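(* The following decision problem is decidable and NP-hard: given a finite set $G$ of matrices in $\mathrm{SL}(2,\mathbb{Z})$, generating the multiplicative semigroup $S$, and a matrix $M\in S$, decide whether $M$ has more than one factorization over $G$.
   Context: $\mathrm{SL}(2,\mathbb{Z})$ is the group of $2\times2$ integer matrices with determinant $1$. For a finite set $G$ of matrices, $S=\langle G\rangle$ denotes the semigroup of all finite nonempty products of elements of $G$. A factorization of $M\in S$ over $G$ is a finite nonempty sequence $(A_1,\dots,A_t)$ of elements of $G$ with $A_1A_2\cdots A_t=M$; two factorizations are different if they are different sequences. *)

theory Defs
  imports "HOL-Analysis.Analysis" "HOL-Computational_Algebra.Polynomial"
begin

section \<open>Turing machines\<close>

datatype move = MoveLeft | Stay | MoveRight

text \<open>
  Nondeterministic multitape Turing machines. States and tape symbols are initial segments of the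
  natural numbers; symbol 0 is the blank, symbols 1 and 2 are the input bits. Given a state and the
  list of scanned symbols (one per tape), the transition relation offers successor states together
  with a symbol to write and a head movement for each tape.
\<close>

record tm =
  tapes :: nat
  states :: nat
  symbols :: nat
  initial :: nat
  accepting :: "nat set"
  trans :: "nat \<Rightarrow> nat list \<Rightarrow> (nat \<times> (nat \<times> move) list) set"

definition well_formed :: "tm \<Rightarrow> bool" where
  "well_formed M \<longleftrightarrow> tapes M \<ge> 1 \<and> symbols M \<ge> 3 \<and> initial M < states M \<and>
     (\<forall>q < states M. \<forall>xs. length xs = tapes M \<and> set xs \<subseteq> {..<symbols M} \<longrightarrow>
        (\<forall>(q', acts) \<in> trans M q xs.
           q' < states M \<and> length acts = tapes M \<and> fst ` set acts \<subseteq> {..<symbols M}))"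

definition deterministic :: "tm \<Rightarrow> bool" where
  "deterministic M \<longleftrightarrow> (\<forall>q xs. \<forall>a \<in> trans M q xs. \<forall>b \<in> trans M q xs. a = b)"

text \<open>
  A configuration consists of the state and, for each tape, its contents (two-way infinite)
  and the head position.
\<close>

type_synonym config = "nat \<times> ((int \<Rightarrow> nat) \<times> int) list"

fun shift :: "move \<Rightarrow> int" where
  "shift MoveLeft = - 1"
| "shift Stay = 0"
| "shift MoveRight = 1"

definition step :: "tm \<Rightarrow> config \<Rightarrow> config \<Rightarrow> bool" where
  "step M = (\<lambda>(q, ts) c'.
     \<exists>(q', acts) \<in> trans M q (map (\<lambda>(t, h). t h) ts).
       c' = (q', map2 (\<lambda>(t, h) (a, d). (t(h := a), h + shift d)) ts acts))"

definition bit_symbol :: "bool \<Rightarrow> nat" where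
  "bit_symbol b = (if b then 2 else 1)"

definition input_tape :: "bool list \<Rightarrow> int \<Rightarrow> nat" where
  "input_tape x i = (if 0 \<le> i \<and> i < int (length x) then bit_symbol (x ! nat i) else 0)"

definition init_config :: "tm \<Rightarrow> bool list \<Rightarrow> config" where
  "init_config M x = (initial M, (input_tape x, 0) # replicate (tapes M - 1) (\<lambda>_. 0, 0))"

definition halted :: "tm \<Rightarrow> config \<Rightarrow> bool" where
  "halted M c \<longleftrightarrow> (\<nexists>c'. step M c c')"

definition accepts :: "tm \<Rightarrow> bool list \<Rightarrow> bool" where
  "accepts M x \<longleftrightarrow>
     (\<exists>c. (step M)\<^sup>*\<^sup>* (init_config M x) c \<and> halted M c \<and> fst c \<in> accepting M)"

text \<open>Only used for deterministic machines: it says that some computation halts without accepting.\<close>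

definition rejects :: "tm \<Rightarrow> bool list \<Rightarrow> bool" where
  "rejects M x \<longleftrightarrow>
     (\<exists>c. (step M)\<^sup>*\<^sup>* (init_config M x) c \<and> halted M c \<and> fst c \<notin> accepting M)"

text \<open>The output is read off the last tape, from cell 0 up to the first blank.\<close>

definition outputs :: "config \<Rightarrow> bool list \<Rightarrow> bool" where
  "outputs c y \<longleftrightarrow> (let t = fst (last (snd c)) in
     (\<forall>i < length y. t (int i) = bit_symbol (y ! i)) \<and> t (int (length y)) = 0)"


section \<open>Decidability and NP-hardness\<close>

definition polytime_computable :: "(bool list \<Rightarrow> bool list) \<Rightarrow> bool" where
  "polytime_computable f \<longleftrightarrow> (\<exists>M. \<exists>p :: nat poly. well_formed M \<and> deterministic M \<and>
     (\<forall>x. \<exists>n c. n \<le> poly p (length x) \<and> (step M ^^ n) (init_config M x) c \<and>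
        halted M c \<and> outputs c (f x)))"

text \<open>All computations of the machine, accepting or not, obey the time bound.\<close>

definition NP :: "bool list set set" where
  "NP = {L. \<exists>M. \<exists>p :: nat poly. well_formed M \<and>
     (\<forall>x n c. (step M ^^ n) (init_config M x) c \<longrightarrow> n \<le> poly p (length x)) \<and>
     (\<forall>x. x \<in> L \<longleftrightarrow> accepts M x)}"

text \<open>
  A decision problem is given by its (encoded) yes-instances and no-instances. Strings in neither
  set are not instances: an algorithm may behave arbitrarily on them, and a reduction
  must not produce them.
\<close>

type_synonym decision_problem = "bool list set \<times> bool list set"

definition decidable :: "decision_problem \<Rightarrow> bool" where
  "decidable = (\<lambda>(Yes, No). \<exists>M. well_formed M \<and> deterministic M \<and>
     (\<forall>x \<in> Yes. accepts M x) \<and> (\<forall>x \<in> No. rejects M x))"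

definition NP_hard :: "decision_problem \<Rightarrow> bool" where
  "NP_hard = (\<lambda>(Yes, No). \<forall>L \<in> NP. \<exists>f. polytime_computable f \<and>
     (\<forall>x. (x \<in> L \<longrightarrow> f x \<in> Yes) \<and> (x \<notin> L \<longrightarrow> f x \<in> No)))"


section \<open>Factorizations over a finite set of matrices\<close>

type_synonym mat2 = "int ^ 2 ^ 2"

definition SL2Z :: "mat2 set" where
  "SL2Z = {A. det A = 1}"

definition mat_prod :: "mat2 list \<Rightarrow> mat2" where
  "mat_prod As = foldr (**) As (mat 1)"

definition generated_semigroup :: "mat2 set \<Rightarrow> mat2 set" where
  "generated_semigroup G = {mat_prod As | As. As \<noteq> [] \<and> set As \<subseteq> G}"

definition factorizations :: "mat2 set \<Rightarrow> mat2 \<Rightarrow> mat2 list set" where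
  "factorizations G A = {As. As \<noteq> [] \<and> set As \<subseteq> G \<and> mat_prod As = A}"

definition multiple_factorizations :: "mat2 set \<Rightarrow> mat2 \<Rightarrow> bool" where
  "multiple_factorizations G A \<longleftrightarrow>
     (\<exists>As \<in> factorizations G A. \<exists>Bs \<in> factorizations G A. As \<noteq> Bs)"


section \<open>Binary encoding of instances\<close>

text \<open>
  Lists are made self-delimiting by marking each element with True and the end with False.
  Integers are written in binary: the sign bit, then the absolute value, least significant bit
  first, without leading zeros.
\<close>

definition enc_list :: "('a \<Rightarrow> bool list) \<Rightarrow> 'a list \<Rightarrow> bool list" where
  "enc_list e xs = concat (map (\<lambda>x. True # e x) xs) @ [False]"

fun nat_bits :: "nat \<Rightarrow> bool list" where
  "nat_bits n = (if n = 0 then [] else odd n # nat_bits (n div 2))"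

declare nat_bits.simps [simp del]

definition enc_int :: "int \<Rightarrow> bool list" where
  "enc_int k = (k < 0) # enc_list (\<lambda>b. [b]) (nat_bits (nat \<bar>k\<bar>))"

definition enc_mat :: "mat2 \<Rightarrow> bool list" where
  "enc_mat A = enc_int (A $ 1 $ 1) @ enc_int (A $ 1 $ 2) @ enc_int (A $ 2 $ 1) @ enc_int (A $ 2 $ 2)"

definition enc_instance :: "mat2 list \<Rightarrow> mat2 \<Rightarrow> bool list" where
  "enc_instance Gs A = enc_list enc_mat Gs @ enc_mat A"

text \<open>A finite set is presented by listing its elements, in any order but without repetition.\<close>

definition encodes :: "bool list \<Rightarrow> mat2 set \<Rightarrow> mat2 \<Rightarrow> bool" where
  "encodes w G A \<longleftrightarrow> (\<exists>Gs. distinct Gs \<and> set Gs = G \<and> w = enc_instance Gs A)"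

definition multiple_factorization_problem :: decision_problem where
  "multiple_factorization_problem =
     ({w. \<exists>G A. finite G \<and> G \<subseteq> SL2Z \<and> A \<in> generated_semigroup G \<and> encodes w G A \<and>
        multiple_factorizations G A},
      {w. \<exists>G A. finite G \<and> G \<subseteq> SL2Z \<and> A \<in> generated_semigroup G \<and> encodes w G A \<and>
        \<not> multiple_factorizations G A})"

text \<open>A string encodes at most one instance, so the yes- and no-instances are disjoint.\<close>

lemma enc_list_prefix_free:
  assumes e: "\<And>x y r s. e x @ r = e y @ s \<Longrightarrow> x = y \<and> r = s"
  shows "enc_list e xs @ r = enc_list e ys @ s \<Longrightarrow> xs = ys \<and> r = s"
proof (induction xs arbitrary: ys)
  case Nil
  then show ?case by (cases ys) (auto simp: enc_list_def)
next
  case (Cons x xs)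
  from Cons.prems obtain y ys' where ys: "ys = y # ys'"
    by (cases ys) (auto simp: enc_list_def)
  from Cons.prems have "e x @ (enc_list e xs @ r) = e y @ (enc_list e ys' @ s)"
    by (simp add: ys enc_list_def)
  from e[OF this] Cons.IH[of ys'] show ?case by (simp add: ys)
qed

lemma inj_nat_bits: "nat_bits m = nat_bits n \<Longrightarrow> m = n"
proof (induction m arbitrary: n rule: less_induct)
  case (less m)
  show ?case
  proof (cases "m = 0 \<or> n = 0")
    case True
    with less.prems show ?thesis
      by (auto simp: nat_bits.simps[of m] nat_bits.simps[of n] split: if_splits)
  next
    case False
    with less.prems have "odd m = odd n" "nat_bits (m div 2) = nat_bits (n div 2)"
      by (simp_all add: nat_bits.simps[of m] nat_bits.simps[of n])
    with less.IH[of "m div 2" "n div 2"] False have "m div 2 = n div 2" "odd m = odd n" by auto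
    then show ?thesis by presburger
  qed
qed

lemma enc_int_prefix_free: "enc_int k @ r = enc_int l @ s \<Longrightarrow> k = l \<and> r = s"
proof -
  assume "enc_int k @ r = enc_int l @ s"
  then have sgn: "(k < 0) = (l < 0)"
    and "enc_list (\<lambda>b. [b]) (nat_bits (nat \<bar>k\<bar>)) @ r = enc_list (\<lambda>b. [b]) (nat_bits (nat \<bar>l\<bar>)) @ s"
    by (auto simp: enc_int_def)
  from enc_list_prefix_free[OF _ this(2)]
  have "nat_bits (nat \<bar>k\<bar>) = nat_bits (nat \<bar>l\<bar>)" "r = s" by auto
  with inj_nat_bits[of "nat \<bar>k\<bar>" "nat \<bar>l\<bar>"] sgn show ?thesis by auto
qed

lemma enc_mat_prefix_free: "enc_mat A @ r = enc_mat B @ s \<Longrightarrow> A = B \<and> r = s"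
  by (auto simp: enc_mat_def vec_eq_iff forall_2 dest!: enc_int_prefix_free)

lemma encodes_unique:
  assumes "encodes w G A" "encodes w H B"
  shows "G = H \<and> A = B"
proof -
  from assms obtain Gs Hs where "set Gs = G" "set Hs = H"
    and eq: "enc_list enc_mat Gs @ enc_mat A = enc_list enc_mat Hs @ enc_mat B"
    by (auto simp: encodes_def enc_instance_def)
  from enc_list_prefix_free[OF enc_mat_prefix_free eq] have "Gs = Hs" "enc_mat A = enc_mat B"
    by auto
  with enc_mat_prefix_free[of A "[]" B "[]"] \<open>set Gs = G\<close> \<open>set Hs = H\<close> show ?thesis by auto
qed

end

theory Submission
  imports Defs
begin

text \<open>
  Machines are programmed in a counter language; a counter is a tape whose head position is its value.

  Decidability. In a normal form of SL(2,Z) over the free product decomposition of PSL(2,Z),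
  multiplication by a generator only changes the end of the word, so a factorization moves like a
  stack. A pigeonhole argument on the stack heights shows that every long factorization can be
  shortened by a bounded number of factors. Hence two factorizations exist only if two short ones do,
  with a computable bound, and these can be counted.

  NP-hardness. A computation of bounded length is a tiling of a grid by tiles with colored edges. If a
  tile covers its bottom and left colors, and at the top and right edges all colors but its own, then
  tilings are exact covers. Read as digits in a large base, exact covers are the solutions of a knapsack
  equation with target \<open>Y\<close>, and the matrices with rows \<open>(1, y)\<close> and \<open>(0, 1)\<close> multiply like the numbers \<open>y\<close>
  add. With the matrix of \<open>Y\<close> among the generators, a second factorization of it is a solution.
\<close>

section \<open>A counter language and its compilation to Turing machines\<close>

text \<open>Counters are unary, yet they suffice for a polynomial-time reduction: the knapsack
  numbers have polynomially many bits but exponential values, and they are never held in a counter.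
  They are only emitted, bit by bit, by nested loops whose indices stay polynomial; the base is a
  power of two, so that a digit is a fixed block of bits and no arithmetic on large numbers occurs.
  Decidability needs no time bound at all, so there everything is primitive recursion on codes,
  followed by one unbounded search that guesses the instance instead of parsing the input. The
  obstacle in the decidability proof is that it does not suffice to shorten long factorizations
  somehow: a shortening might lead from a long factorization straight to the only short one, and the
  second factorization would be lost. Therefore the number of removed factors has to be bounded as
  well, and this is why the part above a high level of the stack is treated by nested passages whose
  distance is controlled.\<close>

datatype test = NZ nat | Sym "nat set"

datatype com = SKIP | ABORT | Inc nat | Dec nat | Emit bool
  | Seq com com (infixr ";;" 60) | Cond test com com | While test com

type_synonym store = "nat \<Rightarrow> nat"

text \<open>Counter 0 is the position of the input head.\<close>

fun holds :: "bool list \<Rightarrow> store \<Rightarrow> test \<Rightarrow> bool" where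
  "holds x s (NZ r) \<longleftrightarrow> s r \<noteq> 0"
| "holds x s (Sym A) \<longleftrightarrow> input_tape x (int (s 0)) \<in> A"

text \<open>The number counts exactly the small steps of \<open>cstep\<close>; the extra
  \<open>Suc\<close> in \<open>run_Seq\<close> and \<open>run_WhileT\<close> is the step that
  discards a finished \<open>SKIP\<close>. \<open>ABORT\<close> has no rule.\<close>

inductive run :: "bool list \<Rightarrow> com \<Rightarrow> store \<times> bool list \<Rightarrow> nat \<Rightarrow> store \<times> bool list \<Rightarrow> bool" for x where
  run_SKIP: "run x SKIP \<sigma> 0 \<sigma>"
| run_Inc: "run x (Inc r) (s, w) 1 (s(r := Suc (s r)), w)"
| run_Dec: "run x (Dec r) (s, w) 1 (s(r := s r - 1), w)"
| run_Emit: "run x (Emit b) (s, w) 1 (s, w @ [b])"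
| run_Seq: "run x c1 \<sigma> t1 \<sigma>1 \<Longrightarrow> run x c2 \<sigma>1 t2 \<sigma>2 \<Longrightarrow> run x (c1 ;; c2) \<sigma> (t1 + Suc t2) \<sigma>2"
| run_CondT: "holds x (fst \<sigma>) b \<Longrightarrow> run x c1 \<sigma> t \<sigma>1 \<Longrightarrow> run x (Cond b c1 c2) \<sigma> (Suc t) \<sigma>1"
| run_CondF: "\<not> holds x (fst \<sigma>) b \<Longrightarrow> run x c2 \<sigma> t \<sigma>1 \<Longrightarrow> run x (Cond b c1 c2) \<sigma> (Suc t) \<sigma>1"
| run_WhileF: "\<not> holds x (fst \<sigma>) b \<Longrightarrow> run x (While b c) \<sigma> 1 \<sigma>"
| run_WhileT: "holds x (fst \<sigma>) b \<Longrightarrow> run x c \<sigma> t1 \<sigma>1 \<Longrightarrow> run x (While b c) \<sigma>1 t2 \<sigma>2 \<Longrightarrow>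
     run x (While b c) \<sigma> (Suc (t1 + Suc t2)) \<sigma>2"

section \<open>Small-step semantics of counter programs\<close>

datatype act = ANone | AInc nat | ADec nat | AEmit bool

text \<open>The store enters only through the truth values \<open>p\<close> of the tests. So the
  same function describes the program, with \<open>holds\<close>, and its machine, with
  \<open>obs\<close>.\<close>

fun nxt :: "(test \<Rightarrow> bool) \<Rightarrow> com \<Rightarrow> (com \<times> act) option" where
  "nxt p SKIP = None"
| "nxt p ABORT = None"
| "nxt p (Inc r) = Some (SKIP, AInc r)"
| "nxt p (Dec r) = Some (SKIP, ADec r)"
| "nxt p (Emit b) = Some (SKIP, AEmit b)"
| "nxt p (c1 ;; c2) =
     (if c1 = SKIP then Some (c2, ANone) else map_option (\<lambda>(c, a). (c ;; c2, a)) (nxt p c1))"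
| "nxt p (Cond b c1 c2) = Some (if p b then c1 else c2, ANone)"
| "nxt p (While b c) = Some (if p b then c ;; While b c else SKIP, ANone)"

fun perform :: "act \<Rightarrow> store \<times> bool list \<Rightarrow> store \<times> bool list" where
  "perform ANone \<sigma> = \<sigma>"
| "perform (AInc r) (s, w) = (s(r := Suc (s r)), w)"
| "perform (ADec r) (s, w) = (s(r := s r - 1), w)"
| "perform (AEmit b) (s, w) = (s, w @ [b])"

definition cstep :: "bool list \<Rightarrow> com \<times> store \<times> bool list \<Rightarrow> com \<times> store \<times> bool list \<Rightarrow> bool" where
  "cstep x = (\<lambda>(c, \<sigma>) (c', \<sigma>'). \<exists>a. nxt (holds x (fst \<sigma>)) c = Some (c', a) \<and> \<sigma>' = perform a \<sigma>)"

lemma cstep_Seq_left: "cstep x (c1, \<sigma>) (c1', \<sigma>') \<Longrightarrow> cstep x (c1 ;; c2, \<sigma>) (c1' ;; c2, \<sigma>')"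
  by (cases "c1 = SKIP") (auto simp: cstep_def)

lemma csteps_Seq_left:
  "(cstep x ^^ n) (c1, \<sigma>) (c1', \<sigma>') \<Longrightarrow> (cstep x ^^ n) (c1 ;; c2, \<sigma>) (c1' ;; c2, \<sigma>')"
proof (induction n arbitrary: c1' \<sigma>')
  case (Suc n)
  then obtain c3 \<sigma>3 where "(cstep x ^^ n) (c1, \<sigma>) (c3, \<sigma>3)" "cstep x (c3, \<sigma>3) (c1', \<sigma>')"
    by (auto elim!: relpowp_Suc_E)
  with Suc.IH cstep_Seq_left show ?case by (blast intro: relpowp_Suc_I)
qed simp

lemma csteps_Seq:
  assumes "(cstep x ^^ m) (c1, \<sigma>) (SKIP, \<sigma>1)" "(cstep x ^^ n) (c2, \<sigma>1) (c3, \<sigma>2)"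
  shows "(cstep x ^^ (m + Suc n)) (c1 ;; c2, \<sigma>) (c3, \<sigma>2)"
proof -
  have "cstep x (SKIP ;; c2, \<sigma>1) (c2, \<sigma>1)" by (simp add: cstep_def)
  then have "(cstep x ^^ Suc n) (SKIP ;; c2, \<sigma>1) (c3, \<sigma>2)"
    using assms(2) by (rule relpowp_Suc_I2)
  with csteps_Seq_left[OF assms(1)] show ?thesis
    unfolding relpowp_add by (rule relcomppI)
qed

lemma run_csteps: "run x c \<sigma> t \<sigma>' \<Longrightarrow> (cstep x ^^ t) (c, \<sigma>) (SKIP, \<sigma>')"
proof (induction rule: run.induct)
  case (run_Seq c1 \<sigma> t1 \<sigma>1 c2 t2 \<sigma>2)
  then show ?case by (blast intro: csteps_Seq)
next
  case (run_CondT \<sigma> b c1 t \<sigma>1 c2)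
  then have "cstep x (Cond b c1 c2, \<sigma>) (c1, \<sigma>)" by (simp add: cstep_def)
  with run_CondT.IH show ?case by (blast intro: relpowp_Suc_I2)
next
  case (run_CondF \<sigma> b c2 t \<sigma>1 c1)
  then have "cstep x (Cond b c1 c2, \<sigma>) (c2, \<sigma>)" by (simp add: cstep_def)
  with run_CondF.IH show ?case by (blast intro: relpowp_Suc_I2)
next
  case (run_WhileF \<sigma> b c)
  then show ?case by (simp add: cstep_def eq_OO)
next
  case (run_WhileT \<sigma> b c t1 \<sigma>1 t2 \<sigma>2)
  then have "cstep x (While b c, \<sigma>) (c ;; While b c, \<sigma>)" by (simp add: cstep_def)
  with csteps_Seq[OF run_WhileT.IH] show ?case by (blast intro: relpowp_Suc_I2)
qed (simp_all add: cstep_def eq_OO)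

text \<open>A finite set that contains every program reachable from the given one; its elements
  become the states of the machine.\<close>

fun subs :: "com \<Rightarrow> com set" where
  "subs (c1 ;; c2) = (\<lambda>c. c ;; c2) ` subs c1 \<union> subs c2"
| "subs (Cond b c1 c2) = {Cond b c1 c2} \<union> subs c1 \<union> subs c2"
| "subs (While b c) = {While b c, SKIP} \<union> (\<lambda>d. d ;; While b c) ` subs c"
| "subs SKIP = {SKIP}"
| "subs ABORT = {ABORT}"
| "subs (Inc r) = {Inc r, SKIP}"
| "subs (Dec r) = {Dec r, SKIP}"
| "subs (Emit b) = {Emit b, SKIP}"

lemma finite_subs: "finite (subs c)"
  by (induction c) auto

lemma subs_self: "c \<in> subs c"
  by (induction c) auto

lemma subs_nxt: "d \<in> subs c \<Longrightarrow> nxt p d = Some (d', a) \<Longrightarrow> d' \<in> subs c"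
proof (induction c arbitrary: d d')
  case (Seq c1 c2)
  then show ?case by (auto simp: subs_self split: if_splits)
next
  case (Cond b c1 c2)
  then show ?case by (auto simp: subs_self split: if_splits)
next
  case (While b c)
  then show ?case by (auto simp: subs_self split: if_splits)
qed auto

fun wf_test :: "nat \<Rightarrow> test \<Rightarrow> bool" where
  "wf_test k (NZ r) \<longleftrightarrow> r < k"
| "wf_test k (Sym A) \<longleftrightarrow> True"

fun wf_com :: "nat \<Rightarrow> com \<Rightarrow> bool" where
  "wf_com k (Inc r) \<longleftrightarrow> r < k"
| "wf_com k (Dec r) \<longleftrightarrow> r < k"
| "wf_com k (c1 ;; c2) \<longleftrightarrow> wf_com k c1 \<and> wf_com k c2"
| "wf_com k (Cond b c1 c2) \<longleftrightarrow> wf_test k b \<and> wf_com k c1 \<and> wf_com k c2"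
| "wf_com k (While b c) \<longleftrightarrow> wf_test k b \<and> wf_com k c"
| "wf_com k _ \<longleftrightarrow> True"

fun wf_act :: "nat \<Rightarrow> act \<Rightarrow> bool" where
  "wf_act k (AInc r) \<longleftrightarrow> r < k"
| "wf_act k (ADec r) \<longleftrightarrow> r < k"
| "wf_act k _ \<longleftrightarrow> True"

lemma wf_com_mono: "wf_com k c \<Longrightarrow> k \<le> l \<Longrightarrow> wf_com l c"
proof (induction c)
  case (Cond b c1 c2) then show ?case by (cases b) auto
next
  case (While b c) then show ?case by (cases b) auto
qed auto

lemma wf_test_exists: "\<exists>j. \<forall>m\<ge>j. wf_test m b"
proof (cases b)
  case (NZ r)
  then show ?thesis by (intro exI[of _ "Suc r"]) auto
qed simp

lemma wf_com_exists: "\<exists>k\<ge>1. wf_com k c"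
proof (induction c)
  case (Seq c1 c2)
  then obtain k l where "k \<ge> 1" "wf_com k c1" "wf_com l c2" by auto
  then show ?case using wf_com_mono[of k c1 "max k l"] wf_com_mono[of l c2 "max k l"]
    by (intro exI[of _ "max k l"]) auto
next
  case (Cond b c1 c2)
  then obtain k l where "k \<ge> 1" "wf_com k c1" "wf_com l c2" by auto
  moreover obtain j where "\<forall>m\<ge>j. wf_test m b" using wf_test_exists by blast
  ultimately show ?case
    using wf_com_mono[of k c1 "max j (max k l)"] wf_com_mono[of l c2 "max j (max k l)"]
    by (intro exI[of _ "max j (max k l)"]) auto
next
  case (While b c)
  then obtain k where "k \<ge> 1" "wf_com k c" by auto
  moreover obtain j where "\<forall>m\<ge>j. wf_test m b" using wf_test_exists by blast
  ultimately show ?case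
    using wf_com_mono[of k c "max j k"] by (intro exI[of _ "max j k"]) auto
qed (auto intro: exI[of _ "Suc _"])

lemma nxt_wf: "wf_com k c \<Longrightarrow> nxt p c = Some (c', a) \<Longrightarrow> wf_com k c' \<and> wf_act k a"
proof (induction c arbitrary: c')
  case (Seq c1 c2)
  show ?case
  proof (cases "c1 = SKIP")
    case True
    with Seq.prems show ?thesis by auto
  next
    case False
    with Seq.prems(2) obtain d where "nxt p c1 = Some (d, a)" "c' = d ;; c2" by auto
    with Seq.IH(1)[of d] Seq.prems(1) show ?thesis by simp
  qed
next
  case (Cond b c1 c2)
  show ?case using Cond.prems by (cases "p b") auto
next
  case (While b c)
  show ?case using While.prems by (cases "p b") auto
qed auto

lemma nxt_cong: "wf_com k c \<Longrightarrow> (\<And>b. wf_test k b \<Longrightarrow> p b = q b) \<Longrightarrow> nxt p c = nxt q c"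
  by (induction c) auto

text \<open>A counter is a tape whose head position is the value; cell 0 is marked by adding 3 to its symbol.\<close>

fun obs :: "nat list \<Rightarrow> test \<Rightarrow> bool" where
  "obs xs (NZ r) \<longleftrightarrow> xs ! r < 3"
| "obs xs (Sym A) \<longleftrightarrow> xs ! 0 mod 3 \<in> A"

text \<open>Tape \<open>k\<close> is the output tape. A decrement at the marked cell 0 does not
  move, which realizes the truncated subtraction of \<open>perform\<close>.\<close>

definition act_moves :: "nat \<Rightarrow> act \<Rightarrow> nat list \<Rightarrow> (nat \<times> move) list" where
  "act_moves k a xs = map (\<lambda>r.
     if r < k \<and> a = AInc r then (xs ! r, MoveRight)
     else if r < k \<and> a = ADec r \<and> xs ! r < 3 then (xs ! r, MoveLeft)
     else if r = k \<and> a = AEmit True then (bit_symbol True, MoveRight)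
     else if r = k \<and> a = AEmit False then (bit_symbol False, MoveRight)
     else (xs ! r, Stay)) [0..<Suc k]"

text \<open>\<open>SKIP\<close> is the accepting state and has to be distinguishable from all others
  even if it is unreachable.\<close>

definition program_states :: "com \<Rightarrow> com set" where
  "program_states c = insert SKIP (subs c)"

definition idx :: "com \<Rightarrow> com \<Rightarrow> nat" where
  "idx c = (SOME f. bij_betw f (program_states c) {0..<card (program_states c)})"

lemma bij_idx: "bij_betw (idx c) (program_states c) {0..<card (program_states c)}"
proof -
  have "\<exists>f. bij_betw f (program_states c) {0..<card (program_states c)}"
    by (rule ex_bij_betw_finite_nat) (simp add: program_states_def finite_subs)
  then show ?thesis unfolding idx_def by (rule someI_ex)
qed

text \<open>State 0 is used for one step only, which marks cell 0 of every counter tape; afterwards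
  program \<open>d\<close> is represented by the state \<open>Suc (idx c d)\<close>. Marking needs a
  second copy of the three symbols, hence 6.\<close>

definition tm_of :: "nat \<Rightarrow> com \<Rightarrow> tm" where
  "tm_of k c = \<lparr>tapes = Suc k, states = Suc (card (program_states c)), symbols = 6, initial = 0,
     accepting = {Suc (idx c SKIP)},
     trans = (\<lambda>q xs.
       if q = 0 then
         {(Suc (idx c c), map (\<lambda>a. (a mod 3 + 3, Stay)) (take k xs) @ map (\<lambda>a. (a, Stay)) (drop k xs))}
       else if q < Suc (card (program_states c)) then
         (case nxt (obs xs) (inv_into (program_states c) (idx c) (q - 1)) of
            None \<Rightarrow> {}
          | Some (d, a) \<Rightarrow> {(Suc (idx c d), act_moves k a xs)})
       else {})\<rparr>"

lemma program_states_nxt: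
  "d \<in> program_states c \<Longrightarrow> nxt p d = Some (d', a) \<Longrightarrow> d' \<in> program_states c"
  by (auto simp: program_states_def subs_nxt)

lemma idx_less: "d \<in> program_states c \<Longrightarrow> idx c d < card (program_states c)"
  using bij_idx[of c] by (auto simp: bij_betw_def)

lemma inv_idx: "d \<in> program_states c \<Longrightarrow> inv_into (program_states c) (idx c) (idx c d) = d"
  using bij_idx[of c] by (simp add: bij_betw_def)

lemma idx_inj: "d \<in> program_states c \<Longrightarrow> e \<in> program_states c \<Longrightarrow> idx c d = idx c e \<longleftrightarrow> d = e"
  using bij_idx[of c] by (auto simp: bij_betw_def inj_on_def)

lemma set_act_moves: "length xs = Suc k \<Longrightarrow> set xs \<subseteq> {..<6} \<Longrightarrow> fst ` set (act_moves k a xs) \<subseteq> {..<6}"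
proof -
  assume "length xs = Suc k" "set xs \<subseteq> {..<6}"
  then have "xs ! r < 6" if "r < Suc k" for r
    using that nth_mem[of r xs] by (metis lessThan_iff subset_iff)
  then show ?thesis
    unfolding act_moves_def set_map image_image bit_symbol_def
    by (intro image_subsetI) (simp del: upt_Suc)
qed

lemma well_formed_tm_of: "well_formed (tm_of k c)"
proof -
  have "q' < Suc (card (program_states c)) \<and> length acts = Suc k \<and> fst ` set acts \<subseteq> {..<6}"
    if q: "q < Suc (card (program_states c))" and xs: "length xs = Suc k" "set xs \<subseteq> {..<6}"
      and tr: "(q', acts) \<in> trans (tm_of k c) q xs" for q xs q' acts
  proof (cases "q = 0")
    case True
    moreover have "a mod 3 + 3 < 6" for a :: nat using mod_less_divisor[of 3 a] by linarith
    moreover have "set (drop k xs) \<subseteq> {..<6}" using xs(2) set_drop_subset by fast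
    ultimately show ?thesis using xs tr idx_less[of c c]
      by (auto simp: tm_of_def program_states_def subs_self)
  next
    case False
    define d where "d = inv_into (program_states c) (idx c) (q - 1)"
    have "q - 1 \<in> idx c ` program_states c"
      using bij_idx[of c] q False by (auto simp: bij_betw_def)
    then have d: "d \<in> program_states c" unfolding d_def by (rule inv_into_into)
    from tr False q obtain e a where "nxt (obs xs) d = Some (e, a)"
      "q' = Suc (idx c e)" "acts = act_moves k a xs"
      by (auto simp: tm_of_def d_def split: option.splits)
    with d xs show ?thesis
      using program_states_nxt[of d c] idx_less[of e c] set_act_moves[of xs k a]
      by (auto simp: act_moves_def)
  qed
  moreover have "tapes (tm_of k c) = Suc k" "states (tm_of k c) = Suc (card (program_states c))"
    "symbols (tm_of k c) = 6" "initial (tm_of k c) = 0" by (simp_all add: tm_of_def)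
  ultimately show ?thesis unfolding well_formed_def by simp blast
qed

lemma deterministic_tm_of: "deterministic (tm_of k c)"
  by (auto simp: deterministic_def tm_of_def split: option.splits)

section \<open>Correctness of the simulation\<close>

definition counter_tape :: "bool list \<Rightarrow> nat \<Rightarrow> int \<Rightarrow> nat" where
  "counter_tape x r i = (if i = 0 then 3 else 0) + (if r = 0 then input_tape x i else 0)"

text \<open>Tape 0 is the input tape and counter 0 at the same time; the head of the output tape
  stands behind the last bit written.\<close>

definition rep :: "nat \<Rightarrow> com \<Rightarrow> bool list \<Rightarrow> com \<times> store \<times> bool list \<Rightarrow> config" where
  "rep k c x = (\<lambda>(d, s, w). (Suc (idx c d),
     map (\<lambda>r. if r < k then (counter_tape x r, int (s r)) else (input_tape w, int (length w))) [0..<Suc k]))"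

lemma input_tape_less: "input_tape x i < 3"
  by (simp add: input_tape_def bit_symbol_def)

lemma obs_rep:
  assumes "k \<ge> 1" "wf_test k b"
  shows "obs (map (\<lambda>(t, h). t h) (snd (rep k c x (d, s, w)))) b = holds x s b"
proof (cases b)
  case (NZ r)
  then show ?thesis using assms input_tape_less[of x]
    by (auto simp: rep_def counter_tape_def simp del: upt_Suc)
next
  case (Sym A)
  then show ?thesis using assms input_tape_less[of x]
    by (auto simp: rep_def counter_tape_def mod_less simp del: upt_Suc)
qed

lemma input_tape_snoc: "(input_tape w)(int (length w) := bit_symbol b) = input_tape (w @ [b])"
  by (rule ext) (auto simp: input_tape_def nth_append nat_less_iff)

lemma rep_perform:
  assumes "k \<ge> 1" "wf_act k a" "snd (rep k c x (d, \<sigma>)) = ts"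
  shows "map2 (\<lambda>(t, h) (a, d). (t(h := a), h + shift d)) ts (act_moves k a (map (\<lambda>(t, h). t h) ts))
    = snd (rep k c x (d', perform a \<sigma>))"
proof -
  obtain s w where \<sigma>: "\<sigma> = (s, w)" by force
  show ?thesis
  proof (rule nth_equalityI)
    fix r assume "r < length (map2 (\<lambda>(t, h) (a, d). (t(h := a), h + shift d)) ts
      (act_moves k a (map (\<lambda>(t, h). t h) ts)))"
    then have r: "r < Suc k" using assms(3) by (auto simp: rep_def \<sigma> act_moves_def)
    show "map2 (\<lambda>(t, h) (a, d). (t(h := a), h + shift d)) ts
      (act_moves k a (map (\<lambda>(t, h). t h) ts)) ! r = snd (rep k c x (d', perform a \<sigma>)) ! r"
      using r assms input_tape_snoc[of w True] input_tape_snoc[of w False] input_tape_less[of x]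
      by (cases a) (auto simp: rep_def \<sigma> act_moves_def counter_tape_def fun_upd_idem
          bit_symbol_def of_nat_diff simp del: upt_Suc split: bool.splits)
  qed (use assms(3) in \<open>auto simp: rep_def \<sigma> act_moves_def split: prod.splits\<close>)
qed

lemma trans_rep:
  assumes "k \<ge> 1" "d \<in> program_states c" "wf_com k d"
  shows "trans (tm_of k c) (fst (rep k c x (d, \<sigma>))) (map (\<lambda>(t, h). t h) (snd (rep k c x (d, \<sigma>)))) =
    (case nxt (holds x (fst \<sigma>)) d of None \<Rightarrow> {}
     | Some (e, a) \<Rightarrow> {(Suc (idx c e), act_moves k a (map (\<lambda>(t, h). t h) (snd (rep k c x (d, \<sigma>)))))})"
proof -
  obtain s w where \<sigma>: "\<sigma> = (s, w)" by force
  have "nxt (obs (map (\<lambda>(t, h). t h) (snd (rep k c x (d, s, w))))) d = nxt (holds x s) d"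
    using obs_rep[OF assms(1)] by (intro nxt_cong[OF assms(3)]) auto
  moreover have "fst (rep k c x (d, s, w)) = Suc (idx c d)" by (simp add: rep_def)
  ultimately show ?thesis using inv_idx[OF assms(2)] idx_less[OF assms(2)]
    unfolding \<sigma> by (simp add: tm_of_def)
qed

lemma step_rep:
  assumes "k \<ge> 1" "d \<in> program_states c" "wf_com k d" "cstep x (d, \<sigma>) (e, \<tau>)"
  shows "step (tm_of k c) (rep k c x (d, \<sigma>)) (rep k c x (e, \<tau>))"
proof -
  from assms(4) obtain a where a: "nxt (holds x (fst \<sigma>)) d = Some (e, a)" "\<tau> = perform a \<sigma>"
    by (auto simp: cstep_def)
  have "wf_act k a" using nxt_wf[OF assms(3) a(1)] by simp
  from rep_perform[OF assms(1) this refl, of c x d \<sigma> e] a(2)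
  show ?thesis
    using trans_rep[OF assms(1-3), of x \<sigma>] a
    by (auto simp: step_def rep_def split: prod.splits)
qed

lemma halted_rep:
  assumes "k \<ge> 1" "d \<in> program_states c" "wf_com k d" "nxt (holds x (fst \<sigma>)) d = None"
  shows "halted (tm_of k c) (rep k c x (d, \<sigma>))"
  using trans_rep[OF assms(1-3), of x \<sigma>] assms(4)
  by (auto simp: halted_def step_def split: prod.splits)

lemma cstep_wf:
  assumes "d \<in> program_states c" "wf_com k d" "cstep x (d, \<sigma>) (e, \<tau>)"
  shows "e \<in> program_states c \<and> wf_com k e"
  using assms program_states_nxt nxt_wf by (fastforce simp: cstep_def)

lemma steps_rep:
  assumes "k \<ge> 1" "wf_com k c" "(cstep x ^^ n) (c, \<sigma>) (e, \<tau>)"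
  shows "(step (tm_of k c) ^^ n) (rep k c x (c, \<sigma>)) (rep k c x (e, \<tau>)) \<and>
    e \<in> program_states c \<and> wf_com k e"
  using assms(3)
proof (induction n arbitrary: e \<tau>)
  case 0
  then show ?case using assms by (auto simp: program_states_def subs_self)
next
  case (Suc n)
  then obtain e' \<tau>' where "(cstep x ^^ n) (c, \<sigma>) (e', \<tau>')" "cstep x (e', \<tau>') (e, \<tau>)"
    by (auto elim!: relpowp_Suc_E)
  with Suc.IH step_rep[OF assms(1)] cstep_wf show ?case by (blast intro: relpowp_Suc_I)
qed

lemma step_init:
  assumes "k \<ge> 1"
  shows "step (tm_of k c) (init_config (tm_of k c) x) (rep k c x (c, (\<lambda>_. 0), []))"
proof -
  let ?ts = "(input_tape x, 0) # replicate k (\<lambda>_. 0, 0 :: int)"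
  let ?xs = "map (\<lambda>(t, h). t h) ?ts"
  let ?acts = "map (\<lambda>a. (a mod 3 + 3, Stay)) (take k ?xs) @ map (\<lambda>a. (a, Stay)) (drop k ?xs)"
  have *: "map2 (\<lambda>(t, h) (a, d). (t(h := a), h + shift d)) ?ts ?acts =
    snd (rep k c x (c, (\<lambda>_. 0), []))"
  proof (rule nth_equalityI)
    fix r assume "r < length (map2 (\<lambda>(t, h) (a, d). (t(h := a), h + shift d)) ?ts ?acts)"
    then have r: "r < Suc k" by simp
    have "?ts ! r = (if r = 0 then input_tape x else (\<lambda>_. 0), 0)" using r by (cases r) auto
    moreover have "?xs ! r = (if r = 0 then input_tape x 0 else 0)" using r by (cases r) auto
    moreover have "?acts ! r = (if r < k then (?xs ! r mod 3 + 3, Stay) else (?xs ! r, Stay))"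
      using r by (cases "r = k") (auto simp: nth_append)
    ultimately show "map2 (\<lambda>(t, h) (a, d). (t(h := a), h + shift d)) ?ts ?acts ! r =
        snd (rep k c x (c, (\<lambda>_. 0), [])) ! r"
      using r assms input_tape_less[of x 0]
      by (auto simp: rep_def counter_tape_def input_tape_def fun_eq_iff simp del: upt_Suc)
  qed (simp add: rep_def)
  have "(Suc (idx c c), ?acts) \<in> trans (tm_of k c) 0 ?xs" by (simp add: tm_of_def)
  with * show ?thesis
    by (auto simp: step_def init_config_def tm_of_def rep_def split: prod.splits)
qed

lemma steps_init:
  assumes "k \<ge> 1" "wf_com k c" "(cstep x ^^ n) (c, (\<lambda>_. 0), []) (e, \<tau>)"
  shows "(step (tm_of k c) ^^ Suc n) (init_config (tm_of k c) x) (rep k c x (e, \<tau>))"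
  using steps_rep[OF assms] step_init[OF assms(1)] by (blast intro: relpowp_Suc_I2)

lemma outputs_rep: "outputs (rep k c x (d, s, w)) w"
  by (simp add: outputs_def rep_def input_tape_def)

lemma polytime_computableI:
  fixes p :: "nat poly"
  assumes run: "\<And>x. \<exists>t s. run x c (\<lambda>_. 0, []) t (s, f x) \<and> t \<le> poly p (length x)"
  shows "polytime_computable f"
proof -
  obtain k where k: "k \<ge> 1" "wf_com k c" using wf_com_exists by blast
  have "\<exists>n d. n \<le> poly (p + 1) (length x) \<and> (step (tm_of k c) ^^ n) (init_config (tm_of k c) x) d \<and>
      halted (tm_of k c) d \<and> outputs d (f x)" for x
  proof -
    obtain t s where "run x c (\<lambda>_. 0, []) t (s, f x)" and t: "t \<le> poly p (length x)" using run by blast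
    then have st: "(cstep x ^^ t) (c, (\<lambda>_. 0), []) (SKIP, s, f x)" by (intro run_csteps)
    have "halted (tm_of k c) (rep k c x (SKIP, s, f x))"
      using steps_rep[OF k st] by (intro halted_rep[OF k(1)]) auto
    with steps_init[OF k st] t outputs_rep show ?thesis
      by (intro exI[of _ "Suc t"] exI) auto
  qed
  then show ?thesis unfolding polytime_computable_def
    using well_formed_tm_of deterministic_tm_of by blast
qed

lemma decidableI:
  assumes run: "\<And>x. x \<in> Yes \<union> No \<Longrightarrow>
    \<exists>t s w. run x c (\<lambda>_. 0, []) t (s, w) \<and> (x \<in> Yes \<longrightarrow> s r = 0) \<and> (x \<in> No \<longrightarrow> s r \<noteq> 0)"
  shows "decidable (Yes, No)"
proof -
  \<comment> \<open>Both ends halt, but only \<open>SKIP\<close> is accepting, so a nonzero counter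
    \<open>r\<close> means rejection.\<close>
  define C where "C = c ;; Cond (NZ r) ABORT SKIP"
  obtain k where k: "k \<ge> 1" "wf_com k C" using wf_com_exists by blast
  have *: "\<exists>d. (step (tm_of k C))\<^sup>*\<^sup>* (init_config (tm_of k C) x) d \<and> halted (tm_of k C) d \<and>
      (x \<in> Yes \<longrightarrow> fst d \<in> accepting (tm_of k C)) \<and> (x \<in> No \<longrightarrow> fst d \<notin> accepting (tm_of k C))"
    if x: "x \<in> Yes \<union> No" for x
  proof -
    obtain t s w where r: "run x c (\<lambda>_. 0, []) t (s, w)" "x \<in> Yes \<longrightarrow> s r = 0" "x \<in> No \<longrightarrow> s r \<noteq> 0"
      using run[OF x] by blast
    define e where "e = (if s r = 0 then SKIP else ABORT)"
    have "(cstep x ^^ 1) (Cond (NZ r) ABORT SKIP, s, w) (e, s, w)" by (simp add: cstep_def e_def eq_OO)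
    from csteps_Seq[OF run_csteps[OF r(1)] this]
    have st: "(cstep x ^^ (t + Suc 1)) (C, (\<lambda>_. 0), []) (e, s, w)" unfolding C_def .
    have e: "e \<in> program_states C" "wf_com k e" using steps_rep[OF k st] by auto
    have "halted (tm_of k C) (rep k C x (e, s, w))"
      by (rule halted_rep[OF k(1) e]) (simp add: e_def)
    moreover have "fst (rep k C x (e, s, w)) \<in> accepting (tm_of k C) \<longleftrightarrow> e = SKIP"
      using idx_inj[OF e(1), of SKIP] by (simp add: rep_def tm_of_def program_states_def)
    ultimately show ?thesis
      using relpowp_imp_rtranclp[OF steps_init[OF k st]] r
      by (intro exI[of _ "rep k C x (e, s, w)"]) (auto simp: e_def)
  qed
  have "\<forall>x \<in> Yes. accepts (tm_of k C) x" "\<forall>x \<in> No. rejects (tm_of k C) x"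
    unfolding accepts_def rejects_def using * by blast+
  then show ?thesis unfolding decidable_def
    using well_formed_tm_of[of k C] deterministic_tm_of[of k C] by blast
qed

section \<open>Expressions over counters\<close>

text \<open>The flag \<open>P\<close> switches the time bound on. One correctness proof of the
  compiler thus serves both polynomial-time programs and primitive recursion, where only termination
  matters.\<close>

definition runs :: "bool list \<Rightarrow> bool \<Rightarrow> nat \<Rightarrow> com \<Rightarrow> store \<times> bool list \<Rightarrow> store \<times> bool list \<Rightarrow> bool" where
  "runs x P b c \<sigma> \<sigma>' \<longleftrightarrow> (\<exists>t. run x c \<sigma> t \<sigma>' \<and> (P \<longrightarrow> t \<le> b))"

lemma runs_mono: "runs x P b c \<sigma> \<sigma>' \<Longrightarrow> (P \<Longrightarrow> b \<le> b') \<Longrightarrow> runs x P b' c \<sigma> \<sigma>'"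
  by (force simp: runs_def)

lemma runs_SKIP: "runs x P 0 SKIP \<sigma> \<sigma>"
  by (auto simp: runs_def intro: run_SKIP)

lemma runs_Inc: "runs x P 1 (Inc r) (s, w) (s(r := Suc (s r)), w)"
  by (auto simp: runs_def intro: run_Inc)

lemma runs_Dec: "runs x P 1 (Dec r) (s, w) (s(r := s r - 1), w)"
  unfolding runs_def by (blast intro: run_Dec)

lemma runs_Emit: "runs x P 1 (Emit b) (s, w) (s, w @ [b])"
  unfolding runs_def by (blast intro: run_Emit)

lemma runs_Seq:
  "runs x P b1 c1 \<sigma> \<sigma>1 \<Longrightarrow> runs x P b2 c2 \<sigma>1 \<sigma>2 \<Longrightarrow> runs x P (b1 + b2 + 1) (c1 ;; c2) \<sigma> \<sigma>2"
  unfolding runs_def using run_Seq by (metis Suc_eq_plus1 add.assoc add_Suc_right add_mono le_SucI Suc_le_mono)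

lemma runs_CondT: "holds x (fst \<sigma>) g \<Longrightarrow> runs x P b c1 \<sigma> \<sigma>' \<Longrightarrow> runs x P (b + 1) (Cond g c1 c2) \<sigma> \<sigma>'"
  unfolding runs_def using run_CondT by (metis Suc_eq_plus1 Suc_le_mono)

lemma runs_CondF: "\<not> holds x (fst \<sigma>) g \<Longrightarrow> runs x P b c2 \<sigma> \<sigma>' \<Longrightarrow> runs x P (b + 1) (Cond g c1 c2) \<sigma> \<sigma>'"
  unfolding runs_def using run_CondF by (metis Suc_eq_plus1 Suc_le_mono)

lemma runs_While:
  assumes "\<And>i. i < n \<Longrightarrow> holds x (fst (S i)) g" "\<And>i. i < n \<Longrightarrow> runs x P b c (S i) (S (Suc i))"
    and "\<not> holds x (fst (S n)) g"
  shows "runs x P (n * (b + 2) + 1) (While g c) (S 0) (S n)"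
  using assms
proof (induction n arbitrary: S)
  case 0
  then show ?case unfolding runs_def by (auto intro: run_WhileF)
next
  case (Suc n)
  obtain t1 where t1: "run x c (S 0) t1 (S 1)" "P \<longrightarrow> t1 \<le> b" using Suc.prems(2)[of 0] by (auto simp: runs_def)
  obtain t2 where t2: "run x (While g c) (S 1) t2 (S (Suc n))" "P \<longrightarrow> t2 \<le> n * (b + 2) + 1"
    using Suc.IH[of "\<lambda>i. S (Suc i)"] Suc.prems by (auto simp: runs_def)
  have "run x (While g c) (S 0) (Suc (t1 + Suc t2)) (S (Suc n))"
    using run_WhileT[OF _ t1(1) t2(1)] Suc.prems(1)[of 0] by simp
  then show ?case using t1(2) t2(2) unfolding runs_def by (intro exI) auto
qed

definition mv :: "nat \<Rightarrow> nat \<Rightarrow> com" where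
  "mv a b = While (NZ a) (Dec a ;; Inc b)"

definition clr :: "nat \<Rightarrow> com" where
  "clr a = While (NZ a) (Dec a)"

lemma runs_mv:
  assumes "a \<noteq> b"
  shows "runs x P (s a * 5 + 1) (mv a b) (s, w) (s(a := 0, b := s b + s a), w)"
proof -
  let ?S = "\<lambda>i. (s(a := s a - i, b := s b + i), w)"
  have "runs x P (s a * ((1 + 1 + 1) + 2) + 1) (While (NZ a) (Dec a ;; Inc b)) (?S 0) (?S (s a))"
  proof (rule runs_While)
    fix i assume i: "i < s a"
    then show "holds x (fst (?S i)) (NZ a)" using assms by simp
    have eq: "?S (Suc i) = ((s(a := s a - i, b := s b + i, a := s a - i - 1))(b := Suc ((s(a := s a - i, b := s b + i, a := s a - i - 1)) b)), w)"
      using assms by (auto simp: fun_eq_iff)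
    show "runs x P (1 + 1 + 1) (Dec a ;; Inc b) (?S i) (?S (Suc i))"
      unfolding eq using runs_Dec[of x P a "s(a := s a - i, b := s b + i)" w] assms
      by (intro runs_Seq[OF _ runs_Inc]) simp
  qed (use assms in simp)
  then show ?thesis using assms by (simp add: mv_def numeral_eq_Suc)
qed

lemma runs_clr: "runs x P (s a * 3 + 1) (clr a) (s, w) (s(a := 0), w)"
proof -
  let ?S = "\<lambda>i. (s(a := s a - i), w)"
  have "runs x P (s a * (1 + 2) + 1) (While (NZ a) (Dec a)) (?S 0) (?S (s a))"
  proof (rule runs_While)
    fix i assume i: "i < s a"
    show "runs x P 1 (Dec a) (?S i) (?S (Suc i))"
      using runs_Dec[of x P a "s(a := s a - i)" w] by simp
  qed auto
  then show ?thesis by (simp add: clr_def numeral_eq_Suc)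
qed

text \<open>\<open>In e\<close> is the input symbol at position \<open>e\<close>; the body of \<open>Rec\<close> sees the step number and the
  previous value as the last two variables; \<open>App f e\<close> evaluates \<open>f\<close> with \<open>e\<close> as the only variable.\<close>

datatype exp = Var nat | Const nat | Len | Add exp exp | Mul exp exp | In exp
  | Rec exp exp exp | App exp exp

fun eval :: "bool list \<Rightarrow> nat list \<Rightarrow> exp \<Rightarrow> nat" where
  "eval x env (Var i) = env ! i"
| "eval x env (Const n) = n"
| "eval x env Len = length x"
| "eval x env (Add a b) = eval x env a + eval x env b"
| "eval x env (Mul a b) = eval x env a * eval x env b"
| "eval x env (In a) = input_tape x (int (eval x env a))"
| "eval x env (Rec b f a) = rec_nat (eval x env b) (\<lambda>n r. eval x (env @ [n, r]) f) (eval x env a)"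
| "eval x env (App f a) = eval x [eval x env a] f"

fun scoped :: "nat \<Rightarrow> exp \<Rightarrow> bool" where
  "scoped k (Var i) \<longleftrightarrow> i < k"
| "scoped k (Const n) \<longleftrightarrow> True"
| "scoped k Len \<longleftrightarrow> True"
| "scoped k (Add a b) \<longleftrightarrow> scoped k a \<and> scoped k b"
| "scoped k (Mul a b) \<longleftrightarrow> scoped k a \<and> scoped k b"
| "scoped k (In a) \<longleftrightarrow> scoped k a"
| "scoped k (Rec b f a) \<longleftrightarrow> scoped k b \<and> scoped (k + 2) f \<and> scoped k a"
| "scoped k (App f a) \<longleftrightarrow> scoped 1 f \<and> scoped k a"

text \<open>Without recursion, values are polynomial in the variables and the input length, so that
  even unary evaluation takes polynomial time.\<close>

fun simple :: "exp \<Rightarrow> bool" where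
  "simple (Add a b) \<longleftrightarrow> simple a \<and> simple b"
| "simple (Mul a b) \<longleftrightarrow> simple a \<and> simple b"
| "simple (In a) \<longleftrightarrow> simple a"
| "simple (Rec b f a) \<longleftrightarrow> False"
| "simple (App f a) \<longleftrightarrow> False"
| "simple _ \<longleftrightarrow> True"

fun value_bound :: "exp \<Rightarrow> nat \<Rightarrow> nat" where
  "value_bound (Var i) N = N"
| "value_bound (Const n) N = n"
| "value_bound Len N = N"
| "value_bound (Add a b) N = value_bound a N + value_bound b N"
| "value_bound (Mul a b) N = value_bound a N * value_bound b N"
| "value_bound (In a) N = 2"
| "value_bound _ N = 0"

text \<open>The value 0 for \<open>Rec\<close> and \<open>App\<close> is a dummy: the bound is
  claimed for \<open>simple\<close> expressions only.\<close>

fun time_bound :: "exp \<Rightarrow> nat \<Rightarrow> nat" where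
  "time_bound (Var i) N = 12 * N + 3"
| "time_bound (Const n) N = 2 * n"
| "time_bound Len N = 8 * N + 3"
| "time_bound (Add a b) N = time_bound a N + time_bound b N + 5 * value_bound b N + 3"
| "time_bound (Mul a b) N =
     time_bound a N + value_bound a N * (time_bound b N + 5 * value_bound b N + 6) + 2"
| "time_bound (In a) N = time_bound a N + 8 * value_bound a N + 10"
| "time_bound _ N = 0"

lemma eval_bound:
  "simple e \<Longrightarrow> scoped (length env) e \<Longrightarrow> length x \<le> N \<Longrightarrow> \<forall>v\<in>set env. v \<le> N \<Longrightarrow>
    eval x env e \<le> value_bound e N"
proof (induction e)
  case (In a)
  then show ?case using input_tape_less[of x "int (eval x env a)"] by simp
qed (auto simp: add_mono mult_mono)

text \<open>Calling convention: the counters in \<open>\<rho>\<close> hold the variables, counter 0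
  and all counters from \<open>d\<close> on are zero; afterwards \<open>d\<close> holds the result
  and everything else is as before. Reading a variable empties its counter, so a second copy in
  \<open>d + 1\<close> is made to restore it.\<close>

fun compile :: "nat list \<Rightarrow> nat \<Rightarrow> exp \<Rightarrow> com" where
  "compile \<rho> d (Var i) =
     While (NZ (\<rho> ! i)) (Dec (\<rho> ! i) ;; Inc d ;; Inc (d + 1)) ;; mv (d + 1) (\<rho> ! i)"
| "compile \<rho> d (Const n) = ((\<lambda>c. Inc d ;; c) ^^ n) SKIP"
| "compile \<rho> d Len = While (Sym {1, 2}) (Inc 0 ;; Inc d) ;; clr 0"
| "compile \<rho> d (Add a b) = compile \<rho> d a ;; compile \<rho> (d + 1) b ;; mv (d + 1) d"
| "compile \<rho> d (Mul a b) = compile \<rho> (d + 1) a ;;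
     While (NZ (d + 1)) (Dec (d + 1) ;; compile \<rho> (d + 2) b ;; mv (d + 2) d)"
| "compile \<rho> d (In a) = compile \<rho> (d + 1) a ;; mv (d + 1) 0 ;;
     Cond (Sym {1}) (Inc d) (Cond (Sym {2}) (Inc d ;; Inc d) SKIP) ;; clr 0"
| "compile \<rho> d (Rec b f a) = compile \<rho> d b ;; compile \<rho> (d + 1) a ;;
     While (NZ (d + 1)) (Dec (d + 1) ;; compile (\<rho> @ [d + 2, d]) (d + 3) f ;; clr d ;; mv (d + 3) d ;;
       Inc (d + 2)) ;; clr (d + 2)"
| "compile \<rho> d (App f a) = compile \<rho> (d + 1) a ;; compile [d + 1] (d + 2) f ;; mv (d + 2) d ;; clr (d + 1)"

lemma runs_compile_C: "runs x P (2 * n) (((\<lambda>c. Inc d ;; c) ^^ n) SKIP) (s, w) (s(d := s d + n), w)"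
proof (induction n arbitrary: s)
  case 0
  then show ?case by (simp add: runs_SKIP)
next
  case (Suc n)
  from runs_Seq[OF runs_Inc[of x P d s w] Suc.IH[of "s(d := Suc (s d))"]] show ?case by (simp cong: if_cong)
qed

lemma runs_compile:
  assumes "scoped (length \<rho>) e" "set \<rho> \<subseteq> {1..<d}" "d \<ge> 1" "\<forall>r\<ge>d. s r = 0" "s 0 = 0"
    and "P \<Longrightarrow> simple e \<and> length x \<le> N \<and> (\<forall>r\<in>set \<rho>. s r \<le> N)"
  shows "runs x P (time_bound e N) (compile \<rho> d e) (s, w) (s(d := eval x (map s \<rho>) e), w)"
  using assms
proof (induction e arbitrary: \<rho> d s P)
  case (Var i)
  define v where "v = \<rho> ! i"
  have "v \<in> set \<rho>" using Var.prems(1) by (simp add: v_def)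
  then have v: "v \<in> set \<rho>" "v \<ge> 1" "v < d" using Var.prems(2) by auto
  let ?S = "\<lambda>j. (s(v := s v - j, d := j, d + 1 := j), w)"
  have "runs x P (s v * ((1 + (1 + 1 + 1) + 1) + 2) + 1)
      (While (NZ v) (Dec v ;; Inc d ;; Inc (d + 1))) (?S 0) (?S (s v))"
  proof (rule runs_While)
    fix j assume j: "j < s v"
    show "holds x (fst (?S j)) (NZ v)" using j v by simp
    let ?s1 = "s(v := s v - Suc j, d := j, d + 1 := j)"
    let ?s2 = "?s1(d := Suc j)"
    have 1: "runs x P 1 (Dec v) (?S j) (?s1, w)"
      using runs_Dec[of x P v "fst (?S j)" w] v by (simp add: fun_upd_twist)
    have 2: "runs x P 1 (Inc d) (?s1, w) (?s2, w)"
      using runs_Inc[of x P d ?s1 w] by simp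
    have 3: "runs x P 1 (Inc (d + 1)) (?s2, w) (?S (Suc j))"
      using runs_Inc[of x P "d + 1" ?s2 w] by (simp add: fun_upd_twist)
    show "runs x P (1 + (1 + 1 + 1) + 1) (Dec v ;; Inc d ;; Inc (d + 1)) (?S j) (?S (Suc j))"
      by (rule runs_Seq[OF 1 runs_Seq[OF 2 3]])
  qed (use v in simp)
  moreover have "?S 0 = (s, w)" using Var.prems by (auto simp: fun_eq_iff)
  ultimately have 1: "runs x P (s v * 7 + 1) (While (NZ v) (Dec v ;; Inc d ;; Inc (d + 1))) (s, w) (?S (s v))"
    by (simp add: numeral_eq_Suc)
  have "runs x P (s v * 5 + 1) (mv (d + 1) v) (?S (s v)) (s(d := s v), w)"
    using runs_mv[of "d + 1" v x P "fst (?S (s v))" w] v Var.prems(4)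
    by (simp add: fun_upd_twist fun_upd_idem)
  from runs_Seq[OF 1 this]
  have *: "runs x P (s v * 7 + 1 + (s v * 5 + 1) + 1) (compile \<rho> d (Var i)) (s, w)
      (s(d := eval x (map s \<rho>) (Var i)), w)"
    using Var.prems(1) by (simp add: v_def)
  have sv: "s v \<le> N" if P using Var.prems(6)[OF that] v(1) by auto
  show ?case
    by (rule runs_mono[OF *]) (use sv in auto)
next
  case (Const n)
  then show ?case using runs_compile_C[of x P n d s w] by (simp add: fun_upd_def)
next
  case Len
  let ?S = "\<lambda>j. (s(0 := j, d := j), w)"
  have "runs x P (length x * ((1 + 1 + 1) + 2) + 1) (While (Sym {1, 2}) (Inc 0 ;; Inc d)) (?S 0) (?S (length x))"
  proof (rule runs_While)
    fix j assume j: "j < length x"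
    show "holds x (fst (?S j)) (Sym {1, 2})" using j Len.prems(3)
      by (auto simp: input_tape_def bit_symbol_def)
    have "runs x P 1 (Inc 0) (?S j) ((s(0 := j, d := j))(0 := Suc j), w)"
      using runs_Inc[of x P 0 "fst (?S j)" w] Len.prems(3) by simp
    moreover have "runs x P 1 (Inc d) ((s(0 := j, d := j))(0 := Suc j), w) (?S (Suc j))"
      using runs_Inc[of x P d "(s(0 := j, d := j))(0 := Suc j)" w] Len.prems(3) by (simp add: fun_upd_twist)
    ultimately show "runs x P (1 + 1 + 1) (Inc 0 ;; Inc d) (?S j) (?S (Suc j))"
      by (rule runs_Seq)
  qed (use Len.prems(3) in \<open>auto simp: input_tape_def\<close>)
  moreover have "?S 0 = (s, w)" using Len.prems by (auto simp: fun_eq_iff)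
  ultimately have 1: "runs x P (length x * 5 + 1) (While (Sym {1, 2}) (Inc 0 ;; Inc d)) (s, w) (?S (length x))"
    by (simp add: numeral_eq_Suc)
  have "runs x P (length x * 3 + 1) (clr 0) (?S (length x)) (s(d := length x), w)"
    using runs_clr[of x P "fst (?S (length x))" 0 w] Len.prems(3,5)
    by (simp add: fun_upd_twist fun_upd_idem)
  from runs_Seq[OF 1 this]
  have *: "runs x P (length x * 5 + 1 + (length x * 3 + 1) + 1) (compile \<rho> d Len) (s, w)
      (s(d := eval x (map s \<rho>) Len), w)" by simp
  have xN: "length x \<le> N" if P using Len.prems(6)[OF that] by auto
  show ?case
    by (rule runs_mono[OF *]) (use xN in auto)
next
  case (Add a b)
  let ?va = "eval x (map s \<rho>) a" and ?vb = "eval x (map s \<rho>) b"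
  let ?s1 = "s(d := ?va)" and ?s2 = "s(d := ?va, d + 1 := ?vb)"
  have m: "map ?s1 \<rho> = map s \<rho>" using Add.prems(2) by auto
  have 1: "runs x P (time_bound a N) (compile \<rho> d a) (s, w) (?s1, w)"
    using Add.prems by (intro Add.IH) auto
  have "runs x P (time_bound b N) (compile \<rho> (d + 1) b) (?s1, w)
      (?s1(d + 1 := eval x (map ?s1 \<rho>) b), w)"
    by (rule Add.IH) (use Add.prems in auto)
  then have 2: "runs x P (time_bound b N) (compile \<rho> (d + 1) b) (?s1, w) (?s2, w)"
    unfolding m .
  have 3: "runs x P (?vb * 5 + 1) (mv (d + 1) d) (?s2, w) (s(d := ?va + ?vb), w)"
    using runs_mv[of "d + 1" d x P ?s2 w] Add.prems(4) by (simp add: fun_upd_twist fun_upd_idem)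
  have vb: "?vb \<le> value_bound b N" if P using Add.prems that by (intro eval_bound) auto
  have "runs x P (time_bound (Add a b) N) (compile \<rho> d a ;; compile \<rho> (d + 1) b ;; mv (d + 1) d)
      (s, w) (s(d := ?va + ?vb), w)"
    by (rule runs_mono[OF runs_Seq[OF 1 runs_Seq[OF 2 3]]]) (use vb in auto)
  then show ?case by (simp add: fun_upd_def)
next
  case (Mul a b)
  let ?va = "eval x (map s \<rho>) a" and ?vb = "eval x (map s \<rho>) b"
  let ?S = "\<lambda>j. (s(d := j * ?vb, d + 1 := ?va - j), w)"
  have 1: "runs x P (time_bound a N) (compile \<rho> (d + 1) a) (s, w) (s(d + 1 := ?va), w)"
    using Mul.prems by (intro Mul.IH) auto
  have "runs x P (?va * ((1 + (time_bound b N + (?vb * 5 + 1) + 1) + 1) + 2) + 1)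
      (While (NZ (d + 1)) (Dec (d + 1) ;; compile \<rho> (d + 2) b ;; mv (d + 2) d)) (?S 0) (?S ?va)"
  proof (rule runs_While)
    fix j assume j: "j < ?va"
    show "holds x (fst (?S j)) (NZ (d + 1))" using j by simp
    let ?s1 = "s(d := j * ?vb, d + 1 := ?va - Suc j)"
    have m: "map ?s1 \<rho> = map s \<rho>" using Mul.prems(2) by auto
    have 1: "runs x P 1 (Dec (d + 1)) (?S j) (?s1, w)"
      using runs_Dec[of x P "d + 1" "fst (?S j)" w] by simp
    have "runs x P (time_bound b N) (compile \<rho> (d + 2) b) (?s1, w)
        (?s1(d + 2 := eval x (map ?s1 \<rho>) b), w)"
      by (rule Mul.IH) (use Mul.prems in auto)
    then have 2: "runs x P (time_bound b N) (compile \<rho> (d + 2) b) (?s1, w) (?s1(d + 2 := ?vb), w)"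
      unfolding m .
    have 3: "runs x P (?vb * 5 + 1) (mv (d + 2) d) (?s1(d + 2 := ?vb), w) (?S (Suc j))"
      using runs_mv[of "d + 2" d x P "?s1(d + 2 := ?vb)" w] Mul.prems(4)
      by (simp add: fun_upd_twist fun_upd_idem add.commute)
    show "runs x P (1 + (time_bound b N + (?vb * 5 + 1) + 1) + 1)
        (Dec (d + 1) ;; compile \<rho> (d + 2) b ;; mv (d + 2) d) (?S j) (?S (Suc j))"
      by (rule runs_Seq[OF 1 runs_Seq[OF 2 3]])
  qed simp
  moreover have "?S 0 = (s(d + 1 := ?va), w)" "?S ?va = (s(d := ?va * ?vb), w)"
    using Mul.prems by (auto simp: fun_eq_iff)
  ultimately have 2: "runs x P (?va * (time_bound b N + 5 * ?vb + 6) + 1)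
      (While (NZ (d + 1)) (Dec (d + 1) ;; compile \<rho> (d + 2) b ;; mv (d + 2) d))
      (s(d + 1 := ?va), w) (s(d := ?va * ?vb), w)"
    by (simp add: algebra_simps)
  have vab: "?va * (time_bound b N + 5 * ?vb + 6) \<le> value_bound a N * (time_bound b N + 5 * value_bound b N + 6)" if P
    using Mul.prems that by (intro mult_le_mono add_le_mono mult_le_mono2 eval_bound) auto
  have "runs x P (time_bound (Mul a b) N) (compile \<rho> d (Mul a b)) (s, w) (s(d := ?va * ?vb), w)"
    unfolding compile.simps by (rule runs_mono[OF runs_Seq[OF 1 2]]) (use vab in auto)
  then show ?case by (simp add: fun_upd_def)
next
  case (In a)
  let ?v = "eval x (map s \<rho>) a"
  let ?i = "input_tape x (int ?v)"
  have 1: "runs x P (time_bound a N) (compile \<rho> (d + 1) a) (s, w) (s(d + 1 := ?v), w)"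
    using In.prems by (intro In.IH) auto
  have 2: "runs x P (?v * 5 + 1) (mv (d + 1) 0) (s(d + 1 := ?v), w) (s(0 := ?v), w)"
    using runs_mv[of "d + 1" 0 x P "s(d + 1 := ?v)" w] In.prems(4,5)
    by (simp add: fun_upd_twist fun_upd_idem)
  have sd: "s d = 0" "d \<noteq> 0" using In.prems by auto
  have 3: "runs x P 5 (Cond (Sym {1}) (Inc d) (Cond (Sym {2}) (Inc d ;; Inc d) SKIP))
      (s(0 := ?v), w) (s(0 := ?v, d := ?i), w)"
  proof -
    consider "?i = 1" | "?i = 2" | "?i = 0" using input_tape_less[of x "int ?v"] by linarith
    then show ?thesis
    proof cases
      case 1
      have "runs x P 1 (Inc d) (s(0 := ?v), w) (s(0 := ?v, d := ?i), w)"
        using runs_Inc[of x P d "s(0 := ?v)" w] sd 1 by simp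
      with 1 have "runs x P (1 + 1) (Cond (Sym {1}) (Inc d) (Cond (Sym {2}) (Inc d ;; Inc d) SKIP))
          (s(0 := ?v), w) (s(0 := ?v, d := ?i), w)"
        by (intro runs_CondT) auto
      then show ?thesis by (rule runs_mono) simp
    next
      case 2
      have "runs x P (1 + 1 + 1) (Inc d ;; Inc d) (s(0 := ?v), w) (s(0 := ?v, d := 2), w)"
        using runs_Seq[OF runs_Inc[of x P d "s(0 := ?v)" w] runs_Inc[of x P d "s(0 := ?v, d := Suc ((s(0 := ?v)) d))" w]] sd
        by (simp add: numeral_2_eq_2)
      with 2 have "runs x P ((1 + 1 + 1) + 1 + 1) (Cond (Sym {1}) (Inc d) (Cond (Sym {2}) (Inc d ;; Inc d) SKIP))
          (s(0 := ?v), w) (s(0 := ?v, d := ?i), w)"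
        by (intro runs_CondF runs_CondT) auto
      then show ?thesis by (rule runs_mono) simp
    next
      case 3
      have "runs x P (0 + 1 + 1) (Cond (Sym {1}) (Inc d) (Cond (Sym {2}) (Inc d ;; Inc d) SKIP))
          (s(0 := ?v), w) (s(0 := ?v), w)"
        using 3 by (intro runs_CondF runs_SKIP) auto
      moreover have "s(0 := ?v) = s(0 := ?v, d := ?i)" using sd 3 by (auto simp: fun_eq_iff)
      ultimately show ?thesis by (auto intro: runs_mono)
    qed
  qed
  have 4: "runs x P (?v * 3 + 1) (clr 0) (s(0 := ?v, d := ?i), w) (s(d := ?i), w)"
    using runs_clr[of x P "s(0 := ?v, d := ?i)" 0 w] In.prems(3,5)
    by (simp add: fun_upd_twist fun_upd_idem)
  have v: "?v \<le> value_bound a N" if P using In.prems that by (intro eval_bound) auto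
  have "runs x P (time_bound (In a) N) (compile \<rho> d (In a)) (s, w) (s(d := ?i), w)"
    unfolding compile.simps
    by (rule runs_mono[OF runs_Seq[OF 1 runs_Seq[OF 2 runs_Seq[OF 3 4]]]]) (use v in auto)
  then show ?case by (simp add: fun_upd_def)
next
  case (Rec b f a)
  \<comment> \<open>The last assumption makes \<open>P\<close> imply \<open>simple\<close>, so in
    this case no time is counted and all bounds are vacuous.\<close>
  have nP: "\<not> P" using Rec.prems(6) by auto
  let ?va = "eval x (map s \<rho>) a"
  let ?R = "rec_nat (eval x (map s \<rho>) b) (\<lambda>n r. eval x (map s \<rho> @ [n, r]) f)"
  let ?S = "\<lambda>j. (s(d := ?R j, d + 1 := ?va - j, d + 2 := j), w)"
  have m: "map (s(d := ?R 0)) \<rho> = map s \<rho>" using Rec.prems(2) by auto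
  have 1: "runs x P (time_bound b N) (compile \<rho> d b) (s, w) (s(d := ?R 0), w)"
    unfolding nat.rec by (rule Rec.IH(1)) (use Rec.prems nP in auto)
  have eq: "?S 0 = ((s(d := ?R 0))(d + 1 := eval x (map (s(d := ?R 0)) \<rho>) a), w)"
    unfolding m using Rec.prems(4) by (auto simp: fun_eq_iff)
  have 2: "runs x P (time_bound a N) (compile \<rho> (d + 1) a) (s(d := ?R 0), w) (?S 0)"
    unfolding eq by (rule Rec.IH(3)) (use Rec.prems nP in auto)
  have 3: "runs x P (?va * (0 + 2) + 1)
      (While (NZ (d + 1)) (Dec (d + 1) ;; compile (\<rho> @ [d + 2, d]) (d + 3) f ;; clr d ;; mv (d + 3) d ;;
       Inc (d + 2))) (?S 0) (?S ?va)"
  proof (rule runs_While)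
    fix j assume j: "j < ?va"
    show "holds x (fst (?S j)) (NZ (d + 1))" using j by simp
    let ?s1 = "s(d := ?R j, d + 1 := ?va - Suc j, d + 2 := j)"
    let ?s2 = "?s1(d + 3 := ?R (Suc j))"
    let ?s3 = "?s2(d := 0)"
    let ?s4 = "s(d := ?R (Suc j), d + 1 := ?va - Suc j, d + 2 := j)"
    have m: "map ?s1 (\<rho> @ [d + 2, d]) = map s \<rho> @ [j, ?R j]" using Rec.prems(2) by auto
    have 1: "runs x P 1 (Dec (d + 1)) (?S j) (?s1, w)"
      using runs_Dec[of x P "d + 1" "fst (?S j)" w] by (simp add: fun_upd_twist)
    have "runs x P (time_bound f N) (compile (\<rho> @ [d + 2, d]) (d + 3) f) (?s1, w)
        (?s1(d + 3 := eval x (map ?s1 (\<rho> @ [d + 2, d])) f), w)"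
      by (rule Rec.IH(2)) (use Rec.prems nP in auto)
    then have 2: "runs x P (time_bound f N) (compile (\<rho> @ [d + 2, d]) (d + 3) f) (?s1, w) (?s2, w)"
      unfolding m nat.rec .
    have 3: "runs x P (?s2 d * 3 + 1) (clr d) (?s2, w) (?s3, w)"
      by (rule runs_clr)
    have eq: "?s3(d + 3 := 0, d := ?s3 d + ?s3 (d + 3)) = ?s4"
      using Rec.prems(4) by (auto simp: fun_eq_iff)
    have 4: "runs x P (?s3 (d + 3) * 5 + 1) (mv (d + 3) d) (?s3, w) (?s4, w)"
      using runs_mv[of "d + 3" d x P ?s3 w] unfolding eq by simp
    have 5: "runs x P 1 (Inc (d + 2)) (?s4, w) (?S (Suc j))"
      using runs_Inc[of x P "d + 2" ?s4 w] by simp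
    from runs_Seq[OF 1 runs_Seq[OF 2 runs_Seq[OF 3 runs_Seq[OF 4 5]]]]
    show "runs x P 0 (Dec (d + 1) ;; compile (\<rho> @ [d + 2, d]) (d + 3) f ;; clr d ;; mv (d + 3) d ;;
       Inc (d + 2)) (?S j) (?S (Suc j))"
      by (rule runs_mono) (simp add: nP)
  qed simp
  have eq: "(fst (?S ?va))(d + 2 := 0) = s(d := ?R ?va)"
    using Rec.prems(4) by (auto simp: fun_eq_iff)
  have 4: "runs x P (fst (?S ?va) (d + 2) * 3 + 1) (clr (d + 2)) (?S ?va) (s(d := ?R ?va), w)"
    using runs_clr[of x P "fst (?S ?va)" "d + 2" w] unfolding eq by simp
  from runs_mono[OF runs_Seq[OF 1 runs_Seq[OF 2 runs_Seq[OF 3 4]]]] nP show ?case by (simp add: fun_upd_def)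
next
  case (App f a)
  have nP: "\<not> P" using App.prems(6) by auto
  let ?va = "eval x (map s \<rho>) a"
  let ?vf = "eval x [?va] f"
  let ?s1 = "s(d + 1 := ?va)" and ?s2 = "s(d + 1 := ?va, d + 2 := ?vf)" and ?s3 = "s(d := ?vf, d + 1 := ?va)"
  have 1: "runs x P (time_bound a N) (compile \<rho> (d + 1) a) (s, w) (?s1, w)"
    by (rule App.IH(2)) (use App.prems nP in auto)
  have 2: "runs x P (time_bound f N) (compile [d + 1] (d + 2) f) (?s1, w) (?s2, w)"
    using App.IH(1)[of "[d + 1]" "d + 2" ?s1 P] App.prems nP by (simp add: fun_upd_def)
  have eq: "?s2(d + 2 := 0, d := ?s2 d + ?s2 (d + 2)) = ?s3" using App.prems(4) by (auto simp: fun_eq_iff)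
  have 3: "runs x P (?s2 (d + 2) * 5 + 1) (mv (d + 2) d) (?s2, w) (?s3, w)"
    using runs_mv[of "d + 2" d x P ?s2 w] unfolding eq by simp
  have eq: "?s3(d + 1 := 0) = s(d := ?vf)" using App.prems(4) by (auto simp: fun_eq_iff)
  have 4: "runs x P (?s3 (d + 1) * 3 + 1) (clr (d + 1)) (?s3, w) (s(d := ?vf), w)"
    using runs_clr[of x P ?s3 "d + 1" w] unfolding eq .
  from runs_mono[OF runs_Seq[OF 1 runs_Seq[OF 2 runs_Seq[OF 3 4]]]] nP show ?case by (simp add: fun_upd_def)
qed

section \<open>String-valued loop programs run in polynomial time\<close>

text \<open>Counters hold only loop indices and the values of \<open>simple\<close> expressions; the
  result itself is an output string, whose length may exceed what the counters could represent as a
  number in polynomial time.\<close>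

datatype em = Out "bool list" | Cat em em | For exp em | IfEq exp exp em em

fun emitted :: "bool list \<Rightarrow> nat list \<Rightarrow> em \<Rightarrow> bool list" where
  "emitted x env (Out bs) = bs"
| "emitted x env (Cat m1 m2) = emitted x env m1 @ emitted x env m2"
| "emitted x env (For a m) = concat (map (\<lambda>i. emitted x (env @ [i]) m) [0..<eval x env a])"
| "emitted x env (IfEq a b m1 m2) = (if eval x env a = eval x env b then emitted x env m1 else emitted x env m2)"

fun admissible :: "nat \<Rightarrow> em \<Rightarrow> bool" where
  "admissible k (Out bs) \<longleftrightarrow> True"
| "admissible k (Cat m1 m2) \<longleftrightarrow> admissible k m1 \<and> admissible k m2"
| "admissible k (For a m) \<longleftrightarrow> scoped k a \<and> simple a \<and> admissible (Suc k) m"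
| "admissible k (IfEq a b m1 m2) \<longleftrightarrow> scoped k a \<and> simple a \<and> scoped k b \<and> simple b \<and>
     admissible k m1 \<and> admissible k m2"

text \<open>The test in \<open>IfEq\<close> computes the distance of the two values in
  \<open>d\<close>: counting down the second one lowers the first and, once that is zero, raises
  \<open>d + 2\<close>.\<close>

fun emit_code :: "nat list \<Rightarrow> nat \<Rightarrow> em \<Rightarrow> com" where
  "emit_code \<rho> d (Out bs) = foldr (\<lambda>b c. Emit b ;; c) bs SKIP"
| "emit_code \<rho> d (Cat m1 m2) = emit_code \<rho> d m1 ;; emit_code \<rho> d m2"
| "emit_code \<rho> d (For a m) = compile \<rho> d a ;;
     While (NZ d) (Dec d ;; emit_code (\<rho> @ [d + 1]) (d + 2) m ;; Inc (d + 1)) ;; clr (d + 1)"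
| "emit_code \<rho> d (IfEq a b m1 m2) = compile \<rho> d a ;; compile \<rho> (d + 1) b ;;
     While (NZ (d + 1)) (Dec (d + 1) ;; Cond (NZ d) (Dec d) (Inc (d + 2))) ;; mv (d + 2) d ;;
     Cond (NZ d) (clr d ;; emit_code \<rho> d m2) (emit_code \<rho> d m1)"

text \<open>The index of a loop is a further variable for its body, so the bound on the variables
  grows there by \<open>value_bound a N\<close>.\<close>

fun emit_bound :: "em \<Rightarrow> nat \<Rightarrow> nat" where
  "emit_bound (Out bs) N = 2 * length bs"
| "emit_bound (Cat m1 m2) N = emit_bound m1 N + emit_bound m2 N + 1"
| "emit_bound (For a m) N = time_bound a N +
     value_bound a N * (emit_bound m (N + value_bound a N) + 9) + 5"
| "emit_bound (IfEq a b m1 m2) N = time_bound a N + time_bound b N + emit_bound m1 N + emit_bound m2 N +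
     8 * value_bound a N + 14 * value_bound b N + 20"

lemma runs_Out: "runs x P (2 * length bs) (foldr (\<lambda>b c. Emit b ;; c) bs SKIP) (s, w) (s, w @ bs)"
proof (induction bs arbitrary: w)
  case Nil
  then show ?case by (simp add: runs_SKIP)
next
  case (Cons b bs)
  from runs_Seq[OF runs_Emit Cons.IH] show ?case by simp
qed

lemma runs_emit:
  assumes "admissible (length \<rho>) m" "set \<rho> \<subseteq> {1..<d}" "d \<ge> 1" "\<forall>r\<ge>d. s r = 0" "s 0 = 0"
    and "length x \<le> N" "\<forall>r\<in>set \<rho>. s r \<le> N"
  shows "runs x True (emit_bound m N) (emit_code \<rho> d m) (s, w) (s, w @ emitted x (map s \<rho>) m)"
  using assms
proof (induction m arbitrary: \<rho> d s w N)
  case (Out bs)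
  then show ?case using runs_Out by simp
next
  case (Cat m1 m2)
  have "runs x True (emit_bound m1 N) (emit_code \<rho> d m1) (s, w) (s, w @ emitted x (map s \<rho>) m1)"
    using Cat.prems by (intro Cat.IH) auto
  moreover have "runs x True (emit_bound m2 N) (emit_code \<rho> d m2) (s, w @ emitted x (map s \<rho>) m1)
      (s, (w @ emitted x (map s \<rho>) m1) @ emitted x (map s \<rho>) m2)"
    using Cat.prems by (intro Cat.IH) auto
  ultimately show ?case using runs_Seq by fastforce
next
  case (For a m)
  let ?v = "eval x (map s \<rho>) a" and ?B = "value_bound a N"
  let ?o = "\<lambda>j. concat (map (\<lambda>i. emitted x (map s \<rho> @ [i]) m) [0..<j])"
  let ?S = "\<lambda>j. (s(d := ?v - j, d + 1 := j), w @ ?o j)"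
  have v: "?v \<le> ?B" using For.prems by (intro eval_bound) auto
  have 1: "runs x True (time_bound a N) (compile \<rho> d a) (s, w) (s(d := ?v), w)"
    using For.prems by (intro runs_compile) auto
  have "runs x True (?v * ((1 + (emit_bound m (N + ?B) + 1 + 1) + 1) + 2) + 1)
      (While (NZ d) (Dec d ;; emit_code (\<rho> @ [d + 1]) (d + 2) m ;; Inc (d + 1))) (?S 0) (?S ?v)"
  proof (rule runs_While)
    fix j assume j: "j < ?v"
    show "holds x (fst (?S j)) (NZ d)" using j by simp
    let ?s1 = "s(d := ?v - Suc j, d + 1 := j)"
    have m: "map ?s1 (\<rho> @ [d + 1]) = map s \<rho> @ [j]" using For.prems(2) by auto
    have 1: "runs x True 1 (Dec d) (?S j) (?s1, w @ ?o j)"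
      using runs_Dec[of x True d "fst (?S j)" "w @ ?o j"] by (simp add: fun_upd_twist)
    have "runs x True (emit_bound m (N + ?B)) (emit_code (\<rho> @ [d + 1]) (d + 2) m) (?s1, w @ ?o j)
        (?s1, (w @ ?o j) @ emitted x (map ?s1 (\<rho> @ [d + 1])) m)"
      using For.prems j v by (intro For.IH) (auto simp: subset_iff)
    then have 2: "runs x True (emit_bound m (N + ?B)) (emit_code (\<rho> @ [d + 1]) (d + 2) m) (?s1, w @ ?o j)
        (?s1, w @ ?o (Suc j))"
      unfolding m by simp
    have 3: "runs x True 1 (Inc (d + 1)) (?s1, w @ ?o (Suc j)) (?S (Suc j))"
      using runs_Inc[of x True "d + 1" ?s1 "w @ ?o (Suc j)"] by simp
    show "runs x True (1 + (emit_bound m (N + ?B) + 1 + 1) + 1)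
        (Dec d ;; emit_code (\<rho> @ [d + 1]) (d + 2) m ;; Inc (d + 1)) (?S j) (?S (Suc j))"
      by (rule runs_Seq[OF 1 runs_Seq[OF 2 3]])
  qed simp
  moreover have "?S 0 = (s(d := ?v), w)" using For.prems(4) by (auto simp: fun_eq_iff)
  ultimately have 2: "runs x True (?v * (emit_bound m (N + ?B) + 6) + 1)
      (While (NZ d) (Dec d ;; emit_code (\<rho> @ [d + 1]) (d + 2) m ;; Inc (d + 1))) (s(d := ?v), w) (?S ?v)"
    by (simp add: algebra_simps numeral_eq_Suc)
  have eq: "(fst (?S ?v))(d + 1 := 0) = s" using For.prems(4) by (auto simp: fun_eq_iff)
  have 3: "runs x True (?v * 3 + 1) (clr (d + 1)) (?S ?v) (s, w @ ?o ?v)"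
    using runs_clr[of x True "fst (?S ?v)" "d + 1" "w @ ?o ?v"] unfolding eq by simp
  have "?v * (emit_bound m (N + ?B) + 6) + ?v * 3 \<le> ?B * (emit_bound m (N + ?B) + 9)"
    using mult_le_mono1[OF v, of "emit_bound m (N + ?B) + 9"] by (simp add: algebra_simps)
  with runs_mono[OF runs_Seq[OF 1 runs_Seq[OF 2 3]], of "emit_bound (For a m) N"] show ?case by simp
next
  case (IfEq a b m1 m2)
  let ?va = "eval x (map s \<rho>) a" and ?vb = "eval x (map s \<rho>) b"
  let ?S = "\<lambda>j. (s(d := ?va - j, d + 1 := ?vb - j, d + 2 := j - ?va), w)"
  have va: "?va \<le> value_bound a N" using IfEq.prems by (intro eval_bound) auto
  have vb: "?vb \<le> value_bound b N" using IfEq.prems by (intro eval_bound) auto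
  have m: "map (s(d := ?va)) \<rho> = map s \<rho>" using IfEq.prems(2) by auto
  have 1: "runs x True (time_bound a N) (compile \<rho> d a) (s, w) (s(d := ?va), w)"
    using IfEq.prems by (intro runs_compile) auto
  have "?S 0 = ((s(d := ?va))(d + 1 := eval x (map (s(d := ?va)) \<rho>) b), w)"
    unfolding m using IfEq.prems(4) by (auto simp: fun_eq_iff)
  then have 2: "runs x True (time_bound b N) (compile \<rho> (d + 1) b) (s(d := ?va), w) (?S 0)"
    using IfEq.prems by (simp only:) (intro runs_compile, auto)
  have 3: "runs x True (?vb * ((1 + (1 + 1) + 1) + 2) + 1)
      (While (NZ (d + 1)) (Dec (d + 1) ;; Cond (NZ d) (Dec d) (Inc (d + 2)))) (?S 0) (?S ?vb)"
  proof (rule runs_While)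
    fix j assume j: "j < ?vb"
    show "holds x (fst (?S j)) (NZ (d + 1))" using j by simp
    let ?s1 = "s(d := ?va - j, d + 1 := ?vb - Suc j, d + 2 := j - ?va)"
    have 1: "runs x True 1 (Dec (d + 1)) (?S j) (?s1, w)"
      using runs_Dec[of x True "d + 1" "fst (?S j)" w] by (simp add: fun_upd_twist)
    have 2: "runs x True (1 + 1) (Cond (NZ d) (Dec d) (Inc (d + 2))) (?s1, w) (?S (Suc j))"
    proof (cases "j < ?va")
      case True
      then have "fst (?S (Suc j)) = ?s1(d := ?s1 d - 1)" by (auto simp: fun_eq_iff)
      then have "runs x True 1 (Dec d) (?s1, w) (?S (Suc j))" using runs_Dec[of x True d ?s1 w] by simp
      then show ?thesis using True by (intro runs_CondT) auto
    next
      case False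
      then have "fst (?S (Suc j)) = ?s1(d + 2 := Suc (?s1 (d + 2)))" by (auto simp: fun_eq_iff)
      then have "runs x True 1 (Inc (d + 2)) (?s1, w) (?S (Suc j))" using runs_Inc[of x True "d + 2" ?s1 w] by simp
      then show ?thesis using False by (intro runs_CondF) auto
    qed
    show "runs x True (1 + (1 + 1) + 1) (Dec (d + 1) ;; Cond (NZ d) (Dec d) (Inc (d + 2))) (?S j) (?S (Suc j))"
      by (rule runs_Seq[OF 1 2])
  qed simp
  let ?D = "?va - ?vb + (?vb - ?va)"
  have eq: "(fst (?S ?vb))(d + 2 := 0, d := fst (?S ?vb) d + fst (?S ?vb) (d + 2)) = s(d := ?D)"
    using IfEq.prems(4) by (auto simp: fun_eq_iff)
  have 4: "runs x True ((?vb - ?va) * 5 + 1) (mv (d + 2) d) (?S ?vb) (s(d := ?D), w)"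
    using runs_mv[of "d + 2" d x True "fst (?S ?vb)" w] unfolding eq by simp
  have 5: "runs x True (?D * 3 + emit_bound m1 N + emit_bound m2 N + 3)
      (Cond (NZ d) (clr d ;; emit_code \<rho> d m2) (emit_code \<rho> d m1)) (s(d := ?D), w)
      (s, w @ emitted x (map s \<rho>) (IfEq a b m1 m2))"
  proof (cases "?va = ?vb")
    case True
    have "s(d := ?D) = s" using True IfEq.prems(4) by (auto simp: fun_eq_iff)
    moreover have "runs x True (emit_bound m1 N) (emit_code \<rho> d m1) (s, w) (s, w @ emitted x (map s \<rho>) m1)"
      using IfEq.prems by (intro IfEq.IH) auto
    ultimately have "runs x True (emit_bound m1 N + 1)
      (Cond (NZ d) (clr d ;; emit_code \<rho> d m2) (emit_code \<rho> d m1)) (s(d := ?D), w)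
      (s, w @ emitted x (map s \<rho>) (IfEq a b m1 m2))"
      using True IfEq.prems(4) by (intro runs_CondF) auto
    then show ?thesis by (rule runs_mono) simp
  next
    case False
    have c: "runs x True (?D * 3 + 1) (clr d) (s(d := ?D), w) (s, w)"
      using runs_clr[of x True "s(d := ?D)" d w] IfEq.prems(4) by (simp add: fun_upd_idem)
    have "runs x True (emit_bound m2 N) (emit_code \<rho> d m2) (s, w) (s, w @ emitted x (map s \<rho>) m2)"
      using IfEq.prems by (intro IfEq.IH) auto
    from runs_Seq[OF c this] have "runs x True (?D * 3 + 1 + emit_bound m2 N + 1 + 1)
      (Cond (NZ d) (clr d ;; emit_code \<rho> d m2) (emit_code \<rho> d m1)) (s(d := ?D), w)
      (s, w @ emitted x (map s \<rho>) (IfEq a b m1 m2))"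
      using False by (intro runs_CondT) auto
    then show ?thesis by (rule runs_mono) simp
  qed
  from runs_Seq[OF 1 runs_Seq[OF 2 runs_Seq[OF 3 runs_Seq[OF 4 5]]]]
  have "runs x True (time_bound a N + (time_bound b N + (?vb * (1 + (1 + 1) + 1 + 2) + 1 +
      ((?vb - ?va) * 5 + 1 + (?D * 3 + emit_bound m1 N + emit_bound m2 N + 3) + 1) + 1) + 1) + 1)
      (emit_code \<rho> d (IfEq a b m1 m2)) (s, w) (s, w @ emitted x (map s \<rho>) (IfEq a b m1 m2))" by simp
  moreover have "?vb - ?va \<le> value_bound b N" "?va - ?vb \<le> value_bound a N" using va vb by auto
  ultimately show ?case using vb by (elim runs_mono) simp
qed

section \<open>Polynomial bounds\<close>

definition poly_bounded :: "(nat \<Rightarrow> nat) \<Rightarrow> bool" where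
  "poly_bounded f \<longleftrightarrow> (\<exists>p. \<forall>n. f n \<le> poly p n)"

lemma poly_nat_mono:
  fixes p :: "nat poly"
  shows "m \<le> n \<Longrightarrow> poly p m \<le> poly p n"
  by (induction p) (auto intro!: add_mono mult_mono)

lemma poly_bounded_const: "poly_bounded (\<lambda>n. c)"
  unfolding poly_bounded_def by (rule exI[of _ "[:c:]"]) simp

lemma poly_bounded_id: "poly_bounded (\<lambda>n. n)"
  unfolding poly_bounded_def by (rule exI[of _ "[:0, 1:]"]) simp

lemma poly_bounded_add: "poly_bounded f \<Longrightarrow> poly_bounded g \<Longrightarrow> poly_bounded (\<lambda>n. f n + g n)"
  unfolding poly_bounded_def by (metis add_mono poly_add)

lemma poly_bounded_mult: "poly_bounded f \<Longrightarrow> poly_bounded g \<Longrightarrow> poly_bounded (\<lambda>n. f n * g n)"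
  unfolding poly_bounded_def by (metis mult_le_mono poly_mult)

text \<open>Polynomials with natural coefficients are monotone, so an upper bound may be substituted
  for the argument.\<close>

lemma poly_bounded_comp: "poly_bounded f \<Longrightarrow> poly_bounded g \<Longrightarrow> poly_bounded (\<lambda>n. f (g n))"
  unfolding poly_bounded_def by (metis order.trans poly_nat_mono poly_pcompose)

lemma poly_bounded_Suc: "poly_bounded f \<Longrightarrow> poly_bounded (\<lambda>n. Suc (f n))"
  using poly_bounded_add[OF poly_bounded_const[of 1], of f] by simp

lemmas poly_bounded_intros =
  poly_bounded_Suc poly_bounded_const poly_bounded_id poly_bounded_add poly_bounded_mult

lemma poly_bounded_value: "poly_bounded (value_bound e)"
  by (induction e) (simp_all add: poly_bounded_intros)

lemma poly_bounded_time: "poly_bounded (time_bound e)"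
  by (induction e) (simp_all add: poly_bounded_intros poly_bounded_value del: mult_Suc_right)

lemma poly_bounded_emit: "poly_bounded (emit_bound m)"
proof (induction m)
  case (For a m)
  from poly_bounded_comp[OF For, of "\<lambda>N. N + value_bound a N"]
  show ?case by (simp add: poly_bounded_intros poly_bounded_value poly_bounded_time)
qed (simp_all add: poly_bounded_intros poly_bounded_value poly_bounded_time del: mult_Suc_right)

theorem polytime_computable_emitted:
  assumes "admissible 0 m"
  shows "polytime_computable (\<lambda>x. emitted x [] m)"
proof -
  obtain p where p: "\<And>n. emit_bound m n \<le> poly p n"
    using poly_bounded_emit[of m] by (auto simp: poly_bounded_def)
  show ?thesis
  proof (rule polytime_computableI[where c = "emit_code [] 1 m" and p = p])
    fix x
    have "runs x True (emit_bound m (length x)) (emit_code [] 1 m) (\<lambda>_. 0, []) (\<lambda>_. 0, emitted x [] m)"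
      using assms runs_emit[of "[]" m 1 "\<lambda>_. 0" x "length x" "[]"] by simp
    with p[of "length x"] show "\<exists>t s. run x (emit_code [] 1 m) (\<lambda>_. 0, []) t (s, emitted x [] m) \<and> t \<le> poly p (length x)"
      by (auto simp: runs_def intro: order.trans)
  qed
qed

section \<open>Primitive recursive functions on structured data\<close>

text \<open>Since codes are bijective, \<open>inv enc\<close> is the identity on codes and hence
  realizable for free, which gives total decoding functions.\<close>

class enc =
  fixes enc :: "'a \<Rightarrow> nat"
  assumes bij_enc: "bij enc"

lemma enc_inject [simp]: "enc a = enc b \<longleftrightarrow> a = b"
  using bij_enc by (auto simp: bij_def inj_def)

lemma enc_inv [simp]: "enc (inv enc n) = n"
  by (meson bij_enc bij_inv_eq_iff)

lemma inv_enc [simp]: "inv enc (enc a) = a"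
  by (rule inv_f_f[OF bij_is_inj[OF bij_enc]])

instantiation nat :: enc
begin
definition nat_enc [simp]: "enc (n :: nat) = n"
instance by standard (simp add: bij_def inj_def surj_def)
end

instantiation prod :: (enc, enc) enc
begin
definition prod_enc: "enc p = prod_encode (enc (fst p), enc (snd p))"
instance
proof
  have "surj (enc :: 'a \<times> 'b \<Rightarrow> nat)"
  proof (rule surjI)
    fix n
    show "enc (inv enc (fst (prod_decode n)) :: 'a, inv enc (snd (prod_decode n)) :: 'b) = n"
      by (simp add: prod_enc)
  qed
  then show "bij (enc :: 'a \<times> 'b \<Rightarrow> nat)"
    by (auto simp: bij_def inj_def prod_enc prod_eq_iff)
qed
end

instantiation list :: (enc) enc
begin
definition list_enc: "enc xs = list_encode (map enc xs)"
instance
proof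
  have "inj (enc :: 'a list \<Rightarrow> nat)"
    by (auto simp: inj_def list_enc list_encode_eq inj_map_eq_map[OF bij_is_inj[OF bij_enc]])
  moreover have "surj (enc :: 'a list \<Rightarrow> nat)"
  proof (rule surjI)
    fix n
    show "enc (map (inv enc) (list_decode n) :: 'a list) = n"
      by (simp add: list_enc comp_def)
  qed
  ultimately show "bij (enc :: 'a list \<Rightarrow> nat)" by (simp add: bij_def)
qed
end

instantiation int :: enc
begin
definition int_enc: "enc (k :: int) = int_encode k"
instance by standard (simp add: int_enc[abs_def] bij_int_encode)
end

lemma enc_Pair: "enc (a, b) = prod_encode (enc a, enc b)"
  by (simp add: prod_enc)

lemma enc_Nil: "enc [] = 0"
  by (simp add: list_enc)

lemma enc_Cons: "enc (x # xs) = Suc (prod_encode (enc x, enc xs))"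
  by (simp add: list_enc)

definition pr :: "('a :: enc \<Rightarrow> 'b :: enc) \<Rightarrow> bool" where
  "pr f \<longleftrightarrow> (\<exists>e. scoped 1 e \<and> (\<forall>x a. eval x [enc a] e = enc (f a)))"

definition prp :: "('a :: enc \<Rightarrow> bool) \<Rightarrow> bool" where
  "prp P \<longleftrightarrow> pr (\<lambda>x. if P x then 1 else 0 :: nat)"

named_theorems pr_intros

subsection \<open>Realizers\<close>

definition TriE :: exp where
  "TriE = Rec (Const 0) (Add (Var 2) (Add (Var 1) (Const 1))) (Var 0)"

definition PairE :: "exp \<Rightarrow> exp \<Rightarrow> exp" where
  "PairE a b = Add (App TriE (Add a b)) a"

definition PredE :: exp where
  "PredE = Rec (Const 0) (Var 1) (Var 0)"

text \<open>\<open>k\<close> is the number of variables in scope, so that \<open>Var (k + 1)\<close>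
  is the previous value inside the recursion.\<close>

definition SubE :: "nat \<Rightarrow> exp \<Rightarrow> exp \<Rightarrow> exp" where
  "SubE k a b = Rec a (App PredE (Var (k + 1))) b"

definition IsZeroE :: "exp \<Rightarrow> exp" where
  "IsZeroE a = App (Rec (Const 1) (Const 0) (Var 0)) a"

text \<open>Inverts the pairing function: counts the triangular numbers up to the argument.\<close>

definition RootE :: exp where
  "RootE = Rec (Const 0) (Add (Var 2) (IsZeroE (SubE 3 (App TriE (Add (Var 1) (Const 1))) (Var 0)))) (Var 0)"

text \<open>\<open>prod_encode (a, b) = triangle (a + b) + a\<close>, and \<open>RootE\<close>
  recovers \<open>a + b\<close>.\<close>

definition FstE :: exp where
  "FstE = SubE 1 (Var 0) (App TriE RootE)"

definition SndE :: exp where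
  "SndE = SubE 1 RootE FstE"

lemma eval_TriE [simp]: "eval x [n] TriE = triangle n"
proof -
  have "rec_nat 0 (\<lambda>n r. r + Suc n) n = triangle n" by (induction n) simp_all
  then show ?thesis by (simp add: TriE_def)
qed

lemma eval_PairE [simp]: "eval x env (PairE a b) = prod_encode (eval x env a, eval x env b)"
  by (simp add: PairE_def prod_encode_def)

lemma eval_PredE [simp]: "eval x [n] PredE = n - 1"
  by (cases n) (simp_all add: PredE_def)

lemma eval_SubE [simp]: "length env = k \<Longrightarrow> eval x env (SubE k a b) = eval x env a - eval x env b"
proof -
  assume k: "length env = k"
  have "rec_nat m (\<lambda>n r. r - Suc 0) n = m - n" for m n by (induction n) simp_all
  then show ?thesis using k by (simp add: SubE_def nth_append)
qed

lemma eval_IsZeroE [simp]: "eval x env (IsZeroE a) = (if eval x env a = 0 then 1 else 0)"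
  by (cases "eval x env a") (simp_all add: IsZeroE_def)

lemma scoped_TriE [simp]: "scoped 1 TriE" "scoped (Suc 0) TriE"
  by (simp_all add: TriE_def)

lemma scoped_PairE [simp]: "scoped k (PairE a b) \<longleftrightarrow> scoped k a \<and> scoped k b"
  by (auto simp: PairE_def)

lemma scoped_SubE: "scoped k a \<Longrightarrow> scoped k b \<Longrightarrow> scoped k (SubE k a b)"
  by (simp add: SubE_def PredE_def)

lemma scoped_IsZeroE [simp]: "scoped k (IsZeroE a) \<longleftrightarrow> scoped k a"
  by (simp add: IsZeroE_def)

lemma triangle_mono: "m \<le> n \<Longrightarrow> triangle m \<le> triangle n"
  by (induction n rule: nat_induct) (auto simp: le_Suc_eq)

lemma triangle_ge: "n \<le> triangle n"
  by (induction n) auto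

text \<open>The code of \<open>(a, b)\<close> lies from \<open>triangle (a + b)\<close> up to, but
  below, the next triangular number. Hence exactly \<open>a + b\<close> of the positive triangular
  numbers do not exceed it, and this is what \<open>RootE\<close> counts.\<close>

lemma triangle_le_encode: "triangle (Suc j) \<le> triangle (a + b) + a \<longleftrightarrow> j < a + b"
proof
  assume *: "triangle (Suc j) \<le> triangle (a + b) + a"
  show "j < a + b"
  proof (rule ccontr)
    assume "\<not> j < a + b"
    then have "triangle (Suc (a + b)) \<le> triangle (Suc j)" by (intro triangle_mono) simp
    with * show False by simp
  qed
next
  assume "j < a + b"
  then show "triangle (Suc j) \<le> triangle (a + b) + a"
    using triangle_mono[of "Suc j" "a + b"] by (simp add: Suc_le_eq)
qed

lemma eval_RootE: "eval x [prod_encode (a, b)] RootE = a + b"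
proof -
  define n where "n = prod_encode (a, b)"
  have n: "n = triangle (a + b) + a" by (simp add: n_def prod_encode_def)
  have *: "(Suc (triangle j + j) - n = 0) = (j < a + b)" for j
    using triangle_le_encode[of j a b] by (simp add: n)
  have "rec_nat 0 (\<lambda>j r. r + (if Suc (triangle j + j) - n = 0 then 1 else 0)) m = min m (a + b)" for m
    unfolding * by (induction m) auto
  moreover have "a + b \<le> n" using triangle_ge[of "a + b"] by (simp add: n)
  ultimately have "eval x [n] RootE = a + b" by (simp add: RootE_def)
  then show ?thesis by (simp add: n_def)
qed

lemma eval_FstE: "eval x [prod_encode (a, b)] FstE = a"
proof -
  have "prod_encode (a, b) - triangle (a + b) = a" by (simp add: prod_encode_def)
  then show ?thesis by (simp add: FstE_def eval_RootE)
qed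

lemma eval_SndE: "eval x [prod_encode (a, b)] SndE = b"
  by (simp add: SndE_def eval_RootE eval_FstE)

lemma scoped_RootE: "scoped 1 RootE"
proof -
  have "scoped 3 (SubE 3 (App TriE (Add (Var 1) (Const 1))) (Var 0))" by (intro scoped_SubE) auto
  then show ?thesis by (simp add: RootE_def numeral_3_eq_3)
qed

lemma scoped_FstE: "scoped 1 FstE"
  unfolding FstE_def by (intro scoped_SubE) (simp_all add: scoped_RootE[unfolded One_nat_def])

lemma scoped_SndE: "scoped 1 SndE"
  unfolding SndE_def by (intro scoped_SubE scoped_RootE scoped_FstE)

subsection \<open>Closure properties\<close>

lemma pr_id [pr_intros]: "pr (\<lambda>x. x)"
  unfolding pr_def by (rule exI[of _ "Var 0"]) simp

lemma pr_const [pr_intros]: "pr (\<lambda>x. c)"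
  unfolding pr_def by (rule exI[of _ "Const (enc c)"]) simp

lemma pr_enc_iff: "pr (\<lambda>x. enc (f x)) \<longleftrightarrow> pr f"
  by (simp add: pr_def)

lemma pr_encI [pr_intros]: "pr f \<Longrightarrow> pr (\<lambda>x. enc (f x))"
  by (simp add: pr_enc_iff)

lemma pr_inv_enc [pr_intros]: "pr f \<Longrightarrow> pr (\<lambda>x. inv enc (f x))"
  by (simp add: pr_def)

lemma pr_comp: "pr f \<Longrightarrow> pr g \<Longrightarrow> pr (\<lambda>x. f (g x))"
  unfolding pr_def
proof (elim exE conjE)
  fix ef eg assume "scoped 1 ef" "\<forall>x a. eval x [enc a] ef = enc (f a)"
    "scoped 1 eg" "\<forall>x a. eval x [enc a] eg = enc (g a)"
  then show "\<exists>e. scoped 1 e \<and> (\<forall>x a. eval x [enc a] e = enc (f (g a)))"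
    by (intro exI[of _ "App ef eg"]) simp
qed

lemma pr_unary_exp:
  assumes "scoped 1 e" "\<And>x a. eval x [enc a] e = enc (f a)" "pr g"
  shows "pr (\<lambda>x. f (g x))"
  by (rule pr_comp[OF _ assms(3)]) (use assms(1,2) in \<open>auto simp: pr_def\<close>)

lemma pr_binary_exp:
  assumes "\<And>a b. scoped 1 a \<Longrightarrow> scoped 1 b \<Longrightarrow> scoped 1 (e a b)"
    "\<And>x n a b. eval x [n] (e a b) = F (eval x [n] a) (eval x [n] b)"
    "\<And>a b. F (enc a) (enc b) = enc (h a b)" "pr f" "pr g"
  shows "pr (\<lambda>x. h (f x) (g x))"
proof -
  obtain ef eg where "scoped 1 ef" "\<And>x a. eval x [enc a] ef = enc (f a)"
    "scoped 1 eg" "\<And>x a. eval x [enc a] eg = enc (g a)" using assms(4,5) by (auto simp: pr_def)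
  then show ?thesis unfolding pr_def using assms(1-3) by (intro exI[of _ "e ef eg"]) simp
qed

lemma pr_Pair [pr_intros]: "pr f \<Longrightarrow> pr g \<Longrightarrow> pr (\<lambda>x. (f x, g x))"
  by (rule pr_binary_exp[where e = PairE and F = "\<lambda>a b. prod_encode (a, b)"]) (simp_all add: enc_Pair)

lemma pr_fst [pr_intros]: "pr f \<Longrightarrow> pr (\<lambda>x. fst (f x))"
  by (rule pr_unary_exp[OF scoped_FstE]) (simp_all add: prod_enc eval_FstE)

lemma pr_snd [pr_intros]: "pr f \<Longrightarrow> pr (\<lambda>x. snd (f x))"
  by (rule pr_unary_exp[OF scoped_SndE]) (simp_all add: prod_enc eval_SndE)

lemma pr_add [pr_intros]: "pr f \<Longrightarrow> pr g \<Longrightarrow> pr (\<lambda>x. f x + g x :: nat)"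
  by (rule pr_binary_exp[where e = Add and F = "(+)"]) simp_all

lemma pr_mult [pr_intros]: "pr f \<Longrightarrow> pr g \<Longrightarrow> pr (\<lambda>x. f x * g x :: nat)"
  by (rule pr_binary_exp[where e = Mul and F = "(*)"]) simp_all

lemma pr_diff [pr_intros]: "pr f \<Longrightarrow> pr g \<Longrightarrow> pr (\<lambda>x. f x - g x :: nat)"
  by (rule pr_binary_exp[where e = "SubE 1" and F = "(-)"]) (simp_all add: scoped_SubE del: One_nat_def)

lemma pr_Suc [pr_intros]: "pr f \<Longrightarrow> pr (\<lambda>x. Suc (f x))"
  using pr_add[OF _ pr_const[of 1], of f] by simp

lemma pr_rec_nat [pr_intros]:
  assumes "pr b" "pr (\<lambda>p. h (fst p) (fst (snd p)) (snd (snd p)))" "pr n"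
  shows "pr (\<lambda>x. rec_nat (b x) (\<lambda>i r. h x i r) (n x))"
proof -
  obtain eb where eb: "scoped 1 eb" "\<And>x a. eval x [enc a] eb = enc (b a)" using assms(1) by (auto simp: pr_def)
  obtain en where en: "scoped 1 en" "\<And>x a. eval x [enc a] en = n a" using assms(3) by (auto simp: pr_def)
  obtain eh where eh: "scoped 1 eh"
    "\<And>x a. eval x [enc a] eh = enc (h (fst a) (fst (snd a)) (snd (snd a)))" using assms(2) by (auto simp: pr_def)
  have "rec_nat (enc (b a)) (\<lambda>i r. eval x [prod_encode (enc a, prod_encode (i, r))] eh) k =
      enc (rec_nat (b a) (\<lambda>i r. h a i r) k)" for x a k
  proof (induction k)
    case (Suc k)
    then show ?case using eh(2)[of x "(a, k, rec_nat (b a) (\<lambda>i r. h a i r) k)"] by (simp add: enc_Pair)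
  qed simp
  then show ?thesis unfolding pr_def using eb en eh(1)
    by (intro exI[of _ "Rec eb (App eh (PairE (Var 0) (PairE (Var 1) (Var 2)))) en"]) simp
qed

lemma pr_if [pr_intros]:
  assumes "prp P" "pr f" "pr g"
  shows "pr (\<lambda>x. if P x then f x else g x)"
proof -
  have "pr (\<lambda>x. (if P x then 1 else 0) * enc (f x) + (1 - (if P x then 1 else 0)) * enc (g x))"
    using assms unfolding prp_def by (intro pr_intros)
  moreover have "(\<lambda>x. (if P x then 1 else 0) * enc (f x) + (1 - (if P x then 1 else 0)) * enc (g x)) =
      (\<lambda>x. enc (if P x then f x else g x))" by auto
  ultimately show ?thesis by (simp add: pr_enc_iff)
qed

lemma prpI: "pr f \<Longrightarrow> (\<And>x. f x = (if P x then 1 else 0 :: nat)) \<Longrightarrow> prp P"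
proof -
  assume "pr f" and f: "\<And>x. f x = (if P x then 1 else 0 :: nat)"
  moreover have "f = (\<lambda>x. if P x then 1 else 0)" using f by (rule ext)
  ultimately show "prp P" by (simp only: prp_def)
qed

lemma prp_is_zero: "pr f \<Longrightarrow> prp (\<lambda>x. f x = (0 :: nat))"
  by (rule prpI[OF pr_diff[OF pr_const[of 1]]]) auto

lemma prp_eq [pr_intros]: "pr f \<Longrightarrow> pr g \<Longrightarrow> prp (\<lambda>x. f x = g x)"
proof -
  assume "pr f" "pr g"
  then have "prp (\<lambda>x. (enc (f x) - enc (g x)) + (enc (g x) - enc (f x)) = 0)"
    by (intro prp_is_zero pr_intros)
  moreover have "(enc (f x) - enc (g x)) + (enc (g x) - enc (f x)) = 0 \<longleftrightarrow> f x = g x" for x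
    using enc_inject[of "f x" "g x"] by (auto simp del: enc_inject)
  ultimately show ?thesis by simp
qed

lemma prp_le [pr_intros]: "pr f \<Longrightarrow> pr g \<Longrightarrow> prp (\<lambda>x. f x \<le> (g x :: nat))"
  using prp_is_zero[OF pr_diff, of f g] by simp

subsection \<open>Lists\<close>

lemma pr_Cons [pr_intros]: "pr f \<Longrightarrow> pr g \<Longrightarrow> pr (\<lambda>x. f x # g x)"
proof -
  assume "pr f" "pr g"
  then have "pr (\<lambda>x. Suc (enc (f x, g x)))" by (intro pr_intros)
  then show ?thesis by (simp add: enc_Cons enc_Pair pr_enc_iff[of "\<lambda>x. f x # g x", symmetric])
qed

text \<open>The value on the empty list is chosen such that unpairing \<open>enc xs - 1\<close>
  yields \<open>head\<close> without a case distinction.\<close>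

definition head :: "'a :: enc list \<Rightarrow> 'a" where
  "head xs = (case xs of [] \<Rightarrow> inv enc 0 | y # ys \<Rightarrow> y)"

lemma pr_tl [pr_intros]: "pr f \<Longrightarrow> pr (\<lambda>x. tl (f x))"
proof -
  assume "pr f"
  then have "pr (\<lambda>x. snd (inv enc (enc (f x) - 1) :: nat \<times> nat))" by (intro pr_intros)
  moreover have "snd (inv enc (enc xs - 1) :: nat \<times> nat) = enc (tl xs)" for xs :: "'b list"
  proof (cases xs)
    case Nil
    have "inv enc 0 = (0 :: nat, 0 :: nat)" using inv_enc[of "(0 :: nat, 0 :: nat)"]
      by (simp add: enc_Pair prod_encode_def)
    then show ?thesis using Nil by (simp add: enc_Nil)
  next
    case (Cons y ys)
    have "inv enc (prod_encode (enc y, enc ys)) = (enc y, enc ys)"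
      using inv_enc[of "(enc y, enc ys)"] by (simp add: enc_Pair)
    then show ?thesis using Cons by (simp add: enc_Cons)
  qed
  ultimately show ?thesis by (simp add: pr_enc_iff)
qed

lemma pr_head [pr_intros]: "pr f \<Longrightarrow> pr (\<lambda>x. head (f x))"
proof -
  assume "pr f"
  then have "pr (\<lambda>x. fst (inv enc (enc (f x) - 1) :: nat \<times> nat))" by (intro pr_intros)
  moreover have "fst (inv enc (enc xs - 1) :: nat \<times> nat) = enc (head xs)" for xs :: "'b list"
  proof (cases xs)
    case Nil
    have "inv enc 0 = (0 :: nat, 0 :: nat)" using inv_enc[of "(0 :: nat, 0 :: nat)"]
      by (simp add: enc_Pair prod_encode_def)
    then show ?thesis using Nil by (simp add: enc_Nil head_def)
  next
    case (Cons y ys)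
    have "inv enc (prod_encode (enc y, enc ys)) = (enc y, enc ys)"
      using inv_enc[of "(enc y, enc ys)"] by (simp add: enc_Pair)
    then show ?thesis using Cons by (simp add: enc_Cons head_def)
  qed
  ultimately show ?thesis by (simp add: pr_enc_iff)
qed

lemma length_le_enc: "length xs \<le> enc xs"
proof (induction xs)
  case (Cons x xs)
  then show ?case using le_prod_encode_2[of "enc xs" "enc x"] by (simp add: enc_Cons)
qed simp

text \<open>The recursion runs for \<open>enc (l x)\<close> rounds, which is at least the length of
  the list; rounds on the empty list change nothing. The other list functions are reduced to this
  one.\<close>

lemma pr_foldl [pr_intros]:
  assumes "pr b" "pr (\<lambda>p. h (fst p) (fst (snd p)) (snd (snd p)))" "pr l"
  shows "pr (\<lambda>x. foldl (\<lambda>a e. h x a e) (b x) (l x))"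
proof -
  define st where "st x s = (if snd s = [] then s else (h x (fst s) (head (snd s)), tl (snd s)))" for x s
  have h: "pr (\<lambda>p. h (f1 p) (f2 p) (f3 p))" if "pr f1" "pr f2" "pr f3" for f1 f2 f3
    using pr_comp[OF assms(2), of "\<lambda>p. (f1 p, f2 p, f3 p)"] that by (simp add: pr_intros)
  have "pr (\<lambda>p. st (fst p) (snd (snd p)))"
    unfolding st_def by (intro pr_intros h)
  then have "pr (\<lambda>x. fst (rec_nat (b x, l x) (\<lambda>i s. st x s) (enc (l x))))"
    using assms by (intro pr_intros)
  moreover have "fst (rec_nat (a, xs) (\<lambda>i s. st x s) n) = foldl (\<lambda>a e. h x a e) a xs" if "length xs \<le> n" for x a xs n
  proof -
    have "rec_nat c (\<lambda>i s. st x s) n = (st x ^^ n) c" for c n by (induction n) simp_all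
    moreover have "(st x ^^ n) (a, xs) = (foldl (\<lambda>a e. h x a e) a xs, [])" using that
    proof (induction n arbitrary: a xs)
      case (Suc n)
      have eq: "(st x ^^ Suc n) (a, xs) = (st x ^^ n) (st x (a, xs))" by (simp add: funpow_swap1)
      show ?case
      proof (cases xs)
        case Nil
        then have "st x (a, xs) = (a, [])" by (simp add: st_def)
        then show ?thesis unfolding eq using Suc.IH[of "[]" a] Nil by simp
      next
        case (Cons y ys)
        then have "st x (a, xs) = (h x a y, ys)" by (simp add: st_def head_def)
        then show ?thesis unfolding eq using Suc.IH[of ys "h x a y"] Suc.prems Cons by simp
      qed
    qed simp
    ultimately show ?thesis by simp
  qed
  ultimately show ?thesis by (simp add: length_le_enc)
qed

lemma pr_rev [pr_intros]: "pr l \<Longrightarrow> pr (\<lambda>x. rev (l x))"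
proof -
  have "foldl (\<lambda>a e. e # a) ys xs = rev xs @ ys" for xs ys :: "'b list"
    by (induction xs arbitrary: ys) simp_all
  then have eq: "rev = (\<lambda>xs :: 'b list. foldl (\<lambda>a e. e # a) [] xs)" by (simp add: fun_eq_iff)
  show "pr l \<Longrightarrow> ?thesis" unfolding eq by (intro pr_intros)
qed

lemma pr_append [pr_intros]: "pr l \<Longrightarrow> pr m \<Longrightarrow> pr (\<lambda>x. l x @ m x)"
proof -
  have eq: "xs @ ys = foldl (\<lambda>a e. e # a) ys (rev xs)" for xs ys :: "'b list"
    by (induction xs) simp_all
  show "pr l \<Longrightarrow> pr m \<Longrightarrow> ?thesis" unfolding eq by (intro pr_intros)
qed

lemma pr_map [pr_intros]:
  assumes "pr (\<lambda>p. h (fst p) (snd p))" "pr l"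
  shows "pr (\<lambda>x. map (\<lambda>e. h x e) (l x))"
proof -
  have eq: "map f xs = foldl (\<lambda>a e. a @ [f e]) [] xs" for f :: "'b \<Rightarrow> 'c" and xs
    by (induction xs rule: rev_induct) simp_all
  have h: "pr (\<lambda>p. h (f1 p) (f2 p))" if "pr f1" "pr f2" for f1 f2
    using pr_comp[OF assms(1), of "\<lambda>p. (f1 p, f2 p)"] that by (simp add: pr_intros)
  show ?thesis unfolding eq using assms(2) by (intro pr_intros h)
qed

lemma pr_concat [pr_intros]: "pr l \<Longrightarrow> pr (\<lambda>x. concat (l x))"
proof -
  have eq: "concat xss = foldl (\<lambda>a e. a @ e) [] xss" for xss :: "'b list list"
    by (induction xss rule: rev_induct) simp_all
  show "pr l \<Longrightarrow> ?thesis" unfolding eq by (intro pr_intros)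
qed

lemma pr_sum_list [pr_intros]: "pr l \<Longrightarrow> pr (\<lambda>x. sum_list (l x) :: nat)"
proof -
  have eq: "sum_list xs = foldl (\<lambda>a e. a + e) 0 xs" for xs :: "nat list"
    by (induction xs rule: rev_induct) simp_all
  show "pr l \<Longrightarrow> ?thesis" unfolding eq by (intro pr_intros)
qed

subsection \<open>Powers, halving and integers\<close>

lemma pr_power [pr_intros]: "pr f \<Longrightarrow> pr g \<Longrightarrow> pr (\<lambda>x. f x ^ g x :: nat)"
proof -
  have eq: "m ^ n = rec_nat 1 (\<lambda>i r. m * r) n" for m n :: nat by (induction n) simp_all
  \<comment> \<open>Inside the recursion \<open>x\<close> is the first component of a tuple, so
    \<open>f\<close> is needed composed with \<open>fst\<close>.\<close>
  show "pr f \<Longrightarrow> pr g \<Longrightarrow> ?thesis" unfolding eq by (intro pr_intros pr_comp[of f "\<lambda>p. fst p"])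
qed

lemma divmod2_rec:
  "rec_nat (0, 0) (\<lambda>i s. if snd s = 1 then (Suc (fst s), 0) else (fst s, 1)) n = (n div 2, n mod 2)"
  by (induction n) (auto simp: mod_Suc, presburger+)

lemma pr_div2 [pr_intros]: "pr f \<Longrightarrow> pr (\<lambda>x. f x div (2 :: nat))"
proof -
  assume "pr f"
  then have "pr (\<lambda>x. fst (rec_nat (0 :: nat, 0 :: nat) (\<lambda>i s. if snd s = 1 then (Suc (fst s), 0) else (fst s, 1)) (f x)))"
    by (intro pr_intros)
  then show ?thesis unfolding divmod2_rec by simp
qed

lemma prp_odd [pr_intros]: "pr f \<Longrightarrow> prp (\<lambda>x. odd (f x :: nat))"
proof -
  assume "pr f"
  then have "prp (\<lambda>x. snd (rec_nat (0 :: nat, 0 :: nat) (\<lambda>i s. if snd s = 1 then (Suc (fst s), 0) else (fst s, 1)) (f x)) = 1)"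
    by (intro pr_intros)
  then show ?thesis unfolding divmod2_rec by (simp add: odd_iff_mod_2_eq_one)
qed

text \<open>\<open>int_encode\<close> sends \<open>k \<ge> 0\<close> to \<open>2 * k\<close> and a
  negative \<open>k\<close> to \<open>2 * (- k) - 1\<close>, so parity is the sign.\<close>

lemma pr_nat [pr_intros]: "pr f \<Longrightarrow> pr (\<lambda>x. nat (f x))"
proof -
  have eq: "nat k = (if odd (enc k) then 0 else enc k div 2)" for k :: int
    by (simp add: int_enc int_encode_def sum_encode_def)
  show "pr f \<Longrightarrow> ?thesis" unfolding eq by (intro pr_intros)
qed

lemma pr_nat_uminus: "pr f \<Longrightarrow> pr (\<lambda>x. nat (- f x))"
proof -
  have eq: "nat (- k) = (if odd (enc k) then Suc (enc k div 2) else 0)" for k :: int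
    by (simp add: int_enc int_encode_def sum_encode_def nat_eq_iff)
  show "pr f \<Longrightarrow> ?thesis" unfolding eq by (intro pr_intros)
qed

text \<open>Integer arithmetic is reduced to natural numbers by splitting \<open>k\<close> into
  \<open>nat k\<close> and \<open>nat (- k)\<close> and forming one difference at the end.\<close>

lemma pr_int_diff: "pr f \<Longrightarrow> pr g \<Longrightarrow> pr (\<lambda>x. int (f x) - int (g x))"
proof -
  have eq: "enc (int m - int n) = (if n \<le> m then 2 * (m - n) else Suc (2 * (n - Suc m)))" for m n
    by (auto simp: int_enc int_encode_def sum_encode_def nat_diff_distrib)
  assume "pr f" "pr g"
  then have "pr (\<lambda>x. enc (int (f x) - int (g x)))" unfolding eq by (intro pr_intros)
  then show ?thesis by (simp add: pr_enc_iff)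
qed

lemma pr_int_add [pr_intros]: "pr f \<Longrightarrow> pr g \<Longrightarrow> pr (\<lambda>x. f x + g x :: int)"
proof -
  have eq: "k + l = int (nat k + nat l) - int (nat (- k) + nat (- l))" for k l :: int by simp
  show "pr f \<Longrightarrow> pr g \<Longrightarrow> ?thesis"
    by (subst eq) (intro pr_int_diff pr_nat_uminus pr_intros)
qed

lemma pr_int_mult [pr_intros]: "pr f \<Longrightarrow> pr g \<Longrightarrow> pr (\<lambda>x. f x * g x :: int)"
proof -
  have eq: "k * l = int (nat k * nat l + nat (- k) * nat (- l)) - int (nat k * nat (- l) + nat (- k) * nat l)"
    for k l :: int by (cases "k \<ge> 0"; cases "l \<ge> 0") auto
  show "pr f \<Longrightarrow> pr g \<Longrightarrow> ?thesis"
    by (subst eq) (intro pr_int_diff pr_nat_uminus pr_intros)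
qed

lemma pr_nat_abs [pr_intros]: "pr f \<Longrightarrow> pr (\<lambda>x. nat \<bar>f x\<bar>)"
proof -
  have eq: "nat \<bar>k\<bar> = nat k + nat (- k)" for k :: int by simp
  show "pr f \<Longrightarrow> ?thesis" unfolding eq by (intro pr_nat_uminus pr_intros)
qed

lemma prp_neg [pr_intros]: "pr f \<Longrightarrow> prp (\<lambda>x. f x < (0 :: int))"
proof -
  have eq: "k < 0 \<longleftrightarrow> odd (enc k)" for k :: int
    by (simp add: int_enc int_encode_def sum_encode_def)
  show "pr f \<Longrightarrow> ?thesis" unfolding eq by (intro pr_intros)
qed

subsection \<open>Unbounded search\<close>

definition symbols_of :: "bool list \<Rightarrow> nat list" where
  "symbols_of x = map bit_symbol x"

text \<open>The input is read from its last symbol to its first, since a list code grows at the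
  front.\<close>

definition InputE :: exp where
  "InputE = Rec (Const 0) (Add (PairE (In (SubE 3 Len (Add (Var 1) (Const 1)))) (Var 2)) (Const 1)) Len"

lemma scoped_InputE: "scoped 1 InputE"
proof -
  have "scoped 3 (SubE 3 Len (Add (Var 1) (Const 1)))" by (intro scoped_SubE) auto
  then show ?thesis by (simp add: InputE_def numeral_3_eq_3)
qed

lemma eval_InputE: "eval x [n] InputE = enc (symbols_of x)"
proof -
  have "rec_nat 0 (\<lambda>i r. Suc (prod_encode (input_tape x (int (length x - Suc i)), r))) k =
      enc (drop (length x - k) (symbols_of x))" if "k \<le> length x" for k
    using that
  proof (induction k)
    case 0
    then show ?case by (simp add: symbols_of_def enc_Nil)
  next
    case (Suc k)
    let ?j = "length x - Suc k"
    have j: "Suc ?j = length x - k" "?j < length x" using Suc.prems by auto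
    have "drop ?j (symbols_of x) = bit_symbol (x ! ?j) # drop (length x - k) (symbols_of x)"
      using j Cons_nth_drop_Suc[of ?j "symbols_of x"] by (simp add: symbols_of_def)
    moreover have "input_tape x (int i) = bit_symbol (x ! i)" if "i < length x" for i
      using that by (simp add: input_tape_def)
    with j(2) have "input_tape x (int ?j) = bit_symbol (x ! ?j)" by blast
    ultimately show ?case using Suc by (simp add: enc_Cons)
  qed
  from this[of "length x"] show ?thesis by (simp add: InputE_def)
qed

text \<open>The value 0 means undecided, 1 yes and 2 no.\<close>

theorem decidable_search:
  fixes D :: "nat list \<times> nat \<Rightarrow> nat"
  assumes D: "pr D"
    and yes: "\<And>x. x \<in> Yes \<Longrightarrow> (\<exists>m. D (symbols_of x, m) \<noteq> 0) \<and> (\<forall>m. D (symbols_of x, m) \<noteq> 2)"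
    and no: "\<And>x. x \<in> No \<Longrightarrow> (\<exists>m. D (symbols_of x, m) \<noteq> 0) \<and> (\<forall>m. D (symbols_of x, m) \<in> {0, 2})"
  shows "decidable (Yes, No)"
proof -
  have "pr (\<lambda>p. if D p = 0 then 1 else 0 :: nat)" "pr (\<lambda>p. if D p = 2 then 1 else 0 :: nat)"
    by (intro pr_intros D)+
  then obtain e1 e2 where e1: "scoped 1 e1" "\<And>x p. eval x [enc p] e1 = (if D p = 0 then 1 else 0)"
    and e2: "scoped 1 e2" "\<And>x p. eval x [enc p] e2 = (if D p = 2 then 1 else 0)"
    by (auto simp: pr_def)
  \<comment> \<open>\<open>E1\<close> is the guard of the search loop, 1 as long as the answer is
    undecided; \<open>E2\<close> is nonzero exactly for the answer no, as \<open>decidableI\<close>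
    expects.\<close>
  define E1 where "E1 = App e1 (PairE InputE (Var 0))"
  define E2 where "E2 = App e2 (PairE InputE (Var 0))"
  have E: "scoped 1 E1" "scoped 1 E2"
    "eval x [m] E1 = (if D (symbols_of x, m) = 0 then 1 else 0)"
    "eval x [m] E2 = (if D (symbols_of x, m) = 2 then 1 else 0)" for x m
    using e1 e2 scoped_InputE
    using e1(2)[of x "(symbols_of x, m)"] e2(2)[of x "(symbols_of x, m)"]
    by (simp_all add: E1_def E2_def eval_InputE enc_Pair)
  let ?s = "\<lambda>i v. (\<lambda>_. 0)(1 := i, 2 := v) :: store"
  have run: "runs x False 0 (compile [1] 2 e) (?s m 0, []) (?s m (eval x [m] e), [])" if "scoped 1 e" for x m e
  proof -
    have "runs x False (time_bound e 0) (compile [1] 2 e) (?s m 0, []) ((?s m 0)(2 := eval x (map (?s m 0) [1]) e), [])"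
      using that by (intro runs_compile) auto
    then have "runs x False (time_bound e 0) (compile [1] 2 e) (?s m 0, []) (?s m (eval x [m] e), [])"
      by simp
    then show ?thesis by (rule runs_mono) simp
  qed
  \<comment> \<open>Inside the loop counter 2 holds the guard value 1, so a single
    \<open>Dec\<close> makes it zero, as \<open>compile\<close> requires.\<close>
  let ?body = "Dec 2 ;; Inc 1 ;; compile [1] 2 E1"
  show ?thesis
  proof (rule decidableI[where c = "compile [1] 2 E1 ;; While (NZ 2) ?body ;; compile [1] 2 E2" and r = 2])
    fix x assume x: "x \<in> Yes \<union> No"
    define m where "m = (LEAST m. D (symbols_of x, m) \<noteq> 0)"
    have "\<exists>m. D (symbols_of x, m) \<noteq> 0" using x yes no by blast
    then have m: "D (symbols_of x, m) \<noteq> 0" unfolding m_def by (rule LeastI_ex)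
    have less: "D (symbols_of x, i) = 0" if "i < m" for i using that not_less_Least unfolding m_def by blast
    let ?S = "\<lambda>i. (?s i (eval x [i] E1), [])"
    have 1: "runs x False 0 (compile [1] 2 E1) (\<lambda>_. 0, []) (?S 0)"
    proof -
      have "?s 0 0 = (\<lambda>_. 0)" by auto
      with run[OF E(1), of x 0] show ?thesis by simp
    qed
    have 2: "runs x False (m * (0 + 2) + 1) (While (NZ 2) ?body) (?S 0) (?S m)"
    proof (rule runs_While)
      fix i assume i: "i < m"
      show "holds x (fst (?S i)) (NZ 2)" using less[OF i] E(3) by simp
      have a: "runs x False 1 (Dec 2) (?S i) (?s i 0, [])"
        using runs_Dec[of x False 2 "?s i (eval x [i] E1)" "[]"] less[OF i] E(3) by simp
      have b: "runs x False 1 (Inc 1) (?s i 0, []) (?s (Suc i) 0, [])"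
        using runs_Inc[of x False 1 "?s i 0" "[]"] by (simp add: fun_upd_twist)
      from runs_Seq[OF a runs_Seq[OF b run[OF E(1)]]]
      show "runs x False 0 ?body (?S i) (?S (Suc i))" by (rule runs_mono) simp
    next
      show "\<not> holds x (fst (?S m)) (NZ 2)" using m E(3) by simp
    qed
    have 3: "runs x False 0 (compile [1] 2 E2) (?S m) (?s m (eval x [m] E2), [])"
      using run[OF E(2), of x m] m E(3) by simp
    from runs_Seq[OF 1 runs_Seq[OF 2 3]]
    obtain t where t: "run x (compile [1] 2 E1 ;; While (NZ 2) ?body ;; compile [1] 2 E2) (\<lambda>_. 0, []) t
        (?s m (eval x [m] E2), [])"
      unfolding runs_def by blast
    have "x \<in> Yes \<Longrightarrow> D (symbols_of x, m) \<noteq> 2" using yes by blast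
    moreover have "D (symbols_of x, m) = 2" if "x \<in> No"
    proof -
      have "D (symbols_of x, m) \<in> {0, 2}" using no[OF that] by blast
      with m show ?thesis by simp
    qed
    ultimately show "\<exists>t s w. run x (compile [1] 2 E1 ;; While (NZ 2) ?body ;; compile [1] 2 E2) (\<lambda>_. 0, []) t (s, w) \<and>
        (x \<in> Yes \<longrightarrow> s 2 = 0) \<and> (x \<in> No \<longrightarrow> s 2 \<noteq> 0)"
      using t E(4) by (intro exI[of _ t] exI[of _ "?s m (eval x [m] E2)"] exI[of _ "[]"]) simp
  qed
qed

section \<open>Shortening factorizations in the modular group\<close>

text \<open>Quadruples of integers, in row order, belong to the class \<open>enc\<close>, which
  makes matrix computations accessible to \<open>pr\<close>.\<close>

type_synonym m4 = "int \<times> int \<times> int \<times> int"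

fun mul4 :: "m4 \<Rightarrow> m4 \<Rightarrow> m4" where
  "mul4 (a, b, c, d) (e, f, g, h) = (a * e + b * g, a * f + b * h, c * e + d * g, c * f + d * h)"

definition one4 :: m4 where "one4 = (1, 0, 0, 1)"

fun det4 :: "m4 \<Rightarrow> int" where
  "det4 (a, b, c, d) = a * d - b * c"

fun size4 :: "m4 \<Rightarrow> nat" where
  "size4 (a, b, c, d) = nat \<bar>a\<bar> + nat \<bar>b\<bar> + nat \<bar>c\<bar> + nat \<bar>d\<bar>"

fun neg4 :: "m4 \<Rightarrow> m4" where
  "neg4 (a, b, c, d) = (- a, - b, - c, - d)"

definition prod4 :: "m4 list \<Rightarrow> m4" where
  "prod4 As = foldr mul4 As one4"

lemma mul4_assoc: "mul4 (mul4 A B) C = mul4 A (mul4 B C)"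
  by (cases A; cases B; cases C) (simp add: algebra_simps)

lemma mul4_one [simp]: "mul4 one4 A = A" "mul4 A one4 = A"
  by (cases A; simp add: one4_def)+

lemma det4_mul: "det4 (mul4 A B) = det4 A * det4 B"
  by (cases A; cases B) (simp add: algebra_simps)

lemma mul4_neg: "mul4 (neg4 A) B = neg4 (mul4 A B)" "mul4 A (neg4 B) = neg4 (mul4 A B)"
  by (cases A; cases B; simp)+

lemma neg4_neg [simp]: "neg4 (neg4 A) = A"
  by (cases A) simp

lemma det4_neg [simp]: "det4 (neg4 A) = det4 A"
  by (cases A) simp

lemma size4_neg [simp]: "size4 (neg4 A) = size4 A"
  by (cases A) simp

lemma mul4_cancel:
  assumes "det4 A = 1" "mul4 A B = mul4 A C"
  shows "B = C"
proof -
  obtain a b c d where A: "A = (a, b, c, d)" by (cases A)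
  have "mul4 (d, - b, - c, a) A = one4"
    using assms(1) by (simp add: A one4_def algebra_simps)
  then show ?thesis using assms(2) mul4_assoc mul4_one(1) by metis
qed

lemma prod4_simps [simp]: "prod4 [] = one4" "prod4 (A # As) = mul4 A (prod4 As)"
  by (simp_all add: prod4_def)

lemma prod4_append: "prod4 (As @ Bs) = mul4 (prod4 As) (prod4 Bs)"
  by (induction As) (simp_all add: mul4_assoc)

subsection \<open>Generation by two elements of finite order\<close>

text \<open>\<open>LS\<close> has square \<open>-1\<close>, \<open>LU\<close> has order 3 and \<open>LV\<close> is its square.\<close>

datatype letter = LS | LU | LV

fun letter_val :: "letter \<Rightarrow> m4" where
  "letter_val LS = (0, - 1, 1, 0)"
| "letter_val LU = (0, - 1, 1, - 1)"
| "letter_val LV = (- 1, 1, - 1, 0)"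

definition gen_val :: "bool \<Rightarrow> m4" where
  "gen_val b = letter_val (if b then LU else LS)"

lemma abs_diff_eq: "0 \<le> a * c \<Longrightarrow> \<bar>c\<bar> \<le> \<bar>a\<bar> \<Longrightarrow> \<bar>a - c\<bar> = \<bar>a\<bar> - \<bar>c\<bar>" for a c :: int
  by (auto simp: zero_le_mult_iff abs_if)

lemma abs_add_eq: "a * c \<le> 0 \<Longrightarrow> \<bar>c\<bar> \<le> \<bar>a\<bar> \<Longrightarrow> \<bar>a + c\<bar> = \<bar>a\<bar> - \<bar>c\<bar>" for a c :: int
  by (auto simp: mult_le_0_iff abs_if)

lemma int_size4: "int (size4 (a, b, c, d)) = \<bar>a\<bar> + \<bar>b\<bar> + \<bar>c\<bar> + \<bar>d\<bar>"
  by simp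

text \<open>With \<open>n = b * c\<close> one has
  \<open>(a * c) * (b * d) = n * (n + 1) \<ge> 0\<close>, so both columns have the same sign
  pattern. If neither row dominated the other, \<open>\<bar>a * d\<bar>\<close> and
  \<open>\<bar>b * c\<bar>\<close> would differ by more than 1 unless one of the diagonals vanishes,
  which leaves only matrices of size 2.\<close>

lemma unimodular_rows_comparable:
  fixes a b c d :: int
  assumes det: "a * d - b * c = 1" and big: "\<bar>a\<bar> + \<bar>b\<bar> + \<bar>c\<bar> + \<bar>d\<bar> > 2"
  shows "(0 \<le> a * c \<and> 0 \<le> b * d \<or> a * c \<le> 0 \<and> b * d \<le> 0) \<and>
    (\<bar>c\<bar> \<le> \<bar>a\<bar> \<and> \<bar>d\<bar> \<le> \<bar>b\<bar> \<or> \<bar>a\<bar> \<le> \<bar>c\<bar> \<and> \<bar>b\<bar> \<le> \<bar>d\<bar>)"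
proof
  have p: "a * d = b * c + 1" using det by simp
  have nonneg: "0 \<le> (b * c + 1) * (b * c)"
    by (cases "b * c \<ge> 0") (auto intro: mult_nonneg_nonneg mult_nonpos_nonpos)
  have "(a * c) * (b * d) = (a * d) * (b * c)" by (simp add: algebra_simps)
  also have "\<dots> = (b * c + 1) * (b * c)" by (simp only: p)
  finally have "0 \<le> (a * c) * (b * d)" using nonneg by (simp only:)
  then show "0 \<le> a * c \<and> 0 \<le> b * d \<or> a * c \<le> 0 \<and> b * d \<le> 0"
    by (simp add: zero_le_mult_iff)
  have "\<bar>a * d\<bar> \<le> \<bar>b * c\<bar> + 1" "\<bar>b * c\<bar> \<le> \<bar>a * d\<bar> + 1" using p by linarith+
  then have ad: "\<bar>a\<bar> * \<bar>d\<bar> \<le> \<bar>b\<bar> * \<bar>c\<bar> + 1" and bc: "\<bar>b\<bar> * \<bar>c\<bar> \<le> \<bar>a\<bar> * \<bar>d\<bar> + 1"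
    by (simp_all add: abs_mult)
  show "\<bar>c\<bar> \<le> \<bar>a\<bar> \<and> \<bar>d\<bar> \<le> \<bar>b\<bar> \<or> \<bar>a\<bar> \<le> \<bar>c\<bar> \<and> \<bar>b\<bar> \<le> \<bar>d\<bar>"
  proof (rule ccontr)
    assume "\<not> ?thesis"
    then consider "\<bar>a\<bar> \<ge> \<bar>c\<bar> + 1" "\<bar>d\<bar> \<ge> \<bar>b\<bar> + 1" | "\<bar>c\<bar> \<ge> \<bar>a\<bar> + 1" "\<bar>b\<bar> \<ge> \<bar>d\<bar> + 1" by linarith
    then show False
    proof cases
      case 1
      then have "(\<bar>c\<bar> + 1) * (\<bar>b\<bar> + 1) \<le> \<bar>a\<bar> * \<bar>d\<bar>" by (intro mult_mono) auto
      with ad have "\<bar>b\<bar> + \<bar>c\<bar> \<le> 0" by (simp add: algebra_simps)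
      then have "b = 0" "c = 0" by linarith+
      with det have "a * d = 1" by simp
      then have "\<bar>a\<bar> = 1" "\<bar>d\<bar> = 1" by (auto simp: zmult_eq_1_iff)
      with \<open>b = 0\<close> \<open>c = 0\<close> big show False by simp
    next
      case 2
      then have "(\<bar>d\<bar> + 1) * (\<bar>a\<bar> + 1) \<le> \<bar>b\<bar> * \<bar>c\<bar>" by (intro mult_mono) auto
      with bc have "\<bar>a\<bar> + \<bar>d\<bar> \<le> 0" by (simp add: algebra_simps)
      then have "a = 0" "d = 0" by linarith+
      with det have "b * (- c) = 1" by simp
      then have "\<bar>b\<bar> = 1" "\<bar>c\<bar> = 1" by (auto simp: zmult_eq_1_iff simp del: mult_minus_right)
      with \<open>a = 0\<close> \<open>d = 0\<close> big show False by simp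
    qed
  qed
qed

text \<open>A step of Euclid's algorithm: subtracting the smaller row from the larger, or adding it
  if the signs are opposite, shrinks both columns at once.\<close>

lemma size4_decreasing_row_operation:
  assumes "det4 A = 1" "size4 A > 2"
  shows "\<exists>E \<in> {(1, 1, 0, 1), (1, - 1, 0, 1), (1, 0, 1, 1), (1, 0, - 1, 1)}. size4 (mul4 E A) < size4 A"
proof -
  obtain a b c d where A: "A = (a, b, c, d)" by (cases A)
  have det: "a * d - b * c = 1" using assms(1) by (simp add: A)
  have big: "\<bar>a\<bar> + \<bar>b\<bar> + \<bar>c\<bar> + \<bar>d\<bar> > 2" using assms(2) int_size4[of a b c d] unfolding A by linarith
  have "\<not> (a = 0 \<and> b = 0)" "\<not> (c = 0 \<and> d = 0)" using det by auto
  then have row: "\<bar>a\<bar> + \<bar>b\<bar> > 0" "\<bar>c\<bar> + \<bar>d\<bar> > 0" by linarith+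
  note cmp = unimodular_rows_comparable[OF det big]
  consider "0 \<le> a * c" "0 \<le> b * d" "\<bar>c\<bar> \<le> \<bar>a\<bar>" "\<bar>d\<bar> \<le> \<bar>b\<bar>"
    | "0 \<le> a * c" "0 \<le> b * d" "\<bar>a\<bar> \<le> \<bar>c\<bar>" "\<bar>b\<bar> \<le> \<bar>d\<bar>"
    | "a * c \<le> 0" "b * d \<le> 0" "\<bar>c\<bar> \<le> \<bar>a\<bar>" "\<bar>d\<bar> \<le> \<bar>b\<bar>"
    | "a * c \<le> 0" "b * d \<le> 0" "\<bar>a\<bar> \<le> \<bar>c\<bar>" "\<bar>b\<bar> \<le> \<bar>d\<bar>"
    using cmp by blast
  then show ?thesis
  proof cases
    case 1
    then have "int (size4 (mul4 (1, - 1, 0, 1) A)) < int (size4 A)"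
      unfolding A mul4.simps int_size4 using row abs_diff_eq[of a c] abs_diff_eq[of b d]
      by (simp add: mult.commute add.commute)
    then have "size4 (mul4 (1, - 1, 0, 1) A) < size4 A" by simp
    then show ?thesis by blast
  next
    case 2
    then have "int (size4 (mul4 (1, 0, - 1, 1) A)) < int (size4 A)"
      unfolding A mul4.simps int_size4 using row abs_diff_eq[of c a] abs_diff_eq[of d b]
      by (simp add: mult.commute add.commute)
    then have "size4 (mul4 (1, 0, - 1, 1) A) < size4 A" by simp
    then show ?thesis by blast
  next
    case 3
    then have "int (size4 (mul4 (1, 1, 0, 1) A)) < int (size4 A)"
      unfolding A mul4.simps int_size4 using row abs_add_eq[of a c] abs_add_eq[of b d]
      by (simp add: mult.commute add.commute)
    then have "size4 (mul4 (1, 1, 0, 1) A) < size4 A" by simp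
    then show ?thesis by blast
  next
    case 4
    then have "int (size4 (mul4 (1, 0, 1, 1) A)) < int (size4 A)"
      unfolding A mul4.simps int_size4 using row abs_add_eq[of c a] abs_add_eq[of d b]
      by (simp add: mult.commute add.commute)
    then have "size4 (mul4 (1, 0, 1, 1) A) < size4 A" by simp
    then show ?thesis by blast
  qed
qed

lemma prod4_gen_val: "prod4 (map gen_val [False, False, False, True]) = (1, - 1, 0, 1)"
    "prod4 (map gen_val [True, True, False]) = (1, 1, 0, 1)"
    "prod4 (map gen_val [True, False, False, False]) = (1, 0, 1, 1)"
    "prod4 (map gen_val [False, True, True]) = (1, 0, - 1, 1)"
  by (simp_all add: gen_val_def one4_def)

text \<open>Each row operation lowers the size and is undone by at most four letters, whence the
  factor 4. What remains are four matrices of size 2, written with at most three letters.\<close>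

lemma generated_by_two:
  "det4 A = 1 \<Longrightarrow> \<exists>bs. length bs \<le> 4 * size4 A \<and> prod4 (map gen_val bs) = A"
proof (induction "size4 A" arbitrary: A rule: less_induct)
  case less
  show ?case
  proof (cases "size4 A > 2")
    case True
    obtain E where E: "E \<in> {(1, 1, 0, 1), (1, - 1, 0, 1), (1, 0, 1, 1), (1, 0, - 1, 1)}"
      "size4 (mul4 E A) < size4 A" using size4_decreasing_row_operation[OF less.prems True] by blast
    have "det4 (mul4 E A) = 1" using E(1) less.prems by (auto simp: det4_mul)
    from less.hyps[OF E(2) this] obtain bs
      where bs: "length bs \<le> 4 * size4 (mul4 E A)" "prod4 (map gen_val bs) = mul4 E A" by blast
    have "\<exists>cs. length cs \<le> 4 \<and> mul4 (prod4 (map gen_val cs)) E = one4"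
    proof -
      consider "E = (1, 1, 0, 1)" | "E = (1, - 1, 0, 1)" | "E = (1, 0, 1, 1)" | "E = (1, 0, - 1, 1)"
        using E(1) by blast
      then show ?thesis
      proof cases
        case 1
        then show ?thesis
          by (intro exI[of _ "[False, False, False, True]"]) (simp only: prod4_gen_val, simp add: one4_def)
      next
        case 2
        then show ?thesis
          by (intro exI[of _ "[True, True, False]"]) (simp only: prod4_gen_val, simp add: one4_def)
      next
        case 3
        then show ?thesis
          by (intro exI[of _ "[False, True, True]"]) (simp only: prod4_gen_val, simp add: one4_def)
      next
        case 4
        then show ?thesis
          by (intro exI[of _ "[True, False, False, False]"]) (simp only: prod4_gen_val, simp add: one4_def)
      qed
    qed
    then obtain cs where cs: "length cs \<le> 4" "mul4 (prod4 (map gen_val cs)) E = one4" by blast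
    have "prod4 (map gen_val (cs @ bs)) = A"
      using cs(2) bs(2) by (simp add: prod4_append mul4_assoc[symmetric])
    moreover have "length (cs @ bs) \<le> 4 * size4 A" using cs(1) bs(1) E(2) by simp
    ultimately show ?thesis by blast
  next
    case False
    obtain a b c d where A: "A = (a, b, c, d)" by (cases A)
    have sz: "\<bar>a\<bar> + \<bar>b\<bar> + \<bar>c\<bar> + \<bar>d\<bar> \<le> 2" using False int_size4[of a b c d] unfolding A by linarith
    have det: "a * d - b * c = 1" using less.prems by (simp add: A)
    have "A \<in> {(1, 0, 0, 1), (- 1, 0, 0, - 1), (0, - 1, 1, 0), (0, 1, - 1, 0)}"
    proof (cases "a * d = 0")
      case True
      then have "- (b * c) = 1" using det by linarith
      then have bc: "b * (- c) = 1" by simp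
      then have "b = 1 \<and> c = - 1 \<or> b = - 1 \<and> c = 1"
        by (auto simp: zmult_eq_1_iff simp del: mult_minus_right)
      moreover from this have "\<bar>b\<bar> = 1" "\<bar>c\<bar> = 1" by auto
      then have "a = 0" "d = 0" using sz by linarith+
      ultimately show ?thesis by (auto simp: A)
    next
      case nz: False
      then have ad: "\<bar>a\<bar> \<ge> 1" "\<bar>d\<bar> \<ge> 1" by auto
      then have "b = 0" "c = 0" using sz by linarith+
      then have "a * d = 1" using det by simp
      then show ?thesis using \<open>b = 0\<close> \<open>c = 0\<close> by (auto simp: A zmult_eq_1_iff)
    qed
    then show ?thesis
    proof (elim insertE emptyE)
      assume "A = (1, 0, 0, 1)"
      then show ?thesis by (intro exI[of _ "[]"]) (simp add: one4_def)
    next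
      assume "A = (- 1, 0, 0, - 1)"
      then show ?thesis by (intro exI[of _ "[False, False]"]) (simp add: gen_val_def)
    next
      assume "A = (0, - 1, 1, 0)"
      then show ?thesis by (intro exI[of _ "[False]"]) (simp add: gen_val_def)
    next
      assume "A = (0, 1, - 1, 0)"
      then show ?thesis by (intro exI[of _ "[False, False, False]"]) (simp add: gen_val_def)
    qed
  qed
qed

subsection \<open>Normal forms as a stack\<close>

text \<open>The top of the stack is the head of the list and the last factor of the product.\<close>

fun word_val :: "letter list \<Rightarrow> m4" where
  "word_val [] = one4"
| "word_val (l # w) = mul4 (word_val w) (letter_val l)"

text \<open>The flag is the sign that is lost in PSL(2,Z).\<close>

fun stack_val :: "bool \<times> letter list \<Rightarrow> m4" where
  "stack_val (n, w) = (if n then neg4 (word_val w) else word_val w)"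

fun push_S :: "bool \<times> letter list \<Rightarrow> bool \<times> letter list" where
  "push_S (n, LS # w) = (\<not> n, w)"
| "push_S (n, w) = (n, LS # w)"

fun push_U :: "bool \<times> letter list \<Rightarrow> bool \<times> letter list" where
  "push_U (n, LU # w) = (n, LV # w)"
| "push_U (n, LV # w) = (n, w)"
| "push_U (n, w) = (n, LU # w)"

definition push :: "bool \<Rightarrow> bool \<times> letter list \<Rightarrow> bool \<times> letter list" where
  "push b = (if b then push_U else push_S)"

text \<open>The normal forms in the free product of groups of order 2 and 3, the latter having the
  nontrivial elements \<open>LU\<close> and \<open>LV\<close>.\<close>

fun alternating :: "letter list \<Rightarrow> bool" where
  "alternating (l # l' # w) \<longleftrightarrow> (l = LS) \<noteq> (l' = LS) \<and> alternating (l' # w)"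
| "alternating _ \<longleftrightarrow> True"

lemma word_val_append: "word_val (u @ w) = mul4 (word_val w) (word_val u)"
  by (induction u) (simp_all add: mul4_assoc)

lemma stack_val_append: "stack_val (n, u @ w) = mul4 (word_val w) (stack_val (n, u))"
  by (simp add: word_val_append mul4_neg)

lemma det4_word: "det4 (word_val w) = 1"
proof (induction w)
  case (Cons l w)
  then show ?case by (cases l) (simp_all add: det4_mul)
qed (simp add: one4_def)

lemma det4_stack: "det4 (stack_val c) = 1"
  by (cases c) (simp add: det4_word)

lemma letter_relations:
  "mul4 (mul4 A (letter_val LS)) (letter_val LS) = neg4 A"
  "mul4 (mul4 A (letter_val LU)) (letter_val LU) = mul4 A (letter_val LV)"
  "mul4 (mul4 A (letter_val LV)) (letter_val LU) = A"
  by (cases A; simp)+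

lemma stack_val_push: "stack_val (push b c) = mul4 (stack_val c) (gen_val b)"
proof (cases b)
  case True
  then show ?thesis
    by (cases c rule: push_U.cases)
      (simp_all add: push_def gen_val_def mul4_neg letter_relations del: letter_val.simps)
next
  case False
  then show ?thesis
    by (cases c rule: push_S.cases)
      (simp_all add: push_def gen_val_def mul4_neg letter_relations del: letter_val.simps)
qed

lemma reduced_tl: "alternating (l # w) \<Longrightarrow> alternating w"
  by (cases w) auto

lemma reduced_push: "alternating (snd c) \<Longrightarrow> alternating (snd (push b c))"
proof (cases b)
  case True
  assume "alternating (snd c)"
  then show ?thesis using True
    by (cases c rule: push_U.cases; cases "tl (snd c)") (auto simp: push_def dest: reduced_tl)
next
  case False
  assume "alternating (snd c)"
  then show ?thesis using False
    by (cases c rule: push_S.cases) (auto simp: push_def dest: reduced_tl)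
qed

text \<open>One push replaces the top letter by at most two letters, so \<open>r\<close> pushes
  reach at most \<open>r\<close> letters deep and leave at most \<open>2 * r\<close> letters in
  their place.\<close>

definition stack_step :: "nat \<Rightarrow> letter list \<Rightarrow> letter list \<Rightarrow> bool" where
  "stack_step r w w' \<longleftrightarrow> (\<exists>u. w' = u @ drop r w \<and> length u \<le> 2 * r)"

lemma stack_step_push: "\<exists>u. snd (push b c) = u @ drop 1 (snd c) \<and> length u \<le> 2"
proof (cases b)
  case True
  then show ?thesis
    by (cases c rule: push_U.cases) (auto simp: push_def)
next
  case False
  then show ?thesis
    by (cases c rule: push_S.cases) (auto simp: push_def)
qed

lemma stack_step_pushes: "stack_step (length bs) (snd c) (snd (fold push bs c))"
proof (induction bs rule: rev_induct)
  case Nil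
  then show ?case by (simp add: stack_step_def)
next
  case (snoc b bs)
  let ?n = "length bs"
  obtain u where u: "snd (fold push bs c) = u @ drop ?n (snd c)" "length u \<le> 2 * ?n"
    using snoc by (auto simp: stack_step_def)
  obtain v where v: "snd (push b (fold push bs c)) = v @ drop 1 (snd (fold push bs c))" "length v \<le> 2"
    using stack_step_push by blast
  show ?case
  proof (cases u)
    case Nil
    then show ?thesis using u v by (auto simp: stack_step_def intro: exI[of _ v])
  next
    case (Cons l u')
    have "snd (push b (fold push bs c)) = (v @ u' @ take 1 (drop ?n (snd c))) @ drop (Suc ?n) (snd c)"
      using u v Cons append_take_drop_id[of 1 "drop ?n (snd c)"] by simp
    moreover have "length (v @ u' @ take 1 (drop ?n (snd c))) \<le> 2 * Suc ?n" using u v Cons by simp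
    ultimately show ?thesis unfolding stack_step_def by auto
  qed
qed

lemma stack_step_mono: "stack_step m w w' \<Longrightarrow> m \<le> r \<Longrightarrow> stack_step r w w'"
proof -
  assume "stack_step m w w'" and mr: "m \<le> r"
  then obtain u where u: "w' = u @ drop m w" "length u \<le> 2 * m" by (auto simp: stack_step_def)
  have "w' = (u @ take (r - m) (drop m w)) @ drop r w"
    using u mr append_take_drop_id[of "r - m" "drop m w"] by simp
  moreover have "length (u @ take (r - m) (drop m w)) \<le> 2 * r" using u(2) mr by simp
  ultimately show ?thesis unfolding stack_step_def by blast
qed

text \<open>\<open>S U\<close> and \<open>S V\<close> are, up to sign, the inverses of the two elementary matrices, whose products do not
  cancel: both rows keep entries of opposite signs, so that the entries grow.\<close>

lemma word_growth:
  "alternating w \<Longrightarrow> w = [] \<or> hd w \<noteq> LS \<Longrightarrow>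
   (case word_val w of (a, b, c, d) \<Rightarrow> a * b \<le> 0 \<and> c * d \<le> 0) \<and> length w + 1 \<le> 2 * size4 (word_val w)"
proof (induction w rule: length_induct)
  case (1 w)
  consider "w = []" | l where "w = [l]" "l \<noteq> LS" | l w' where "w = l # LS # w'" "l \<noteq> LS"
  proof (cases w)
    case Nil
    then show ?thesis using that by blast
  next
    case (Cons l v)
    with 1 have "l \<noteq> LS" by simp
    with Cons 1 that show ?thesis by (cases v) auto
  qed
  then show ?case
  proof cases
    case 1
    then show ?thesis by (simp add: one4_def)
  next
    case 2
    then show ?thesis by (cases l) (simp_all add: one4_def)
  next
    case (3 l w')
    obtain a b c d where A: "word_val w' = (a, b, c, d)" by (cases "word_val w'")
    have "alternating w'" "w' = [] \<or> hd w' \<noteq> LS"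
      using "1.prems" 3 by (cases w'; auto dest: reduced_tl)+
    with "1.IH"[rule_format, of w'] 3(1) have IH: "a * b \<le> 0" "c * d \<le> 0" "length w' + 1 \<le> 2 * size4 (a, b, c, d)"
      by (auto simp: A)
    have det: "a * d - b * c = 1" using det4_word[of w'] by (simp add: A)
    have "\<not> (a = 0 \<and> c = 0)" "\<not> (b = 0 \<and> d = 0)" using det by auto
    then have pos: "\<bar>a\<bar> + \<bar>c\<bar> > 0" "\<bar>b\<bar> + \<bar>d\<bar> > 0" by linarith+
    have abs: "\<bar>a - b\<bar> = \<bar>a\<bar> + \<bar>b\<bar>" "\<bar>c - d\<bar> = \<bar>c\<bar> + \<bar>d\<bar>"
      using IH(1,2) by (auto simp: mult_le_0_iff abs_if)
    have ge: "a * b \<le> a * a" "a * b \<le> b * b" "c * d \<le> c * c" "c * d \<le> d * d"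
      using IH(1,2) zero_le_square[of a] zero_le_square[of b] zero_le_square[of c] zero_le_square[of d]
      by linarith+
    have IH3: "int (length w') + 1 \<le> 2 * (\<bar>a\<bar> + \<bar>b\<bar> + \<bar>c\<bar> + \<bar>d\<bar>)"
    proof -
      have "int (length w' + 1) \<le> int (2 * size4 (a, b, c, d))" using IH(3) by (simp only: of_nat_le_iff)
      then show ?thesis by (simp only: of_nat_add of_nat_mult int_size4 of_nat_1 of_nat_numeral)
    qed
    show ?thesis
    proof (cases l)
      case LU
      have w: "word_val w = (- a, a - b, - c, c - d)" using 3 LU A by (simp add: algebra_simps)
      have "int (length w + 1) \<le> int (2 * size4 (word_val w))"
        unfolding w of_nat_mult int_size4 using IH3 abs pos 3(1) by simp
      then show ?thesis using ge by (simp only: of_nat_le_iff) (simp add: w algebra_simps)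
    next
      case LV
      have w: "word_val w = (a - b, b, c - d, d)" using 3 LV A by (simp add: algebra_simps)
      have "int (length w + 1) \<le> int (2 * size4 (word_val w))"
        unfolding w of_nat_mult int_size4 using IH3 abs pos 3(1) by simp
      then show ?thesis using ge by (simp only: of_nat_le_iff) (simp add: w algebra_simps)
    qed (use 3 in simp)
  qed
qed

text \<open>A top letter \<open>LS\<close> only exchanges the columns up to sign, which keeps the
  size; the \<open>+ 1\<close> in \<open>word_growth\<close> pays for it.\<close>

lemma reduced_length: "alternating w \<Longrightarrow> length w \<le> 2 * size4 (word_val w)"
proof (cases "w = [] \<or> hd w \<noteq> LS")
  case True
  assume "alternating w"
  with word_growth[OF this True] show ?thesis by simp
next
  case False
  assume r: "alternating w"
  obtain w' where w: "w = LS # w'" using False by (cases w) auto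
  obtain a b c d where A: "word_val w' = (a, b, c, d)" by (cases "word_val w'")
  have "alternating w'" "w' = [] \<or> hd w' \<noteq> LS" using r w by (cases w'; auto dest: reduced_tl)+
  from word_growth[OF this] show ?thesis by (simp add: w A)
qed

lemma reduced_stack_length: "alternating (snd c) \<Longrightarrow> length (snd c) \<le> 2 * size4 (stack_val c)"
  using reduced_length by (cases c) simp

subsection \<open>Pumping\<close>

definition stacks_upto :: "nat \<Rightarrow> (bool \<times> letter list) set" where
  "stacks_upto l = {c. length (snd c) \<le> l}"

lemma UNIV_letter: "UNIV = {LS, LU, LV}"
  using letter.exhaust by blast

lemma sum_pow3: "(\<Sum>i\<le>n. 3 ^ i) \<le> (4 :: nat) ^ n"
proof (induction n)
  case (Suc n)
  have "(3 :: nat) ^ n \<le> 4 ^ n" by (rule power_mono) simp_all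
  then show ?case using Suc by simp
qed simp

lemma card_stacks_upto: "finite (stacks_upto l) \<and> card (stacks_upto l) \<le> 2 * 4 ^ l"
proof -
  have eq: "stacks_upto l = UNIV \<times> {w. set w \<subseteq> {LS, LU, LV} \<and> length w \<le> l}"
    by (auto simp: stacks_upto_def UNIV_letter[symmetric])
  have "card (stacks_upto l) = 2 * (\<Sum>i\<le>l. 3 ^ i)"
  proof -
    have fin: "finite {LS, LU, LV}" and c3: "card {LS, LU, LV} = 3" by simp_all
    show ?thesis by (simp only: eq card_cartesian_product card_UNIV_bool card_lists_length_le[OF fin] c3)
  qed
  moreover have "finite (stacks_upto l)" unfolding eq by (intro finite_cartesian_product finite_lists_length_le) auto
  ultimately show ?thesis using sum_pow3[of l] by simp
qed

lemma pigeonhole_stacks: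
  fixes I :: "nat set"
  assumes "\<And>i. i \<in> I \<Longrightarrow> f i \<in> stacks_upto l" "finite I" "card I > 2 * 4 ^ l"
  shows "\<exists>i\<in>I. \<exists>j\<in>I. i < j \<and> f i = f j"
proof -
  have "card (f ` I) \<le> card (stacks_upto l)"
    using assms card_stacks_upto by (intro card_mono) auto
  then have "card (f ` I) < card I" using card_stacks_upto[of l] assms(3) by linarith
  then have "\<not> inj_on f I" by (rule pigeonhole)
  then show ?thesis unfolding inj_on_def by (metis linorder_neqE_nat)
qed

text \<open>Room for \<open>K + 1\<close> levels at distance \<open>2 * r\<close>, where
  \<open>K = (2 * 4 ^ (3 * r)) ^ 2\<close> bounds the number of pairs of signed stacks of height at
  most \<open>3 * r\<close>, one for the ascent and one for the descent. The lowest level is still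
  \<open>3 * r\<close> above the bound \<open>m\<close> on the final height.\<close>

definition pump_depth :: "nat \<Rightarrow> nat \<Rightarrow> nat" where
  "pump_depth m r = m + 2 * r * (2 * 4 ^ (3 * r)) ^ 2 + 3 * r + 1"

text \<open>At least the number of signed stacks of height up to \<open>pump_depth m r\<close>; a
  longer stretch below that height repeats one.\<close>

definition pump_length :: "nat \<Rightarrow> nat \<Rightarrow> nat" where
  "pump_length m r = 2 * 4 ^ pump_depth m r"

text \<open>That at most \<open>N\<close> factors are lost is essential: repeated shortening then
  cannot jump over a window of \<open>N\<close> consecutive lengths.\<close>

definition shortened :: "m4 list \<Rightarrow> nat \<Rightarrow> bool" where
  "shortened As N \<longleftrightarrow> (\<exists>Bs. set Bs \<subseteq> set As \<and> prod4 Bs = prod4 As \<and> length Bs < length As \<and>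
     length As \<le> length Bs + N)"

text \<open>Every factor costs at most \<open>r\<close> letters. By
  \<open>reduced_stack_length\<close>, \<open>m\<close> bounds the height of the final
  stack.\<close>

context
  fixes As :: "m4 list" and wd :: "m4 \<Rightarrow> bool list" and r m :: nat
  assumes wd: "A \<in> set As \<Longrightarrow> prod4 (map gen_val (wd A)) = A \<and> length (wd A) \<le> r"
    and m: "2 * size4 (prod4 As) \<le> m"
begin

definition stack_at :: "nat \<Rightarrow> bool \<times> letter list" where
  "stack_at i = fold push (concat (map wd (take i As))) (False, [])"

definition height :: "nat \<Rightarrow> nat" where
  "height i = length (snd (stack_at i))"

lemma stack_val_pushes: "stack_val (fold push bs c) = mul4 (stack_val c) (prod4 (map gen_val bs))"
  by (induction bs arbitrary: c) (simp_all add: stack_val_push mul4_assoc)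

lemma reduced_pushes: "alternating (snd c) \<Longrightarrow> alternating (snd (fold push bs c))"
  by (induction bs arbitrary: c) (simp_all add: reduced_push)

lemma stack_at_Suc: "i < length As \<Longrightarrow> stack_at (Suc i) = fold push (wd (As ! i)) (stack_at i)"
  by (simp add: stack_at_def take_Suc_conv_app_nth)

lemma stack_at_val: "i \<le> length As \<Longrightarrow> stack_val (stack_at i) = prod4 (take i As)"
proof (induction i)
  case (Suc i)
  then show ?case using wd[of "As ! i"]
    by (simp add: stack_at_Suc stack_val_pushes take_Suc_conv_app_nth prod4_append)
qed (simp add: stack_at_def)

lemma step_at: "i < length As \<Longrightarrow> stack_step r (snd (stack_at i)) (snd (stack_at (Suc i)))"
  using stack_step_pushes[of "wd (As ! i)" "stack_at i"] wd[of "As ! i"]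
  by (auto simp: stack_at_Suc intro: stack_step_mono)

lemma height_0: "height 0 = 0"
  by (simp add: height_def stack_at_def)

lemma height_last: "height (length As) \<le> m"
proof -
  have "alternating (snd (stack_at (length As)))" unfolding stack_at_def by (rule reduced_pushes) simp
  from reduced_stack_length[OF this] m show ?thesis by (simp add: height_def stack_at_val)
qed

lemma height_Suc: "i < length As \<Longrightarrow> height (Suc i) \<le> height i + 2 * r"
  using step_at[of i] by (auto simp: stack_step_def height_def)

definition segment :: "nat \<Rightarrow> nat \<Rightarrow> m4 list" where
  "segment i j = drop i (take j As)"

lemma segment_val:
  assumes "i \<le> j" "j \<le> length As"
  shows "stack_val (stack_at j) = mul4 (stack_val (stack_at i)) (prod4 (segment i j))"
proof -
  have "take j As = take i As @ segment i j"
    using assms append_take_drop_id[of i "take j As"] by (simp add: segment_def min_def)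
  with assms show ?thesis by (simp add: stack_at_val prod4_append)
qed

text \<open>Used in two ways: with an empty inner segment for a repeated stack, and with two nested
  passages over different levels.\<close>

lemma splice:
  assumes "i \<le> i'" "i' \<le> j'" "j' \<le> j" "j \<le> length As" "j' - i' < j - i" "j - i \<le> N"
    and "prod4 (segment i j) = prod4 (segment i' j')"
  shows "shortened As N"
proof -
  let ?Bs = "take i As @ segment i' j' @ drop j As"
  have "i \<le> j" using assms by linarith
  then have "take j As = take i As @ segment i j"
    using append_take_drop_id[of i "take j As"] by (simp add: segment_def min_def)
  then have As: "As = take i As @ segment i j @ drop j As"
    by (metis append.assoc append_take_drop_id)
  have "prod4 As = prod4 ?Bs"
    using assms(7) arg_cong[OF As, of prod4] by (simp add: prod4_append)
  moreover have "set ?Bs \<subseteq> set As"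
    unfolding segment_def by (auto dest!: in_set_dropD in_set_takeD)
  moreover have "length ?Bs = i + (j' - i') + (length As - j)" using assms by (simp add: segment_def)
  ultimately show ?thesis unfolding shortened_def using assms by (intro exI[of _ ?Bs]) auto
qed

lemma repetition:
  assumes "i < j" "j \<le> length As" "j - i \<le> N"
    and "stack_at i = (n, u @ z)" "stack_at j = (n, u @ z)"
  shows "shortened As N"
proof -
  have "mul4 (stack_val (stack_at i)) (prod4 (segment i j)) = mul4 (stack_val (stack_at i)) one4"
    using segment_val[of i j] assms by simp
  then have "prod4 (segment i j) = prod4 (segment j j)"
    using mul4_cancel[OF det4_stack] by (simp add: segment_def)
  with assms show ?thesis by (intro splice[of i j j j]) auto
qed

text \<open>The window has \<open>N + 1\<close> positions, but there are at most \<open>N\<close>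
  signed stacks of height up to \<open>l\<close> that can stand above the common bottom
  \<open>z\<close>.\<close>

lemma repetition_window:
  assumes "i + N \<le> length As" "N = 2 * 4 ^ l"
    and "\<And>j. i \<le> j \<Longrightarrow> j \<le> i + N \<Longrightarrow> \<exists>u. snd (stack_at j) = u @ z \<and> length u \<le> l"
  shows "shortened As N"
proof -
  obtain u where u: "\<And>j. i \<le> j \<Longrightarrow> j \<le> i + N \<Longrightarrow> snd (stack_at j) = u j @ z \<and> length (u j) \<le> l"
    using assms(3) by metis
  have "\<exists>a\<in>{i..i + N}. \<exists>b\<in>{i..i + N}. a < b \<and> (fst (stack_at a), u a) = (fst (stack_at b), u b)"
    using u assms(2) by (intro pigeonhole_stacks[of _ _ l]) (auto simp: stacks_upto_def)
  then obtain a b where "a \<in> {i..i + N}" "b \<in> {i..i + N}" "a < b"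
    "fst (stack_at a) = fst (stack_at b)" "u a = u b" by auto
  with u assms(1) show ?thesis
    by (intro repetition[of a b _ "fst (stack_at a)" "u a" z]) (auto simp: prod_eq_iff)
qed

text \<open>A factor touches only the top \<open>r\<close> letters. Before every step of the stretch
  the height is at least \<open>l - 2 * r\<close>, so the lowest \<open>l - 3 * r\<close> letters
  survive it.\<close>

lemma common_bottom:
  assumes "a \<le> b" "b \<le> length As" "l \<ge> 3 * r" "height a \<ge> l - 2 * r"
    and "\<And>i. a < i \<Longrightarrow> i < b \<Longrightarrow> height i > l"
  shows "\<exists>z. length z = l - 3 * r \<and> (\<forall>i. a \<le> i \<longrightarrow> i \<le> b \<longrightarrow> (\<exists>u. snd (stack_at i) = u @ z))"
proof -
  define z where "z = drop (height a - (l - 3 * r)) (snd (stack_at a))"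
  have z: "length z = l - 3 * r" using assms(3,4) by (simp add: z_def height_def)
  have "\<exists>u. snd (stack_at i) = u @ z" if "a \<le> i" "i \<le> b" for i
    using that
  proof (induction i rule: dec_induct)
    case base
    then show ?case unfolding z_def by (metis append_take_drop_id)
  next
    case (step i)
    then obtain u where u: "snd (stack_at i) = u @ z" by auto
    have "height i \<ge> l - 2 * r" using assms(4) assms(5)[of i] step by (cases "i = a") auto
    then have "length u \<ge> r" using u z assms(3) by (simp add: height_def)
    then have "drop r (snd (stack_at i)) = drop r u @ z" using u by simp
    moreover have "i < length As" using step assms(2) by simp
    ultimately show ?case using step_at[of i] by (auto simp: stack_step_def)
  qed
  with z show ?thesis by blast
qed

text \<open>A long factorization either repeats a short stack or climbs high; in the latter case, at two of
  many levels below the summit the ascent and the descent pass the level in the same way, and the part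
  between the outer passages can be replaced by the part between the inner ones.\<close>

lemma pumping:
  assumes "r \<ge> 1" "length As > pump_length m r"
  shows "shortened As (pump_length m r)"
proof -
  define K :: nat where "K = (2 * 4 ^ (3 * r)) ^ 2"
  define H where "H = pump_depth m r"
  define N where "N = pump_length m r"
  define T where "T = length As"
  have H: "H = m + 2 * r * K + 3 * r + 1" by (simp add: H_def K_def pump_depth_def)
  have N: "N = 2 * 4 ^ H" by (simp add: N_def H_def pump_length_def)
  have T: "T > N" using assms by (simp add: T_def N_def)
  show ?thesis
  proof (cases "\<forall>i\<le>T. height i \<le> H")
    case True
    then have "shortened As N" using T N
      by (intro repetition_window[of 0 N H "[]"]) (auto simp: T_def height_def)
    then show ?thesis by (simp add: N_def)
  next
    case False
    define h where "h = Max (height ` {..T})"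
    have h_ge: "height i \<le> h" if "i \<le> T" for i using that by (simp add: h_def)
    have "h \<in> height ` {..T}" unfolding h_def by (rule Max_in) auto
    then obtain s where s: "s \<le> T" "height s = h" by auto
    have hH: "h \<ge> H" using False h_ge by (meson le_cases le_trans)
    \<comment> \<open>The levels are \<open>2 * r\<close> apart because one factor may raise the
      stack by that much; this makes the upward passages \<open>a j\<close> at different levels
      different positions.\<close>
    define l where "l j = h - 1 - 2 * r * j" for j
    have l: "l j \<ge> m + 3 * r" "l j < h" if "j \<le> K" for j
    proof -
      have "2 * r * j \<le> 2 * r * K" using that by simp
      then show "l j \<ge> m + 3 * r" "l j < h" using hH H unfolding l_def by linarith+
    qed
    define a where "a j = Max {i. i \<le> s \<and> height i \<le> l j}" for j
    define b where "b j = Min {i. s \<le> i \<and> i \<le> T \<and> height i \<le> l j}" for j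
    have a: "a j < s" "height (a j) \<le> l j" "a j < i \<Longrightarrow> i \<le> s \<Longrightarrow> height i > l j" if "j \<le> K" for i j
    proof -
      have fin: "finite {i. i \<le> s \<and> height i \<le> l j}" by simp
      have "a j \<in> {i. i \<le> s \<and> height i \<le> l j}" unfolding a_def
        by (rule Max_in[OF fin]) (use height_0 in auto)
      then show "a j < s" "height (a j) \<le> l j"
        using s(2) l(2)[OF that] by (auto simp: order_less_le)
      show "height i > l j" if i: "a j < i" "i \<le> s"
      proof (rule ccontr)
        assume "\<not> height i > l j"
        then have "i \<le> a j" unfolding a_def using i by (intro Max_ge[OF fin]) auto
        with i show False by simp
      qed
    qed
    have b: "s < b j" "b j \<le> T" "height (b j) \<le> l j" "s \<le> i \<Longrightarrow> i < b j \<Longrightarrow> height i > l j" if "j \<le> K" for i j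
    proof -
      have fin: "finite {i. s \<le> i \<and> i \<le> T \<and> height i \<le> l j}" by simp
      \<comment> \<open>The final height is at most \<open>m\<close>, below all levels, so each
        level is passed on the way down.\<close>
      have "T \<in> {i. s \<le> i \<and> i \<le> T \<and> height i \<le> l j}"
        using s(1) height_last l(1)[OF that] by (simp add: T_def)
      then have "b j \<in> {i. s \<le> i \<and> i \<le> T \<and> height i \<le> l j}" unfolding b_def by (intro Min_in[OF fin]) auto
      then show bj: "s < b j" "b j \<le> T" "height (b j) \<le> l j"
        using s(2) l(2)[OF that] by (auto simp: order_less_le)
      show "height i > l j" if i: "s \<le> i" "i < b j"
      proof (rule ccontr)
        assume "\<not> height i > l j"
        then have "b j \<le> i" unfolding b_def using i bj(2) by (intro Min_le[OF fin]) auto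
        with i show False by simp
      qed
    qed
    have a_high: "height (a j) > l j - 2 * r" if "j \<le> K" for j
    proof -
      have "height (Suc (a j)) > l j" using a[OF that] by simp
      then show ?thesis using height_Suc[of "a j"] a(1)[OF that] s(1) l(1)[OF that] by (simp add: T_def)
    qed
    have "\<exists>z. length z = l j - 3 * r \<and> (\<forall>i. a j \<le> i \<longrightarrow> i \<le> b j \<longrightarrow> (\<exists>u. snd (stack_at i) = u @ z))"
      if "j \<le> K" for j
    proof (rule common_bottom)
      show "height i > l j" if "a j < i" "i < b j" for i
        using that a(3)[OF \<open>j \<le> K\<close>, of i] b(4)[OF \<open>j \<le> K\<close>, of i] by (cases "i \<le> s") auto
    qed (use a[OF that] b[OF that] a_high[OF that] l[OF that] in \<open>auto simp: T_def\<close>)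
    then obtain z where z: "\<And>j. j \<le> K \<Longrightarrow> length (z j) = l j - 3 * r"
      "\<And>j i. j \<le> K \<Longrightarrow> a j \<le> i \<Longrightarrow> i \<le> b j \<Longrightarrow> \<exists>u. snd (stack_at i) = u @ z j" by metis
    have ab: "a j \<le> b j" if "j \<le> K" for j using a(1)[OF that] b(1)[OF that] by simp
    have "\<forall>j. \<exists>u. j \<le> K \<longrightarrow> snd (stack_at (a j)) = u @ z j" using z(2) ab by blast
    then obtain x where x: "\<And>j. j \<le> K \<Longrightarrow> snd (stack_at (a j)) = x j @ z j" by metis
    have "\<forall>j. \<exists>u. j \<le> K \<longrightarrow> snd (stack_at (b j)) = u @ z j" using z(2) ab by blast
    then obtain y where y: "\<And>j. j \<le> K \<Longrightarrow> snd (stack_at (b j)) = y j @ z j" by metis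
    have len: "length (x j) \<le> 3 * r" "length (y j) \<le> 3 * r" if "j \<le> K" for j
      using x[OF that] y[OF that] z(1)[OF that] a(2)[OF that] b(3)[OF that] l(1)[OF that]
      by (auto simp: height_def)
    define S where "S = stacks_upto (3 * r)"
    \<comment> \<open>The profile of level \<open>j\<close>: sign and letters above the common
      bottom at both passages. There are \<open>K + 1\<close> levels and at most \<open>K\<close>
      profiles.\<close>
    define g where "g j = ((fst (stack_at (a j)), x j), (fst (stack_at (b j)), y j))" for j
    have "g ` {..K} \<subseteq> S \<times> S" using len by (auto simp: g_def S_def stacks_upto_def)
    then have "card (g ` {..K}) \<le> card (S \<times> S)"
      using card_stacks_upto[of "3 * r"] by (intro card_mono) (auto simp: S_def)
    also have "\<dots> = card S * card S" by (rule card_cartesian_product)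
    also have "\<dots> \<le> K" unfolding K_def S_def power2_eq_square
      using card_stacks_upto[of "3 * r"] by (intro mult_le_mono) auto
    finally have "\<not> inj_on g {..K}" by (intro pigeonhole) simp
    then obtain j k where jk: "j < k" "k \<le> K" "g j = g k"
      unfolding inj_on_def by (metis atMost_iff linorder_neqE_nat)
    then have j: "j \<le> K" by simp
    \<comment> \<open>The common bottom cancels on the left, so the product of the passage depends
      on the profile alone.\<close>
    have seg: "mul4 (stack_val (fst (stack_at (a i)), x i)) (prod4 (segment (a i) (b i))) =
        stack_val (fst (stack_at (b i)), y i)" if "i \<le> K" for i
    proof -
      have "stack_val (stack_at (b i)) = mul4 (stack_val (stack_at (a i))) (prod4 (segment (a i) (b i)))"
        using ab[OF that] b(2)[OF that] by (intro segment_val) (auto simp: T_def)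
      moreover have "stack_at (a i) = (fst (stack_at (a i)), x i @ z i)"
        "stack_at (b i) = (fst (stack_at (b i)), y i @ z i)" using x y that by (simp_all add: prod_eq_iff)
      ultimately have "mul4 (word_val (z i)) (stack_val (fst (stack_at (b i)), y i)) =
          mul4 (word_val (z i)) (mul4 (stack_val (fst (stack_at (a i)), x i)) (prod4 (segment (a i) (b i))))"
        by (metis mul4_assoc stack_val_append)
      then show ?thesis using mul4_cancel[OF det4_word] by metis
    qed
    have segs: "prod4 (segment (a k) (b k)) = prod4 (segment (a j) (b j))"
    proof (rule mul4_cancel[OF det4_stack[of "(fst (stack_at (a j)), x j)"]])
      have "fst (stack_at (a k)) = fst (stack_at (a j))" "x k = x j"
        "fst (stack_at (b k)) = fst (stack_at (b j))" "y k = y j"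
        using jk(3) by (simp_all only: g_def prod.inject)
      then show "mul4 (stack_val (fst (stack_at (a j)), x j)) (prod4 (segment (a k) (b k))) =
          mul4 (stack_val (fst (stack_at (a j)), x j)) (prod4 (segment (a j) (b j)))"
        using seg[OF jk(2)] seg[OF j] by (simp only:)
    qed
    have ljk: "l k + 2 * r \<le> l j"
    proof -
      have "2 * r * Suc j \<le> 2 * r * k" using jk(1) by (intro mult_le_mono2) simp
      moreover have "2 * r * k \<le> 2 * r * K" using jk(2) by simp
      moreover have "2 * r * Suc j = 2 * r + 2 * r * j" by simp
      ultimately show ?thesis using hH H unfolding l_def by linarith
    qed
    have akj: "a k < a j"
    proof (rule ccontr)
      assume "\<not> a k < a j"
      then have "a k = a j \<or> a j < a k" by auto
      then show False using a(2)[OF jk(2)] a(1)[OF jk(2)] a(3)[OF j, of "a k"] a_high[OF j] ljk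
        by auto
    qed
    have bjk: "b j \<le> b k"
    proof (rule ccontr)
      assume "\<not> b j \<le> b k"
      then show False using b(4)[OF j, of "b k"] b(1)[OF jk(2)] b(3)[OF jk(2)] ljk by simp
    qed
    have "shortened As N"
    proof (cases "b k - a k \<le> N")
      case True
      with akj bjk ab[OF j] segs b(2)[OF jk(2)] show ?thesis
        by (intro splice[of "a k" "a j" "b j" "b k" N]) (auto simp: T_def)
    next
      \<comment> \<open>A longer outer passage contains a repetition of its own: above
        \<open>z k\<close> the stack never has more than
        \<open>h - length (z k) = 2 * r * k + 3 * r + 1 \<le> H\<close> letters.\<close>
      case False
      show ?thesis
      proof (rule repetition_window[OF _ N, of "a k" "z k"])
        show "a k + N \<le> length As" using False b(2)[OF jk(2)] by (simp add: T_def)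
        fix i assume i: "a k \<le> i" "i \<le> a k + N"
        then have ib: "i \<le> b k" using False by simp
        obtain u where u: "snd (stack_at i) = u @ z k" using z(2)[OF jk(2) i(1) ib] by blast
        have "2 * r * k \<le> 2 * r * K" using jk(2) by simp
        moreover have "length u + length (z k) \<le> h"
          using h_ge[of i] ib b(2)[OF jk(2)] u by (simp add: height_def)
        ultimately have "length u \<le> H" using z(1)[OF jk(2)] H hH unfolding l_def by linarith
        with u show "\<exists>u. snd (stack_at i) = u @ z k \<and> length u \<le> H" by blast
      qed
    qed
    then show ?thesis by (simp add: N_def)
  qed
qed

end

text \<open>A factor of size at most \<open>X\<close> is a word of at most \<open>4 * X\<close>
  letters, with \<open>+ 1\<close> ensuring \<open>r \<ge> 1\<close>, and the final stack has height
  at most \<open>2 * X\<close>. The factor 2 is explained in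
  \<open>two_short_factorizations\<close>.\<close>

definition factorization_bound :: "nat \<Rightarrow> nat" where
  "factorization_bound X = 2 * pump_length (2 * X) (4 * X + 1)"

lemma shorten_factorization:
  assumes "\<And>A. A \<in> set As \<Longrightarrow> det4 A = 1 \<and> size4 A \<le> X" "size4 (prod4 As) \<le> X"
    and "length As > pump_length (2 * X) (4 * X + 1)"
  shows "\<exists>Bs. set Bs \<subseteq> set As \<and> prod4 Bs = prod4 As \<and> length Bs < length As \<and>
     length As \<le> length Bs + pump_length (2 * X) (4 * X + 1)"
proof -
  obtain wd where wd: "\<And>A. det4 A = 1 \<Longrightarrow> length (wd A) \<le> 4 * size4 A \<and> prod4 (map gen_val (wd A)) = A"
    using generated_by_two by metis
  have "prod4 (map gen_val (wd A)) = A \<and> length (wd A) \<le> 4 * X + 1" if "A \<in> set As" for A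
    using wd[of A] assms(1)[OF that] by auto
  from pumping[of As, OF this, of "2 * X"] assms(2,3)
  show ?thesis by (simp add: shortened_def)
qed

text \<open>Let \<open>N\<close> be the pumping length. If one of the factorizations is longer than
  \<open>2 * N\<close>, shortening it by at most \<open>N\<close> factors at a time must stop at
  some length in the window from \<open>N + 1\<close> to \<open>2 * N\<close>. One further
  shortening gives a second short factorization, different because its length is.\<close>

theorem two_short_factorizations:
  assumes G: "\<And>A. A \<in> G \<Longrightarrow> det4 A = 1 \<and> size4 A \<le> X" and M: "size4 M \<le> X"
    and As: "As \<noteq> []" "set As \<subseteq> G" "prod4 As = M"
    and Bs: "Bs \<noteq> []" "set Bs \<subseteq> G" "prod4 Bs = M" and ne: "As \<noteq> Bs"
  shows "\<exists>As Bs. As \<noteq> [] \<and> set As \<subseteq> G \<and> prod4 As = M \<and> length As \<le> factorization_bound X \<and>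
     Bs \<noteq> [] \<and> set Bs \<subseteq> G \<and> prod4 Bs = M \<and> length Bs \<le> factorization_bound X \<and> As \<noteq> Bs"
proof -
  define N where "N = pump_length (2 * X) (4 * X + 1)"
  have B: "factorization_bound X = 2 * N" by (simp add: factorization_bound_def N_def)
  have short: "\<exists>Ys. set Ys \<subseteq> G \<and> prod4 Ys = M \<and> length Ys < length Xs \<and> length Xs \<le> length Ys + N"
    if "set Xs \<subseteq> G" "prod4 Xs = M" "length Xs > N" for Xs
    using shorten_factorization[of Xs X] G M that unfolding N_def by blast
  have mid: "\<exists>Ys. set Ys \<subseteq> G \<and> prod4 Ys = M \<and> N < length Ys \<and> length Ys \<le> 2 * N"
    if "set Xs \<subseteq> G" "prod4 Xs = M" "length Xs > 2 * N" for Xs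
    using that
  proof (induction "length Xs" arbitrary: Xs rule: less_induct)
    case less
    obtain Ys where Ys: "set Ys \<subseteq> G" "prod4 Ys = M" "length Ys < length Xs" "length Xs \<le> length Ys + N"
      using short[of Xs] less.prems by auto
    then show ?case using less.hyps[of Ys] less.prems by (cases "length Ys > 2 * N") force+
  qed
  show ?thesis
  proof (cases "length As \<le> 2 * N \<and> length Bs \<le> 2 * N")
    case True
    then show ?thesis using As Bs ne unfolding B by blast
  next
    case False
    then obtain Ys where Ys: "set Ys \<subseteq> G" "prod4 Ys = M" "N < length Ys" "length Ys \<le> 2 * N"
      using mid[of As] mid[of Bs] As Bs by auto
    \<comment> \<open>More than \<open>N\<close> factors minus at most \<open>N\<close> leaves at
      least one, so \<open>Zs\<close> is nonempty.\<close>
    obtain Zs where "set Zs \<subseteq> G" "prod4 Zs = M" "length Zs < length Ys" "length Ys \<le> length Zs + N"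
      using short[of Ys] Ys by auto
    with Ys show ?thesis unfolding B
      by (intro exI[of _ Ys] exI[of _ Zs]) auto
  qed
qed

section \<open>Decidability\<close>

definition to4 :: "mat2 \<Rightarrow> m4" where
  "to4 A = (A $ 1 $ 1, A $ 1 $ 2, A $ 2 $ 1, A $ 2 $ 2)"

definition of4 :: "m4 \<Rightarrow> mat2" where
  "of4 A = vector [vector [fst A, fst (snd A)], vector [fst (snd (snd A)), snd (snd (snd A))]]"

lemma of4_to4 [simp]: "of4 (to4 A) = A"
  by (simp add: of4_def to4_def vec_eq_iff forall_2)

lemma to4_of4 [simp]: "to4 (of4 A) = A"
  by (cases A) (simp add: of4_def to4_def)

lemma to4_inject [simp]: "to4 A = to4 B \<longleftrightarrow> A = B"
  by (metis of4_to4)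

lemma to4_mult: "to4 (A ** B) = mul4 (to4 A) (to4 B)"
  by (simp add: to4_def matrix_matrix_mult_def sum_2)

lemma to4_one: "to4 (mat 1) = one4"
  by (simp add: to4_def mat_def one4_def)

lemma det4_to4: "det4 (to4 A) = det A"
  by (simp add: to4_def det_2)

lemma to4_prod: "to4 (mat_prod As) = prod4 (map to4 As)"
  by (induction As) (simp_all add: mat_prod_def to4_mult to4_one)

text \<open>This and the following functions recompute the binary encodings in a form to which
  \<open>pr\<close> applies, with symbols for bits. Halving \<open>n\<close> times is more than
  enough, and a state with first component 0 is final.\<close>

definition nat_code :: "nat \<Rightarrow> nat list" where
  "nat_code n = rev (snd (rec_nat (n, []) (\<lambda>i s. if fst s = 0 then s
     else (fst s div 2, (if odd (fst s) then 2 else 1) # snd s)) n))"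

definition int_code :: "int \<Rightarrow> nat list" where
  "int_code k = (if k < 0 then 2 else 1) # concat (map (\<lambda>b. [2, b]) (nat_code (nat \<bar>k\<bar>))) @ [1]"

definition mat_code :: "m4 \<Rightarrow> nat list" where
  "mat_code A = int_code (fst A) @ int_code (fst (snd A)) @ int_code (fst (snd (snd A))) @
     int_code (snd (snd (snd A)))"

definition instance_code :: "m4 list \<times> m4 \<Rightarrow> nat list" where
  "instance_code p = concat (map (\<lambda>G. 2 # mat_code G) (fst p)) @ [1] @ mat_code (snd p)"

lemma nat_code: "nat_code n = map bit_symbol (nat_bits n)"
proof -
  define st where "st s = (if fst s = 0 then s
     else (fst s div 2, (if odd (fst s) then 2 else 1) # snd s))" for s :: "nat \<times> nat list"
  have "rec_nat c (\<lambda>i. st) k = (st ^^ k) c" for c k by (induction k) simp_all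
  moreover have "(st ^^ k) (m, w) = (0, rev (map bit_symbol (nat_bits m)) @ w)" if "m \<le> k" for k m w
    using that
  proof (induction k arbitrary: m w)
    case 0
    then show ?case by (simp add: nat_bits.simps)
  next
    case (Suc k)
    have eq: "(st ^^ Suc k) (m, w) = (st ^^ k) (st (m, w))" by (simp add: funpow_swap1)
    show ?case
    proof (cases "m = 0")
      case True
      then have "st (m, w) = (0, w)" by (simp add: st_def)
      then show ?thesis unfolding eq using Suc.IH[of 0 w] True by simp
    next
      case False
      then have st: "st (m, w) = (m div 2, bit_symbol (odd m) # w)" by (simp add: st_def bit_symbol_def)
      have "m div 2 \<le> k" using Suc.prems False by simp
      from Suc.IH[OF this] show ?thesis unfolding eq st using False by (simp add: nat_bits.simps[of m])
    qed
  qed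
  ultimately have "rec_nat (n, []) (\<lambda>i. st) n = (0, rev (map bit_symbol (nat_bits n)))" by simp
  then show ?thesis by (simp add: nat_code_def st_def[abs_def])
qed

lemma int_code: "int_code k = map bit_symbol (enc_int k)"
  by (simp add: int_code_def enc_int_def enc_list_def nat_code map_concat comp_def) (simp add: bit_symbol_def)

lemma mat_code: "mat_code (to4 A) = map bit_symbol (enc_mat A)"
  by (simp add: mat_code_def enc_mat_def to4_def int_code)

lemma instance_code: "instance_code (map to4 Gs, to4 A) = symbols_of (enc_instance Gs A)"
  by (simp add: instance_code_def enc_instance_def enc_list_def symbols_of_def map_concat comp_def mat_code)
    (simp add: bit_symbol_def)

lemma instance_code_inject:
  assumes "instance_code (Hs, B) = symbols_of (enc_instance Gs A)"
  shows "Hs = map to4 Gs \<and> B = to4 A"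
proof -
  have "inj bit_symbol" by (auto simp: inj_def bit_symbol_def)
  moreover have "instance_code (Hs, B) = symbols_of (enc_instance (map of4 Hs) (of4 B))"
    using instance_code[of "map of4 Hs" "of4 B"] by (simp add: comp_def)
  ultimately have "enc_instance (map of4 Hs) (of4 B) = enc_instance Gs A"
    using assms by (simp add: symbols_of_def inj_map_eq_map)
  then have "enc_list enc_mat (map of4 Hs) @ enc_mat (of4 B) = enc_list enc_mat Gs @ enc_mat A"
    by (simp add: enc_instance_def)
  from enc_list_prefix_free[OF enc_mat_prefix_free this]
  have "map of4 Hs = Gs" "enc_mat (of4 B) = enc_mat A" by auto
  moreover from this have "of4 B = A" using enc_mat_prefix_free[of "of4 B" "[]" A "[]"] by simp
  ultimately have "Gs = map of4 Hs" "A = of4 B" by simp_all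
  then show ?thesis by (simp add: comp_def)
qed

text \<open>Words with equal products give separate entries, so counting the entries equal to
  \<open>A\<close> counts factorizations.\<close>

definition products :: "m4 list \<Rightarrow> nat \<Rightarrow> m4 list" where
  "products Gs n = rec_nat [one4] (\<lambda>i ps. concat (map (\<lambda>P. map (\<lambda>g. mul4 g P) Gs) ps)) n"

definition occurrences :: "m4 \<Rightarrow> m4 list \<Rightarrow> nat" where
  "occurrences A ps = foldl (\<lambda>a P. if P = A then Suc a else a) 0 ps"

definition short_factorizations :: "m4 list \<Rightarrow> m4 \<Rightarrow> nat \<Rightarrow> nat" where
  "short_factorizations Gs A N = rec_nat 0 (\<lambda>i a. a + occurrences A (products Gs (Suc i))) N"

text \<open>The second argument is a guess of the instance; it is verified by encoding it and
  comparing with the input, and a wrong guess leaves the question undecided. The sum of all sizes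
  serves as the common bound \<open>X\<close>.\<close>

definition decision :: "nat list \<times> nat \<Rightarrow> nat" where
  "decision p = (if instance_code (inv enc (snd p)) = fst p then
     (if short_factorizations (fst (inv enc (snd p) :: m4 list \<times> m4)) (snd (inv enc (snd p) :: m4 list \<times> m4))
        (factorization_bound (sum_list (map size4 (snd (inv enc (snd p) :: m4 list \<times> m4) #
           fst (inv enc (snd p) :: m4 list \<times> m4))))) \<le> 1
      then 2 else 1) else 0)"

section \<open>Correctness of the count of short factorizations\<close>

lemma products: "products Gs n = map prod4 (List.n_lists n Gs)"
proof (induction n)
  case (Suc n)
  then show ?case by (simp add: products_def map_concat comp_def)
qed (simp add: products_def)

lemma occurrences: "occurrences A ps = length (filter (\<lambda>P. P = A) ps)"
proof -
  have "foldl (\<lambda>a P. if P = A then Suc a else a) n ps = n + length (filter (\<lambda>P. P = A) ps)" for n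
    by (induction ps arbitrary: n) simp_all
  then show ?thesis by (simp add: occurrences_def)
qed

definition lists_upto :: "m4 list \<Rightarrow> nat \<Rightarrow> m4 list list" where
  "lists_upto Gs N = concat (map (\<lambda>i. List.n_lists (Suc i) Gs) [0..<N])"

lemma short_factorizations:
  "short_factorizations Gs A N = length (filter (\<lambda>As. prod4 As = A) (lists_upto Gs N))"
  by (induction N) (simp_all add: short_factorizations_def lists_upto_def occurrences products filter_map comp_def
      del: n_lists.simps)

lemma set_lists_upto: "set (lists_upto Gs N) = {As. As \<noteq> [] \<and> length As \<le> N \<and> set As \<subseteq> set Gs}"
proof -
  have *: "As \<noteq> [] \<and> length As \<le> N \<longleftrightarrow> (\<exists>i\<in>{0..<N}. length As = Suc i)" for As :: "m4 list"
    by (cases As) (auto simp: Suc_le_eq)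
  have "set (lists_upto Gs N) = {As. (\<exists>i\<in>{0..<N}. length As = Suc i) \<and> set As \<subseteq> set Gs}"
    unfolding lists_upto_def set_concat set_map set_upt image_image set_n_lists by blast
  then show ?thesis by (simp only: *[symmetric] conj_assoc)
qed

lemma distinct_lists_upto: "distinct Gs \<Longrightarrow> distinct (lists_upto Gs N)"
proof (induction N)
  case (Suc N)
  have "set (lists_upto Gs N) \<inter> set (List.n_lists (Suc N) Gs) = {}"
    unfolding set_lists_upto set_n_lists by auto
  moreover have "lists_upto Gs (Suc N) = lists_upto Gs N @ List.n_lists (Suc N) Gs"
    by (simp add: lists_upto_def del: n_lists.simps)
  ultimately show ?case using Suc distinct_n_lists[OF Suc.prems, of "Suc N"] by simp
qed (simp add: lists_upto_def)

lemma two_le_length_distinct: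
  assumes "distinct xs"
  shows "2 \<le> length xs \<longleftrightarrow> (\<exists>x\<in>set xs. \<exists>y\<in>set xs. x \<noteq> y)"
proof
  assume "2 \<le> length xs"
  then obtain x y zs where "xs = x # y # zs" by (cases xs; cases "tl xs") auto
  with assms show "\<exists>x\<in>set xs. \<exists>y\<in>set xs. x \<noteq> y" by auto
next
  assume "\<exists>x\<in>set xs. \<exists>y\<in>set xs. x \<noteq> y"
  then obtain x y where "{x, y} \<subseteq> set xs" "x \<noteq> y" by auto
  then have "card {x, y} \<le> card (set xs)" by (intro card_mono) auto
  then show "2 \<le> length xs" using \<open>x \<noteq> y\<close> assms by (simp add: distinct_card)
qed

section \<open>The decision function is primitive recursive\<close>

lemma pr_mul4 [pr_intros]: "pr f \<Longrightarrow> pr g \<Longrightarrow> pr (\<lambda>x. mul4 (f x) (g x))"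
proof -
  have eq: "mul4 A B = (fst A * fst B + fst (snd A) * fst (snd (snd B)),
     fst A * fst (snd B) + fst (snd A) * snd (snd (snd B)),
     fst (snd (snd A)) * fst B + snd (snd (snd A)) * fst (snd (snd B)),
     fst (snd (snd A)) * fst (snd B) + snd (snd (snd A)) * snd (snd (snd B)))" for A B
    by (cases A; cases B) simp
  show "pr f \<Longrightarrow> pr g \<Longrightarrow> ?thesis" unfolding eq by (intro pr_intros)
qed

lemma pr_size4 [pr_intros]: "pr f \<Longrightarrow> pr (\<lambda>x. size4 (f x))"
proof -
  have eq: "size4 A = nat \<bar>fst A\<bar> + nat \<bar>fst (snd A)\<bar> + nat \<bar>fst (snd (snd A))\<bar> + nat \<bar>snd (snd (snd A))\<bar>"
    for A by (cases A) simp
  show "pr f \<Longrightarrow> ?thesis" unfolding eq by (intro pr_intros)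
qed

lemma pr_nat_code [pr_intros]: "pr f \<Longrightarrow> pr (\<lambda>x. nat_code (f x))"
  unfolding nat_code_def by (intro pr_intros)

lemma pr_int_code [pr_intros]: "pr f \<Longrightarrow> pr (\<lambda>x. int_code (f x))"
  unfolding int_code_def by (intro pr_intros)

lemma pr_mat_code [pr_intros]: "pr f \<Longrightarrow> pr (\<lambda>x. mat_code (f x))"
  unfolding mat_code_def by (intro pr_intros)

lemma pr_instance_code [pr_intros]: "pr f \<Longrightarrow> pr (\<lambda>x. instance_code (f x))"
  unfolding instance_code_def by (intro pr_intros)

lemma pr_products [pr_intros]: "pr f \<Longrightarrow> pr g \<Longrightarrow> pr (\<lambda>x. products (f x) (g x))"
  unfolding products_def by (intro pr_intros pr_comp[of f "\<lambda>p. fst (fst p)"])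

lemma pr_occurrences [pr_intros]: "pr f \<Longrightarrow> pr g \<Longrightarrow> pr (\<lambda>x. occurrences (f x) (g x))"
  unfolding occurrences_def by (intro pr_intros pr_comp[of f "\<lambda>p. fst p"])

lemma pr_short_factorizations [pr_intros]:
  "pr f \<Longrightarrow> pr g \<Longrightarrow> pr h \<Longrightarrow> pr (\<lambda>x. short_factorizations (f x) (g x) (h x))"
  unfolding short_factorizations_def
  by (intro pr_intros pr_comp[of f "\<lambda>p. fst p"] pr_comp[of g "\<lambda>p. fst p"])

lemma pr_factorization_bound [pr_intros]: "pr f \<Longrightarrow> pr (\<lambda>x. factorization_bound (f x))"
  unfolding factorization_bound_def pump_length_def pump_depth_def by (intro pr_intros)

lemma pr_decision: "pr decision"
  unfolding decision_def[abs_def] by (intro pr_intros)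

lemma decision_correct:
  assumes "distinct Gs" "set Gs \<subseteq> SL2Z"
  shows "decision (symbols_of (enc_instance Gs A), m) \<in>
    {0, if multiple_factorizations (set Gs) A then 1 else 2}"
    and "\<exists>m. decision (symbols_of (enc_instance Gs A), m) \<noteq> 0"
proof -
  define p where "p = (map to4 Gs, to4 A)"
  define X where "X = sum_list (map size4 (to4 A # map to4 Gs))"
  let ?N = "factorization_bound X"
  let ?L = "filter (\<lambda>As. prod4 As = to4 A) (lists_upto (map to4 Gs) ?N)"
  have inj: "inj to4" by (simp add: inj_def)
  have "distinct ?L"
    using assms(1) inj by (intro distinct_filter distinct_lists_upto) (simp add: distinct_map inj_on_def)
  then have two: "2 \<le> short_factorizations (map to4 Gs) (to4 A) ?N \<longleftrightarrow> (\<exists>As\<in>set ?L. \<exists>Bs\<in>set ?L. As \<noteq> Bs)"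
    unfolding short_factorizations by (rule two_le_length_distinct)
  have det: "det4 B = 1 \<and> size4 B \<le> X" if "B \<in> to4 ` set Gs" for B
  proof
    show "det4 B = 1" using that assms(2) by (auto simp: det4_to4 SL2Z_def)
    have "size4 B \<in> set (map size4 (to4 A # map to4 Gs))" using that by auto
    then show "size4 B \<le> X" unfolding X_def by (rule member_le_sum_list) simp
  qed
  have A: "size4 (to4 A) \<le> X" by (simp add: X_def)
  have fac: "As \<in> factorizations (set Gs) A \<longleftrightarrow>
      map to4 As \<noteq> [] \<and> set (map to4 As) \<subseteq> to4 ` set Gs \<and> prod4 (map to4 As) = to4 A" for As
    using inj by (auto simp: factorizations_def to4_prod[symmetric] inj_image_subset_iff)
  have "multiple_factorizations (set Gs) A \<longleftrightarrow> (\<exists>As\<in>set ?L. \<exists>Bs\<in>set ?L. As \<noteq> Bs)"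
  proof
    assume "multiple_factorizations (set Gs) A"
    then obtain As Bs where "As \<in> factorizations (set Gs) A" "Bs \<in> factorizations (set Gs) A" "As \<noteq> Bs"
      by (auto simp: multiple_factorizations_def)
    then have "map to4 As \<noteq> map to4 Bs" using inj by (simp add: inj_map_eq_map)
    with two_short_factorizations[of "to4 ` set Gs" X "to4 A" "map to4 As" "map to4 Bs"] det A
      \<open>As \<in> _\<close> \<open>Bs \<in> _\<close>
    show "\<exists>As\<in>set ?L. \<exists>Bs\<in>set ?L. As \<noteq> Bs" unfolding fac
      by (simp only: set_filter set_lists_upto set_map mem_Collect_eq Bex_def) meson
  next
    assume "\<exists>As\<in>set ?L. \<exists>Bs\<in>set ?L. As \<noteq> Bs"
    then obtain As Bs where AB: "As \<in> set ?L" "Bs \<in> set ?L" "As \<noteq> Bs" by blast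
    have "map of4 Cs \<in> factorizations (set Gs) A" if "Cs \<in> set ?L" for Cs
      using that unfolding fac by (auto simp: set_lists_upto comp_def)
    moreover have "map of4 As \<noteq> map of4 Bs"
    proof
      assume "map of4 As = map of4 Bs"
      then have "map to4 (map of4 As) = map to4 (map of4 Bs)" by (simp only:)
      with AB show False by (simp add: comp_def)
    qed
    ultimately show "multiple_factorizations (set Gs) A"
      using AB unfolding multiple_factorizations_def by blast
  qed
  with two have *: "short_factorizations (map to4 Gs) (to4 A) ?N \<le> 1 \<longleftrightarrow> \<not> multiple_factorizations (set Gs) A"
    by linarith
  show "decision (symbols_of (enc_instance Gs A), m) \<in> {0, if multiple_factorizations (set Gs) A then 1 else 2}"
  proof (cases "instance_code (inv enc m) = symbols_of (enc_instance Gs A)")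
    case True
    obtain Hs :: "m4 list" and B :: m4 where HB: "inv enc m = (Hs, B)" by (rule prod.exhaust)
    with True have "inv enc m = p" using instance_code_inject[of Hs B Gs A] by (simp add: p_def)
    then show ?thesis using * by (simp add: decision_def p_def X_def)
  qed (simp add: decision_def)
  show "\<exists>m. decision (symbols_of (enc_instance Gs A), m) \<noteq> 0"
    using instance_code[of Gs A] by (intro exI[of _ "enc p"]) (simp add: decision_def p_def)
qed

theorem decidable_multiple_factorization: "decidable multiple_factorization_problem"
  unfolding multiple_factorization_problem_def
proof (rule decidable_search[OF pr_decision])
  fix x assume "x \<in> {w. \<exists>G A. finite G \<and> G \<subseteq> SL2Z \<and> A \<in> generated_semigroup G \<and> encodes w G A \<and>
    multiple_factorizations G A}"
  then obtain Gs A where *: "distinct Gs" "set Gs \<subseteq> SL2Z"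
    "x = enc_instance Gs A" "multiple_factorizations (set Gs) A" by (auto simp: encodes_def)
  have "decision (symbols_of x, m) \<in> {0, 1}" for m using decision_correct(1)[OF *(1,2), of A m] *(3,4) by simp
  then have "decision (symbols_of x, m) \<noteq> 2" for m
    by (metis insertE singletonD zero_neq_numeral numeral_One num.distinct(1) numeral_eq_iff)
  then show "(\<exists>m. decision (symbols_of x, m) \<noteq> 0) \<and> (\<forall>m. decision (symbols_of x, m) \<noteq> 2)"
    using decision_correct(2)[OF *(1,2)] *(3) by simp
next
  fix x assume "x \<in> {w. \<exists>G A. finite G \<and> G \<subseteq> SL2Z \<and> A \<in> generated_semigroup G \<and> encodes w G A \<and>
    \<not> multiple_factorizations G A}"
  then obtain Gs A where *: "distinct Gs" "set Gs \<subseteq> SL2Z"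
    "x = enc_instance Gs A" "\<not> multiple_factorizations (set Gs) A" by (auto simp: encodes_def)
  have "decision (symbols_of x, m) \<in> {0, 2}" for m using decision_correct(1)[OF *(1,2), of A m] *(3,4) by simp
  then show "(\<exists>m. decision (symbols_of x, m) \<noteq> 0) \<and> (\<forall>m. decision (symbols_of x, m) \<in> {0, 2})"
    using decision_correct(2)[OF *(1,2)] *(3) by simp
qed

section \<open>From bounded tilings to unbounded knapsack\<close>

fun bits_val :: "bool list \<Rightarrow> nat" where
  "bits_val [] = 0"
| "bits_val (b # bs) = of_bool b + 2 * bits_val bs"

lemma bits_val_pos: "bs \<noteq> [] \<Longrightarrow> last bs \<Longrightarrow> bits_val bs > 0"
  by (induction bs) (auto split: if_splits)

lemma nat_bits_val: "bs = [] \<or> last bs \<Longrightarrow> nat_bits (bits_val bs) = bs"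
proof (induction bs)
  case (Cons b bs)
  have "bits_val (b # bs) > 0" using Cons.prems by (intro bits_val_pos) auto
  moreover have "bs = [] \<or> last bs" using Cons.prems by (auto split: if_splits)
  ultimately show ?case using Cons.IH by (subst nat_bits.simps) (cases b; simp)
qed (simp add: nat_bits.simps)

lemma bits_val_zeros: "bits_val (replicate m False @ bs) = 2 ^ m * bits_val bs"
  by (induction m) simp_all

text \<open>The number with base \<open>B\<close> digits \<open>g k\<close>, least significant
  first, and with \<open>a\<close> on top of them. The digits may exceed the base, so sums can be
  formed digit by digit before carries are excluded.\<close>

definition horner :: "nat \<Rightarrow> ('k \<Rightarrow> nat) \<Rightarrow> 'k list \<Rightarrow> nat \<Rightarrow> nat" where
  "horner B g ks a = foldr (\<lambda>k r. g k + B * r) ks a"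

lemma horner_simps [simp]: "horner B g [] a = a" "horner B g (k # ks) a = g k + B * horner B g ks a"
  by (simp_all add: horner_def)

text \<open>In base \<open>2 ^ Suc m\<close>, a digit 0 or 1 is one bit followed by \<open>m\<close>
  zeros, so such numbers can be written down without arithmetic.\<close>

lemma bits_val_digits:
  "bits_val (concat (map (\<lambda>k. d k # replicate m False) ks) @ bs) =
    horner (2 ^ Suc m) (\<lambda>k. of_bool (d k)) ks (bits_val bs)"
  by (induction ks) (simp_all add: bits_val_zeros)

lemma horner_add: "horner B g ks a + horner B h ks b = horner B (\<lambda>k. g k + h k) ks (a + b)"
proof (induction ks)
  case (Cons k ks)
  then show ?case by (simp flip: Cons.IH add: distrib_left)
qed simp

lemma horner_cong: "\<forall>k\<in>set ks. g k = h k \<Longrightarrow> horner B g ks a = horner B h ks a"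
  by (induction ks) simp_all

lemma horner_zero: "horner B (\<lambda>k. 0) ks 0 = 0"
  by (induction ks) simp_all

lemma horner_sum_list:
  "sum_list (map (\<lambda>i. horner B (g i) ks (a i)) is) =
    horner B (\<lambda>k. sum_list (map (\<lambda>i. g i k) is)) ks (sum_list (map a is))"
  by (induction "is") (simp_all add: horner_zero horner_add)

lemma horner_pos: "a > 0 \<Longrightarrow> B > 0 \<Longrightarrow> horner B g ks a > 0"
  by (induction ks) simp_all

lemma horner_lower: "a * B ^ length ks \<le> horner B g ks a"
proof (induction ks)
  case (Cons k ks)
  then have "B * (a * B ^ length ks) \<le> B * horner B g ks a" by (rule mult_le_mono2)
  then show ?case unfolding horner_simps by (simp add: mult.left_commute trans_le_add2 del: mult_le_cancel1)
qed simp

lemma horner_upper: "\<forall>k\<in>set ks. g k < B \<Longrightarrow> horner B g ks a < Suc a * B ^ length ks"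
proof (induction ks)
  case (Cons k ks)
  then have "Suc (horner B g ks a) \<le> Suc a * B ^ length ks" by (simp del: mult_Suc)
  then have "B * Suc (horner B g ks a) \<le> B * (Suc a * B ^ length ks)" by (rule mult_le_mono2)
  moreover have "B * Suc (horner B g ks a) = B + B * horner B g ks a" by simp
  moreover have "g k < B" using Cons.prems by simp
  moreover have "Suc a * B ^ length (k # ks) = B * (Suc a * B ^ length ks)" by (simp add: algebra_simps)
  ultimately show ?case unfolding horner_simps by linarith
qed simp

lemma horner_inject:
  assumes "horner B g ks a = horner B h ks b" "\<forall>k\<in>set ks. g k < B \<and> h k < B"
  shows "a = b \<and> (\<forall>k\<in>set ks. g k = h k)"
  using assms
proof (induction ks)
  case (Cons k ks)
  then have gh: "g k < B" "h k < B" by auto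
  have "g k + B * horner B g ks a = h k + B * horner B h ks b" using Cons.prems by simp
  then have "(g k + B * horner B g ks a) mod B = (h k + B * horner B h ks b) mod B"
    "(g k + B * horner B g ks a) div B = (h k + B * horner B h ks b) div B" by simp_all
  then have "g k = h k" "horner B g ks a = horner B h ks b" using gh by simp_all
  with Cons show ?case by simp
qed simp

lemma of_bool_less_power: "of_bool b < (2 :: nat) ^ Suc n"
  using one_less_power[of "2 :: nat" "Suc n"] by (cases b) simp_all

lemma sum_list_of_bool: "sum_list (map (\<lambda>z. of_bool (P z)) zs) = length (filter P zs)"
  by (induction zs) simp_all

lemma length_filter_disj:
  "(\<And>z. z \<in> set zs \<Longrightarrow> \<not> (P z \<and> Q z)) \<Longrightarrow>
    length (filter (\<lambda>z. P z \<or> Q z) zs) = length (filter P zs) + length (filter Q zs)"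
  by (induction zs) auto

lemma unique_of_counts:
  assumes "\<forall>z\<in>set zs. b z \<in> A" "w \<in> A" "\<forall>v\<in>A. length (filter (\<lambda>z. b z = v) zs) = of_bool (v = w)"
  shows "\<exists>z. zs = [z] \<and> b z = w"
proof -
  have "b z = w" if "z \<in> set zs" for z
  proof (rule ccontr)
    assume "b z \<noteq> w"
    then have "length (filter (\<lambda>y. b y = b z) zs) = 0" using assms(1,3) that by simp
    then show False using that by (auto simp: filter_empty_conv)
  qed
  then have "filter (\<lambda>z. b z = w) zs = zs" by (simp add: filter_id_conv)
  then have "length zs = 1" using assms(2,3) by auto
  then obtain z where "zs = [z]" by (auto simp: length_Suc_conv)
  then show ?thesis using \<open>\<And>z. z \<in> set zs \<Longrightarrow> b z = w\<close> by simp
qed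

text \<open>Tiles have a left, a bottom and a right color, and determine their top color by \<open>up\<close>. Rows are cyclic.\<close>

locale tile_grid =
  fixes vs :: "'v list" and hs :: "'h list" and tiles :: "('h \<times> 'v \<times> 'h) list"
    and up :: "'h \<times> 'v \<times> 'h \<Rightarrow> 'v" and T C :: nat and init :: "nat \<Rightarrow> 'v"
  assumes distinct_tiles: "distinct tiles"
    and tile_colors: "z \<in> set tiles \<Longrightarrow> fst z \<in> set hs \<and> fst (snd z) \<in> set vs \<and> snd (snd z) \<in> set hs \<and> up z \<in> set vs"
    and T: "T \<ge> 1" and C: "C \<ge> 2" and init: "init c \<in> set vs"
begin

definition tiling :: "(nat \<Rightarrow> nat \<Rightarrow> 'h \<times> 'v \<times> 'h) \<Rightarrow> bool" where
  "tiling f \<longleftrightarrow> (\<forall>t<T. \<forall>c<C. f t c \<in> set tiles \<and> fst (f t (Suc c mod C)) = snd (snd (f t c)) \<and>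
     fst (snd (f t c)) = (if t = 0 then init c else up (f (t - 1) c)))"

text \<open>Coordinates stand for the edges of the grid with a color. A tile covers its bottom and left colors,
  and at its top and right edges all colors but its own, so that an edge is covered completely and
  without overlap exactly if its two sides agree.\<close>

fun covers :: "nat \<times> nat \<times> ('h \<times> 'v \<times> 'h) \<Rightarrow> nat \<times> nat \<times> ('v + 'h) \<Rightarrow> bool" where
  "covers (t, c, z) (t', c', Inl v) \<longleftrightarrow>
     t' = t \<and> c' = c \<and> fst (snd z) = v \<or> t' = Suc t \<and> c' = c \<and> up z \<noteq> v"
| "covers (t, c, z) (t', c', Inr u) \<longleftrightarrow>
     t' = t \<and> c' = c \<and> fst z = u \<or> t' = t \<and> c' = Suc c mod C \<and> snd (snd z) \<noteq> u"

text \<open>There is no tile below the edges with \<open>t = 0\<close>, so only the initial color is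
  left to be covered there. The edges above the last row are no coordinates: the final row is
  unconstrained.\<close>

fun demand :: "nat \<times> nat \<times> ('v + 'h) \<Rightarrow> bool" where
  "demand (t, c, Inl v) \<longleftrightarrow> t \<noteq> 0 \<or> v = init c"
| "demand (t, c, Inr u) \<longleftrightarrow> True"

definition colors :: "('v + 'h) list" where
  "colors = map Inl vs @ map Inr hs"

definition coords :: "(nat \<times> nat \<times> ('v + 'h)) list" where
  "coords = concat (map (\<lambda>t. concat (map (\<lambda>c. map (\<lambda>f. (t, c, f)) colors) [0..<C])) [0..<T])"

definition placements :: "(nat \<times> nat \<times> ('h \<times> 'v \<times> 'h)) list" where
  "placements = concat (map (\<lambda>t. concat (map (\<lambda>c. map (\<lambda>z. (t, c, z)) tiles) [0..<C])) [0..<T])"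

definition item :: "(nat \<times> nat \<times> ('v + 'h) \<Rightarrow> bool) \<Rightarrow> nat" where
  "item d = horner (2 ^ Suc (T * C)) (\<lambda>k. of_bool (d k)) coords 1"

text \<open>The top part \<open>2 ^ (T * C)\<close> is below the base, exceeds the number
  \<open>T * C\<close> of tiles in a tiling, so that fillers can make up the difference, and is
  easily written in binary.\<close>

definition goal :: nat where
  "goal = horner (2 ^ Suc (T * C)) (\<lambda>k. of_bool (demand k)) coords (2 ^ (T * C))"

text \<open>The item without digits fills up the top digit, which bounds the number of items and hence prevents carries.\<close>

definition items :: "nat list" where
  "items = item (\<lambda>k. False) # map (\<lambda>z. item (covers z)) placements"

section \<open>Exact covers as sums of items\<close>

lemma set_coords: "set coords = {..<T} \<times> {..<C} \<times> set colors"
  by (auto simp: coords_def image_iff)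

lemma set_placements: "set placements = {..<T} \<times> {..<C} \<times> set tiles"
  by (auto simp: placements_def image_iff)

lemma distinct_placements: "distinct placements"
proof -
  have "distinct (map (\<lambda>z. (t, c, z)) tiles)" for t c :: nat
    using distinct_tiles by (simp add: distinct_map inj_on_def)
  then have "distinct (concat (map (\<lambda>c. map (\<lambda>z. (t, c, z)) tiles) [0..<n]))" for t n :: nat
    by (induction n) auto
  then have "distinct (concat (map (\<lambda>t. concat (map (\<lambda>c. map (\<lambda>z. (t, c, z)) tiles) [0..<C])) [0..<n]))" for n :: nat
    by (induction n) auto
  then show ?thesis by (simp add: placements_def)
qed

text \<open>With \<open>C \<ge> 2\<close> no tile is its own neighbor, so its left and right edges
  are different coordinates.\<close>

lemma Suc_mod_neq: "c < C \<Longrightarrow> Suc c mod C \<noteq> c"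
  using C by (cases "Suc c = C") auto

lemma Suc_mod_inj: "c < C \<Longrightarrow> c' < C \<Longrightarrow> Suc c mod C = Suc c' mod C \<Longrightarrow> c = c'"
  by (cases "Suc c = C"; cases "Suc c' = C") auto

lemma Suc_mod_surj: "c < C \<Longrightarrow> \<exists>c'<C. Suc c' mod C = c"
proof (cases c)
  case 0
  then show ?thesis using C by (intro exI[of _ "C - 1"]) simp
next
  case (Suc n)
  assume "c < C"
  then show ?thesis using Suc by (intro exI[of _ n]) simp
qed

lemma item_inject: "item d = item e \<Longrightarrow> \<forall>k\<in>set coords. d k = e k"
proof -
  assume "item d = item e"
  then have "\<forall>k\<in>set coords. of_bool (d k) = (of_bool (e k) :: nat)" unfolding item_def
    by (rule conjunct2[OF horner_inject]) (simp add: of_bool_less_power del: power_Suc)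
  then show ?thesis by (simp only: of_bool_eq_iff)
qed

text \<open>The generators of an instance must be listed without repetition, so a placement has to
  be recoverable from what it covers. The bottom, left and right colors make up the whole
  tile.\<close>

lemma covers_inject:
  assumes "p \<in> set placements" "q \<in> set placements" "\<forall>k\<in>set coords. covers p k = covers q k"
  shows "p = q"
proof -
  obtain t c z where p: "p = (t, c, z)" by (cases p)
  obtain t' c' z' where q: "q = (t', c', z')" by (cases q)
  have z: "t < T" "c < C" "z \<in> set tiles" and z': "t' < T" "c' < C" "z' \<in> set tiles"
    using assms(1,2) by (auto simp: p q set_placements)
  have m: "Suc c mod C < C" using C by simp
  have col: "fst z \<in> set hs" "fst (snd z) \<in> set vs" "snd (snd z) \<in> set hs" "fst (snd z') \<in> set vs"
    using tile_colors z(3) z'(3) by auto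
  have same: "covers p k = covers q k" if "k \<in> set coords" for k using assms(3) that by blast
  have "covers p (t, c, Inl (fst (snd z)))" "covers q (t', c', Inl (fst (snd z')))" by (simp_all add: p q)
  moreover have "(t, c, Inl (fst (snd z))) \<in> set coords" "(t', c', Inl (fst (snd z'))) \<in> set coords"
    using z z' col by (simp_all add: set_coords colors_def)
  ultimately have "covers q (t, c, Inl (fst (snd z)))" "covers p (t', c', Inl (fst (snd z')))"
    using same by blast+
  \<comment> \<open>The bottom coordinate of one placement could be covered from below by the other,
    but this cannot happen in both directions.\<close>
  then have e1: "t' = t" "c' = c" "fst (snd z') = fst (snd z)" by (auto simp: p q)
  have "covers p (t, c, Inr (fst z))" by (simp add: p)
  moreover have "(t, c, Inr (fst z)) \<in> set coords" using z col by (simp add: set_coords colors_def)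
  ultimately have "covers q (t, c, Inr (fst z))" using same by blast
  then have e2: "fst z' = fst z" using Suc_mod_neq[OF z(2)] e1 by (auto simp: q)
  have "\<not> covers p (t, Suc c mod C, Inr (snd (snd z)))" using Suc_mod_neq[OF z(2)] by (simp add: p)
  moreover have "(t, Suc c mod C, Inr (snd (snd z))) \<in> set coords"
    using z m col by (simp add: set_coords colors_def)
  ultimately have "\<not> covers q (t, Suc c mod C, Inr (snd (snd z)))" using same by blast
  then have "snd (snd z') = snd (snd z)" using e1 by (simp add: q)
  with e1 e2 show ?thesis by (simp add: p q prod_eq_iff)
qed

lemma distinct_items: "distinct (goal # items)"
proof -
  have "inj_on (\<lambda>z. item (covers z)) (set placements)"
  proof (rule inj_onI)
    fix p q assume "p \<in> set placements" "q \<in> set placements" "item (covers p) = item (covers q)"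
    then show "p = q" by (intro covers_inject item_inject)
  qed
  then have "distinct (map (\<lambda>z. item (covers z)) placements)"
    using distinct_placements by (simp add: distinct_map)
  moreover have "item (\<lambda>k. False) \<noteq> item (covers p)" if "p \<in> set placements" for p
  proof
    assume "item (\<lambda>k. False) = item (covers p)"
    then have "\<forall>k\<in>set coords. \<not> covers p k" using item_inject by blast
    moreover obtain t c z where p: "p = (t, c, z)" by (cases p)
    moreover have "(t, c, Inl (fst (snd z))) \<in> set coords"
      using that tile_colors by (auto simp: p set_placements set_coords colors_def)
    ultimately show False by fastforce
  qed
  moreover have "goal \<noteq> item d" for d
  proof
    assume "goal = item d"
    then have "2 ^ (T * C) = (1 :: nat)" unfolding goal_def item_def
      by (rule conjunct1[OF horner_inject]) (simp add: of_bool_less_power del: power_Suc)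
    then show False using T C by simp
  qed
  ultimately show ?thesis unfolding items_def distinct.simps list.set set_map by blast
qed

lemma item_pos: "item d > 0"
  unfolding item_def by (rule horner_pos) simp_all

lemma goal_pos: "goal > 0"
  unfolding goal_def by (rule horner_pos) simp_all

lemma sum_items:
  "sum_list (map item ds) =
    horner (2 ^ Suc (T * C)) (\<lambda>k. length (filter (\<lambda>d. d k) ds)) coords (length ds)"
proof -
  have "sum_list (map item ds) = sum_list (map (\<lambda>d. horner (2 ^ Suc (T * C)) (\<lambda>k. of_bool (d k)) coords 1) ds)"
    by (simp add: item_def[abs_def])
  also have "\<dots> = horner (2 ^ Suc (T * C)) (\<lambda>k. length (filter (\<lambda>d. d k) ds)) coords (length ds)"
    unfolding horner_sum_list sum_list_of_bool by (simp add: sum_list_triv)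
  finally show ?thesis .
qed

lemma goal_iff_exact_cover:
  "sum_list (map item ds) = goal \<longleftrightarrow>
    length ds = 2 ^ (T * C) \<and> (\<forall>k\<in>set coords. length (filter (\<lambda>d. d k) ds) = of_bool (demand k))"
proof
  let ?B = "2 ^ Suc (T * C) :: nat"
  assume *: "sum_list (map item ds) = goal"
  \<comment> \<open>The top part alone bounds the number of items, before anything is known about
    the digits; only then carries are excluded.\<close>
  have "length ds * ?B ^ length coords \<le> goal"
    using horner_lower unfolding *[symmetric] sum_items by blast
  also have "goal < Suc (2 ^ (T * C)) * ?B ^ length coords"
    unfolding goal_def by (rule horner_upper) (simp add: of_bool_less_power del: power_Suc)
  finally have "length ds < Suc (2 ^ (T * C))" by (simp only: mult_less_cancel2)
  then have "length ds < ?B" by (simp add: less_Suc_eq_le) (use zero_less_power[of "2 :: nat" "T * C"] in linarith)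
  then have lt: "length (filter P ds) < ?B" for P
    using length_filter_le[of P ds] by linarith
  have "horner ?B (\<lambda>k. length (filter (\<lambda>d. d k) ds)) coords (length ds) =
      horner ?B (\<lambda>k. of_bool (demand k)) coords (2 ^ (T * C))"
    using * unfolding sum_items goal_def .
  from horner_inject[OF this] lt
  show "length ds = 2 ^ (T * C) \<and> (\<forall>k\<in>set coords. length (filter (\<lambda>d. d k) ds) = of_bool (demand k))"
    by (simp add: of_bool_less_power del: power_Suc)
next
  assume *: "length ds = 2 ^ (T * C) \<and> (\<forall>k\<in>set coords. length (filter (\<lambda>d. d k) ds) = of_bool (demand k))"
  then show "sum_list (map item ds) = goal" unfolding sum_items goal_def by (simp add: horner_cong)
qed

lemma cover_of_tiling:
  assumes f: "tiling f" and k: "k \<in> set coords"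
  defines "zs \<equiv> filter (\<lambda>p. snd (snd p) = f (fst p) (fst (snd p))) placements"
  shows "length (filter (\<lambda>p. covers p k) zs) = of_bool (demand k)"
proof -
  have mem: "p \<in> set zs \<longleftrightarrow> (\<exists>t c. p = (t, c, f t c) \<and> t < T \<and> c < C)" for p
    using f by (cases p) (auto simp: zs_def set_placements tiling_def)
  have "distinct zs" using distinct_placements by (simp add: zs_def)
  then have len: "length (filter (\<lambda>p. covers p k) zs) = card {p \<in> set zs. covers p k}"
    by (simp add: distinct_length_filter Int_def conj_commute)
  obtain t c q where kq: "k = (t, c, q)" by (cases k)
  have tc: "t < T" "c < C" "q \<in> set colors" using k by (auto simp: kq set_coords)
  have f1: "fst (snd (f t c)) = (if t = 0 then init c else up (f (t - 1) c))" using f tc by (auto simp: tiling_def)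
  show ?thesis
  proof (cases q)
    case (Inl v)
    show ?thesis
    proof (cases "t = 0")
      case True
      then have "{p \<in> set zs. covers p k} = (if v = init c then {(t, c, f t c)} else {})"
        using f1 tc by (auto simp: mem kq Inl)
      then show ?thesis unfolding len by (simp add: kq Inl True)
    next
      case False
      then have "{p \<in> set zs. covers p k} = {if fst (snd (f t c)) = v then (t, c, f t c) else (t - 1, c, f (t - 1) c)}"
        using f1 tc by (auto simp: mem kq Inl)
      then show ?thesis unfolding len using False by (simp add: kq Inl)
    qed
  next
    case (Inr u)
    obtain c' where c': "c' < C" "Suc c' mod C = c" using Suc_mod_surj tc(2) by blast
    have lr: "fst (f t c) = snd (snd (f t c'))" using f tc c' by (auto simp: tiling_def)
    have "covers (t1, c1, f t1 c1) k \<longleftrightarrow>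
        t1 = t \<and> (if fst (f t c) = u then c1 = c else c1 = c')" if "c1 < C" for t1 c1
    proof -
      have m: "c = Suc c1 mod C \<longleftrightarrow> c1 = c'" using c'(2) Suc_mod_inj[OF that c'(1)] by metis
      have ne: "c' \<noteq> c" using Suc_mod_neq[OF c'(1)] c'(2) by blast
      show ?thesis unfolding kq Inr covers.simps m
        by (cases "t1 = t"; cases "c1 = c"; cases "c1 = c'") (use lr ne in simp_all)
    qed
    then have "{p \<in> set zs. covers p k} = {if fst (f t c) = u then (t, c, f t c) else (t, c', f t c')}"
      using tc(1,2) c'(1) by (cases "fst (f t c) = u") (auto simp: mem)
    then show ?thesis unfolding len by (simp add: kq Inr)
  qed
qed

text \<open>By induction on the rows: in row 0 the demand leaves one color for each bottom edge,
  which forces a single tile at each place. A single tile covers all colors but its own at its top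
  edge, so exactly that color remains for a single tile above.\<close>

lemma tiling_of_cover:
  assumes ps: "set ps \<subseteq> set placements"
    and cover: "\<And>k. k \<in> set coords \<Longrightarrow> length (filter (\<lambda>p. covers p k) ps) = of_bool (demand k)"
  shows "\<exists>f. tiling f"
proof -
  define here where "here t c = filter (\<lambda>p. fst p = t \<and> fst (snd p) = c) ps" for t c
  have ps': "snd (snd p) \<in> set tiles \<and> fst p < T \<and> fst (snd p) < C" if "p \<in> set ps" for p
    using ps that by (cases p) (auto simp: set_placements)
  have filter_here: "filter P (here t c) = filter (\<lambda>p. fst p = t \<and> fst (snd p) = c \<and> P p) ps" for P t c
    by (simp add: here_def conj_assoc)
  have colors_here: "\<forall>p\<in>set (here t c). fst (snd (snd (snd p))) \<in> set vs" for t c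
    using ps' tile_colors by (auto simp: here_def)
  have vert: "length (filter (\<lambda>p. covers p (t, c, Inl v)) ps) =
      length (filter (\<lambda>p. fst (snd (snd (snd p))) = v) (here t c)) +
      (if t = 0 then 0 else length (filter (\<lambda>p. up (snd (snd p)) \<noteq> v) (here (t - 1) c)))" for t c v
  proof -
    have "(\<lambda>p. covers p (t, c, Inl v)) = (\<lambda>p. (fst p = t \<and> fst (snd p) = c \<and> fst (snd (snd (snd p))) = v) \<or>
        (t = Suc (fst p) \<and> fst (snd p) = c \<and> up (snd (snd p)) \<noteq> v))" by (auto simp: fun_eq_iff)
    then have "length (filter (\<lambda>p. covers p (t, c, Inl v)) ps) =
        length (filter (\<lambda>p. fst p = t \<and> fst (snd p) = c \<and> fst (snd (snd (snd p))) = v) ps) +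
        length (filter (\<lambda>p. t = Suc (fst p) \<and> fst (snd p) = c \<and> up (snd (snd p)) \<noteq> v) ps)"
      by (simp only:) (rule length_filter_disj, auto)
    then show ?thesis unfolding filter_here by (cases t) (auto intro: arg_cong[of _ _ length] filter_cong)
  qed
  have horiz: "length (filter (\<lambda>p. covers p (t, Suc c mod C, Inr u)) ps) =
      length (filter (\<lambda>p. fst (snd (snd p)) = u) (here t (Suc c mod C))) +
      length (filter (\<lambda>p. snd (snd (snd (snd p))) \<noteq> u) (here t c))" if c: "c < C" for t c u
  proof -
    have "covers p (t, Suc c mod C, Inr u) \<longleftrightarrow> (fst p = t \<and> fst (snd p) = Suc c mod C \<and> fst (snd (snd p)) = u) \<or>
        (fst p = t \<and> fst (snd p) = c \<and> snd (snd (snd (snd p))) \<noteq> u)" if "p \<in> set ps" for p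
      using ps'[OF that] Suc_mod_inj[OF c, of "fst (snd p)"] by (cases p) auto
    then have "length (filter (\<lambda>p. covers p (t, Suc c mod C, Inr u)) ps) =
        length (filter (\<lambda>p. (fst p = t \<and> fst (snd p) = Suc c mod C \<and> fst (snd (snd p)) = u) \<or>
        (fst p = t \<and> fst (snd p) = c \<and> snd (snd (snd (snd p))) \<noteq> u)) ps)"
      by (intro arg_cong[of _ _ length] filter_cong) auto
    also have "\<dots> = length (filter (\<lambda>p. fst p = t \<and> fst (snd p) = Suc c mod C \<and> fst (snd (snd p)) = u) ps) +
        length (filter (\<lambda>p. fst p = t \<and> fst (snd p) = c \<and> snd (snd (snd (snd p))) \<noteq> u) ps)"
      using Suc_mod_neq[OF c] by (intro length_filter_disj) auto
    finally show ?thesis unfolding filter_here .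
  qed
  have one: "\<exists>p. here t c = [p] \<and> (fst (snd (snd (snd p))) = (if t = 0 then init c else up (snd (snd (hd (here (t - 1) c))))))"
    if "t < T" "c < C" for t c
    using that
  proof (induction t)
    case 0
    have "\<forall>v\<in>set vs. length (filter (\<lambda>p. fst (snd (snd (snd p))) = v) (here 0 c)) = of_bool (v = init c)"
      using vert[of 0 c] cover[of "(0, c, Inl _)"] 0 by (auto simp: set_coords colors_def)
    from unique_of_counts[OF colors_here init this] show ?case by simp
  next
    case (Suc t)
    then obtain p where p: "here t c = [p]" by auto
    then have "p \<in> set ps" by (auto simp: here_def filter_eq_Cons_iff)
    then have w: "up (snd (snd p)) \<in> set vs" using ps' tile_colors by blast
    have "length (filter (\<lambda>p. fst (snd (snd (snd p))) = v) (here (Suc t) c)) = of_bool (v = up (snd (snd p)))"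
      if "v \<in> set vs" for v
    proof -
      have "(Suc t, c, Inl v) \<in> set coords" using that Suc.prems by (auto simp: set_coords colors_def)
      from cover[OF this] vert[of "Suc t" c v] show ?thesis by (auto simp: p)
    qed
    then show ?case using unique_of_counts[OF colors_here w, of "Suc t" c] by (simp add: p)
  qed
  define f where "f t c = snd (snd (hd (here t c)))" for t c
  have here: "here t c = [(t, c, f t c)] \<and> f t c \<in> set tiles" if tc: "t < T" "c < C" for t c
  proof -
    obtain p where p: "here t c = [p]" using one[OF tc] by blast
    then have "p \<in> set (here t c)" by simp
    then have "fst p = t" "fst (snd p) = c" "snd (snd p) \<in> set tiles" using ps' by (auto simp: here_def)
    then show ?thesis using p by (simp add: f_def prod_eq_iff)
  qed
  have "tiling f" unfolding tiling_def
  proof (intro allI impI conjI)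
    fix t c assume tc: "t < T" "c < C"
    show "f t c \<in> set tiles" using here[OF tc] by blast
    show "fst (snd (f t c)) = (if t = 0 then init c else up (f (t - 1) c))"
    proof -
      obtain p where "here t c = [p]"
        "fst (snd (snd (snd p))) = (if t = 0 then init c else up (snd (snd (hd (here (t - 1) c)))))"
        using one[OF tc] by blast
      then show ?thesis by (simp add: f_def)
    qed
    have c': "Suc c mod C < C" using C by simp
    \<comment> \<open>At its own right color a tile leaves the edge uncovered, so the right neighbor
      has to cover it and has this color on its left.\<close>
    have "snd (snd (f t c)) \<in> set hs" using here[OF tc] tile_colors by blast
    then have "(t, Suc c mod C, Inr (snd (snd (f t c)))) \<in> set coords"
      using tc c' by (auto simp: set_coords colors_def)
    from cover[OF this] horiz[OF tc(2), of t "snd (snd (f t c))"] here[OF tc] here[OF tc(1) c']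
    show "fst (f t (Suc c mod C)) = snd (snd (f t c))" by (simp split: if_splits)
  qed
  then show ?thesis by blast
qed

theorem knapsack_iff_tiling:
  "(\<exists>ys. set ys \<subseteq> set items \<and> sum_list ys = goal) \<longleftrightarrow> (\<exists>f. tiling f)"
proof
  assume "\<exists>ys. set ys \<subseteq> set items \<and> sum_list ys = goal"
  then obtain ys where ys: "set ys \<subseteq> set items" "sum_list ys = goal" by blast
  define D where "D = insert (\<lambda>k. False) (covers ` set placements)"
  have "set items = item ` D" by (auto simp: items_def D_def)
  then have "ys \<in> lists (item ` D)" using ys(1) by blast
  then obtain ds where ds: "set ds \<subseteq> D" "ys = map item ds" unfolding lists_image by blast
  have "\<exists>ps. set ps \<subseteq> set placements \<and> (\<forall>k. length (filter (\<lambda>d. d k) ds) = length (filter (\<lambda>p. covers p k) ps))"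
    using ds(1)
  proof (induction ds)
    case Nil
    show ?case by (rule exI[of _ "[]"]) simp
  next
    case (Cons d ds)
    then obtain ps where ps: "set ps \<subseteq> set placements"
      "\<forall>k. length (filter (\<lambda>d. d k) ds) = length (filter (\<lambda>p. covers p k) ps)" by auto
    consider "d = (\<lambda>k. False)" | p where "p \<in> set placements" "d = covers p"
      using Cons.prems by (auto simp: D_def)
    then show ?case
    proof cases
      case 1
      then show ?thesis using ps by (intro exI[of _ ps]) simp
    next
      case 2
      then show ?thesis using ps by (intro exI[of _ "p # ps"]) simp
    qed
  qed
  then obtain ps where ps: "set ps \<subseteq> set placements"
    "\<And>k. length (filter (\<lambda>d. d k) ds) = length (filter (\<lambda>p. covers p k) ps)" by blast
  have "\<forall>k\<in>set coords. length (filter (\<lambda>d. d k) ds) = of_bool (demand k)"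
    using ys(2) goal_iff_exact_cover[of ds] by (simp add: ds(2))
  then show "\<exists>f. tiling f" using ps(2) by (intro tiling_of_cover[OF ps(1)]) simp
next
  assume "\<exists>f. tiling f"
  then obtain f where f: "tiling f" by blast
  define zs where "zs = filter (\<lambda>p. snd (snd p) = f (fst p) (fst (snd p))) placements"
  have "length zs \<le> T * C"
  proof -
    have "set zs \<subseteq> (\<lambda>(t, c). (t, c, f t c)) ` ({..<T} \<times> {..<C})"
      by (auto simp: zs_def set_placements)
    then have "card (set zs) \<le> card ({..<T} \<times> {..<C})" by (intro surj_card_le) auto
    moreover have "card (set zs) = length zs"
      using distinct_placements by (intro distinct_card) (simp add: zs_def)
    ultimately show ?thesis by (simp add: card_cartesian_product)
  qed
  also have "\<dots> < 2 ^ (T * C)" by (rule less_exp)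
  finally have len: "length zs < 2 ^ (T * C)" .
  define ds where "ds = map covers zs @ replicate (2 ^ (T * C) - length zs) (\<lambda>k. False)"
  have "length (filter (\<lambda>d. d k) ds) = length (filter (\<lambda>p. covers p k) zs)" for k
    by (simp add: ds_def filter_map comp_def)
  then have "sum_list (map item ds) = goal"
    unfolding goal_iff_exact_cover using cover_of_tiling[OF f] len by (simp add: ds_def zs_def)
  moreover have "set (map item ds) \<subseteq> set items" by (auto simp: ds_def items_def zs_def)
  ultimately show "\<exists>ys. set ys \<subseteq> set items \<and> sum_list ys = goal" by blast
qed

end

section \<open>From knapsack to factorizations of a unipotent matrix\<close>

definition unipotent :: "nat \<Rightarrow> mat2" where
  "unipotent y = of4 (1, int y, 0, 1)"

lemma unipotent_inject [simp]: "unipotent y = unipotent z \<longleftrightarrow> y = z"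
  by (simp add: unipotent_def to4_inject[symmetric] del: to4_inject)

lemma mat_prod_unipotent: "mat_prod (map unipotent ys) = unipotent (sum_list ys)"
proof -
  have "prod4 (map (\<lambda>y. (1, int y, 0, 1)) ys) = (1, int (sum_list ys), 0, 1)"
    by (induction ys) (simp_all add: one4_def)
  then have "to4 (mat_prod (map unipotent ys)) = to4 (unipotent (sum_list ys))"
    by (simp add: to4_prod unipotent_def comp_def)
  then show ?thesis by (simp only: to4_inject)
qed

lemma unipotent_SL2Z: "unipotent y \<in> SL2Z"
  by (simp add: SL2Z_def unipotent_def det4_to4[symmetric])

lemma multiple_factorizations_unipotent:
  assumes "Y > 0" "Y \<notin> set ys" "\<forall>y\<in>set ys. y > 0"
  shows "multiple_factorizations (unipotent ` set (Y # ys)) (unipotent Y) \<longleftrightarrow>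
    (\<exists>zs. set zs \<subseteq> set ys \<and> sum_list zs = Y)"
proof -
  have fac: "As \<in> factorizations (unipotent ` set (Y # ys)) (unipotent Y) \<longleftrightarrow>
      (\<exists>zs. As = map unipotent zs \<and> set zs \<subseteq> insert Y (set ys) \<and> sum_list zs = Y)" for As
  proof
    assume As: "As \<in> factorizations (unipotent ` set (Y # ys)) (unipotent Y)"
    then have "As \<in> lists (unipotent ` set (Y # ys))" by (auto simp: factorizations_def)
    then obtain zs where "As = map unipotent zs" "set zs \<subseteq> set (Y # ys)" unfolding lists_image by blast
    then show "\<exists>zs. As = map unipotent zs \<and> set zs \<subseteq> insert Y (set ys) \<and> sum_list zs = Y"
      using As by (auto simp: factorizations_def mat_prod_unipotent)
  next
    assume "\<exists>zs. As = map unipotent zs \<and> set zs \<subseteq> insert Y (set ys) \<and> sum_list zs = Y"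
    then obtain zs where zs: "As = map unipotent zs" "set zs \<subseteq> set (Y # ys)" "sum_list zs = Y" by auto
    then have "set As \<subseteq> unipotent ` set (Y # ys)" "As \<noteq> []"
      using assms(1) image_mono[OF zs(2), of unipotent] by auto
    then show "As \<in> factorizations (unipotent ` set (Y # ys)) (unipotent Y)"
      using zs by (simp add: factorizations_def mat_prod_unipotent)
  qed
  \<comment> \<open>All numbers are positive, so nothing can stand next to \<open>Y\<close> in a sum
    equal to \<open>Y\<close>.\<close>
  have single: "zs = [Y]" if *: "set zs \<subseteq> insert Y (set ys)" "sum_list zs = Y" "Y \<in> set zs" for zs
  proof -
    obtain us ws where zs: "zs = us @ Y # ws" using *(3) by (meson split_list)
    then have "sum_list us = 0" "sum_list ws = 0" using *(2) by simp_all
    moreover have "\<forall>y\<in>set us \<union> set ws. y > 0" using *(1) assms zs by auto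
    ultimately have "us = []" "ws = []" by (cases us; cases ws; auto)+
    then show ?thesis by (simp add: zs)
  qed
  show ?thesis
  proof
    assume "multiple_factorizations (unipotent ` set (Y # ys)) (unipotent Y)"
    then obtain As Bs where ne: "As \<noteq> Bs" and AB: "As \<in> factorizations (unipotent ` set (Y # ys)) (unipotent Y)"
      "Bs \<in> factorizations (unipotent ` set (Y # ys)) (unipotent Y)"
      unfolding multiple_factorizations_def by blast
    obtain us ws where "As = map unipotent us" "set us \<subseteq> insert Y (set ys)" "sum_list us = Y"
      "Bs = map unipotent ws" "set ws \<subseteq> insert Y (set ys)" "sum_list ws = Y"
      using AB unfolding fac by blast
    moreover from this have "us \<noteq> ws" using ne by auto
    ultimately have "Y \<notin> set us \<and> set us \<subseteq> insert Y (set ys) \<and> sum_list us = Y \<or>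
      Y \<notin> set ws \<and> set ws \<subseteq> insert Y (set ys) \<and> sum_list ws = Y" using single by metis
    then show "\<exists>zs. set zs \<subseteq> set ys \<and> sum_list zs = Y" by blast
  next
    assume "\<exists>zs. set zs \<subseteq> set ys \<and> sum_list zs = Y"
    then obtain zs where zs: "set zs \<subseteq> set ys" "sum_list zs = Y" by blast
    have "zs \<noteq> [Y]"
    proof
      assume "zs = [Y]"
      then show False using zs(1) assms(2) by (metis list.set_intros(1) subsetD)
    qed
    then have "map unipotent zs \<noteq> map unipotent [Y]" by (auto simp: map_eq_Cons_conv)
    moreover have "map unipotent zs \<in> factorizations (unipotent ` set (Y # ys)) (unipotent Y)"
      "map unipotent [Y] \<in> factorizations (unipotent ` set (Y # ys)) (unipotent Y)"
      unfolding fac using zs by (auto intro: exI[of _ zs] exI[of _ "[Y]"])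
    ultimately show "multiple_factorizations (unipotent ` set (Y # ys)) (unipotent Y)"
      unfolding multiple_factorizations_def by blast
  qed
qed

text \<open>Because the matrix of \<open>Y\<close> is itself a generator, the target lies in the
  semigroup in every case, so no string outside the instances is produced.\<close>

lemma knapsack_instance:
  assumes "Y > 0" "distinct (Y # ys)" "\<forall>y\<in>set ys. y > 0"
    and w: "w = enc_instance (map unipotent (Y # ys)) (unipotent Y)"
  shows "((\<exists>zs. set zs \<subseteq> set ys \<and> sum_list zs = Y) \<longrightarrow> w \<in> fst multiple_factorization_problem) \<and>
    ((\<nexists>zs. set zs \<subseteq> set ys \<and> sum_list zs = Y) \<longrightarrow> w \<in> snd multiple_factorization_problem)"
proof -
  let ?Gs = "map unipotent (Y # ys)" and ?G = "unipotent ` set (Y # ys)"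
  have "encodes w ?G (unipotent Y)" unfolding encodes_def
    using assms(2) w by (intro exI[of _ ?Gs]) (auto simp: distinct_map inj_on_def)
  moreover have "?G \<subseteq> SL2Z" using unipotent_SL2Z by auto
  moreover have "unipotent Y \<in> generated_semigroup ?G"
    unfolding generated_semigroup_def using mat_prod_unipotent[of "[Y]"]
    by (auto intro!: exI[of _ "[unipotent Y]"])
  moreover have "finite ?G" by simp
  moreover have "multiple_factorizations ?G (unipotent Y) \<longleftrightarrow> (\<exists>zs. set zs \<subseteq> set ys \<and> sum_list zs = Y)"
    using assms by (intro multiple_factorizations_unipotent) auto
  ultimately show ?thesis
    unfolding multiple_factorization_problem_def fst_conv snd_conv mem_Collect_eq by metis
qed

section \<open>Writing down the knapsack instance of a tiling problem\<close>

definition double :: "bool list \<Rightarrow> bool list" where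
  "double bs = concat (map (\<lambda>b. [True, b]) bs)"

lemma double_simps [simp]: "double [] = []" "double (b # bs) = True # b # double bs"
  "double (bs @ cs) = double bs @ double cs"
  by (simp_all add: double_def)

lemma enc_mat_unipotent:
  assumes "bs = [] \<or> last bs"
  shows "enc_mat (unipotent (bits_val bs)) =
    enc_int 1 @ [False] @ double bs @ [False] @ enc_int 0 @ enc_int 1"
proof -
  have "enc_int (int (bits_val bs)) = [False] @ double bs @ [False]"
    using nat_bits_val[OF assms] by (simp add: enc_int_def enc_list_def double_def)
  then show ?thesis by (simp add: enc_mat_def unipotent_def of4_def)
qed

text \<open>For lists that are known when the program is built: colors and tiles depend on the
  machine only, so iterating over them is unrolled, while the grid is traversed by
  \<open>For\<close>.\<close>

definition cats :: "em list \<Rightarrow> em" where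
  "cats ms = foldr Cat ms (Out [])"

lemma emitted_cats: "emitted x env (cats ms) = concat (map (emitted x env) ms)"
  by (induction ms) (simp_all add: cats_def)

lemma admissible_cats: "admissible k (cats ms) \<longleftrightarrow> (\<forall>m\<in>set ms. admissible k m)"
  by (induction ms) (simp_all add: cats_def)

text \<open>Only the two dimensions and the initial row depend on the input. The dimensions are
  given by expressions, and a program compares a fixed color with the initial one.\<close>

locale tiling_reduction =
  fixes vs :: "'v list" and hs :: "'h list" and tiles :: "('h \<times> 'v \<times> 'h) list"
    and up :: "'h \<times> 'v \<times> 'h \<Rightarrow> 'v" and Te We :: exp and T W :: "bool list \<Rightarrow> nat"
    and init :: "bool list \<Rightarrow> nat \<Rightarrow> 'v" and init_em :: "'v \<Rightarrow> em"
  assumes grid: "tile_grid vs hs tiles up (T x) (W x) (init x)"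
    and Te: "eval x env Te = T x" "scoped k Te" "simple Te"
    and We: "eval x env We = W x" "scoped k We" "simple We"
    and init_em: "emitted x [t, c] (init_em v) = [True, v = init x c]" "admissible 2 (init_em v)"
begin

definition digit_one :: em where "digit_one = Out [True, True]"
definition digit_zero :: em where "digit_zero = Out [True, False]"

definition zeros_em :: em where
  "zeros_em = For (Mul Te We) digit_zero"

definition digits_em :: "('v + 'h \<Rightarrow> em) \<Rightarrow> em" where
  "digits_em D = For Te (For We (cats (map (\<lambda>f. Cat (D f) zeros_em) (tile_grid.colors vs hs))))"

definition mat_em :: "em \<Rightarrow> em" where
  "mat_em m = Cat (Out (enc_int 1 @ [False])) (Cat m (Out (False # enc_int 0 @ enc_int 1)))"

fun demand_em :: "'v + 'h \<Rightarrow> em" where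
  "demand_em (Inl v) = IfEq (Var 0) (Const 0) (init_em v) digit_one"
| "demand_em (Inr u) = digit_one"

text \<open>Variables 0 and 1 are the place of the tile, 2 and 3 the coordinate. The neighbor
  \<open>Suc c mod C\<close> is found by cases: either the next column or, at the last column,
  column 0.\<close>

fun covers_em :: "'h \<times> 'v \<times> 'h \<Rightarrow> 'v + 'h \<Rightarrow> em" where
  "covers_em z (Inl v) =
     IfEq (Var 3) (Var 1)
       (IfEq (Var 2) (Var 0) (if fst (snd z) = v then digit_one else digit_zero)
         (IfEq (Var 2) (Add (Var 0) (Const 1)) (if up z \<noteq> v then digit_one else digit_zero) digit_zero))
       digit_zero"
| "covers_em z (Inr u) =
     IfEq (Var 2) (Var 0)
       (IfEq (Var 3) (Var 1) (if fst z = u then digit_one else digit_zero)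
         (IfEq (Var 3) (Add (Var 1) (Const 1)) (if snd (snd z) \<noteq> u then digit_one else digit_zero)
           (IfEq (Var 3) (Const 0)
             (IfEq (Add (Var 1) (Const 1)) We (if snd (snd z) \<noteq> u then digit_one else digit_zero) digit_zero)
             digit_zero)))
       digit_zero"

definition goal_em :: em where
  "goal_em = mat_em (Cat (digits_em demand_em) (Cat zeros_em digit_one))"

definition item_em :: "('v + 'h \<Rightarrow> em) \<Rightarrow> em" where
  "item_em D = mat_em (Cat (digits_em D) digit_one)"

text \<open>The marks \<open>True\<close> and \<open>False\<close> are those of
  \<open>enc_list\<close>; the goal appears as first generator and as target.\<close>

definition instance_em :: em where
  "instance_em = cats [Out [True], goal_em, Out [True], item_em (\<lambda>f. digit_zero),
     For Te (For We (cats (map (\<lambda>z. Cat (Out [True]) (item_em (covers_em z))) tiles))),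
     Out [False], goal_em]"

lemma admissible_instance: "admissible 0 instance_em"
proof -
  have "admissible 2 (demand_em f)" for f
    by (cases f) (simp_all add: init_em digit_one_def)
  moreover have "admissible 4 (covers_em z f)" for z f
    using We(2)[of 4] We(3) by (cases f) (simp_all add: digit_one_def digit_zero_def)
  ultimately show ?thesis using Te We
    by (simp add: instance_em_def goal_em_def item_em_def mat_em_def digits_em_def zeros_em_def admissible_cats
        digit_one_def digit_zero_def eval_nat_numeral)
qed

context
  fixes x :: "bool list"
begin

interpretation G: tile_grid vs hs tiles up "T x" "W x" "init x"
  by (rule grid)

lemma emitted_zeros: "emitted x env zeros_em = double (replicate (T x * W x) False)"
proof -
  have "concat (map (\<lambda>i. [True, False]) [0..<n]) = double (replicate n False)" for n
  proof (induction n)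
    case (Suc n)
    have "double (replicate n False) @ [True, False] = double (replicate n False @ [False])" by simp
    then have "double (replicate n False) @ [True, False] = double (replicate (Suc n) False)"
      by (simp only: replicate_append_same replicate_Suc)
    then show ?case using Suc by simp
  qed simp
  then show ?thesis by (simp add: zeros_em_def Te We digit_zero_def)
qed

lemma double_concat: "double (concat bss) = concat (map double bss)"
  by (induction bss) simp_all

lemma concat_concat: "concat (concat xsss) = concat (map concat xsss)"
  by (induction xsss) simp_all

lemma emitted_digits:
  assumes "\<And>t c f. t < T x \<Longrightarrow> c < W x \<Longrightarrow> f \<in> set G.colors \<Longrightarrow> emitted x (env @ [t, c]) (D f) = [True, d (t, c, f)]"
  shows "emitted x env (digits_em D) = double (concat (map (\<lambda>k. d k # replicate (T x * W x) False) G.coords))"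
proof -
  have "emitted x env (digits_em D) = concat (map (\<lambda>t. concat (map (\<lambda>c. concat (map (\<lambda>f.
      emitted x (env @ [t, c]) (D f) @ double (replicate (T x * W x) False)) G.colors)) [0..<W x])) [0..<T x])"
    by (simp add: digits_em_def emitted_cats comp_def emitted_zeros Te We)
  also have "\<dots> = concat (map (\<lambda>t. concat (map (\<lambda>c. concat (map (\<lambda>f.
      [True, d (t, c, f)] @ double (replicate (T x * W x) False)) G.colors)) [0..<W x])) [0..<T x])"
    using assms by (intro arg_cong[of _ _ concat] map_cong refl) auto
  also have "\<dots> = double (concat (map (\<lambda>k. d k # replicate (T x * W x) False) G.coords))"
    by (simp add: G.coords_def map_concat comp_def double_concat concat_concat)
  finally show ?thesis .
qed

lemma emitted_item:
  assumes "\<And>t c f. t < T x \<Longrightarrow> c < W x \<Longrightarrow> f \<in> set G.colors \<Longrightarrow> emitted x (env @ [t, c]) (D f) = [True, d (t, c, f)]"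
  shows "emitted x env (item_em D) = enc_mat (unipotent (G.item d))"
proof -
  let ?bs = "concat (map (\<lambda>k. d k # replicate (T x * W x) False) G.coords) @ [True]"
  have "G.item d = bits_val ?bs" by (simp only: G.item_def bits_val_digits) simp
  \<comment> \<open>The last bit is the top digit 1, so the bits are the canonical representation
    without leading zeros.\<close>
  then have "enc_mat (unipotent (G.item d)) = enc_int 1 @ [False] @ double ?bs @ [False] @ enc_int 0 @ enc_int 1"
    by (simp only:) (rule enc_mat_unipotent, simp)
  then show ?thesis using emitted_digits[OF assms] by (simp add: item_em_def mat_em_def digit_one_def)
qed

lemma emitted_goal: "emitted x [] goal_em = enc_mat (unipotent G.goal)"
proof -
  let ?bs = "concat (map (\<lambda>k. G.demand k # replicate (T x * W x) False) G.coords) @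
    replicate (T x * W x) False @ [True]"
  have "emitted x ([] @ [t, c]) (demand_em f) = [True, G.demand (t, c, f)]" for t c f
    by (cases f) (simp_all add: init_em digit_one_def)
  then have d: "emitted x [] (digits_em demand_em) =
      double (concat (map (\<lambda>k. G.demand k # replicate (T x * W x) False) G.coords))"
    by (rule emitted_digits)
  have "bits_val (replicate (T x * W x) False @ [True]) = 2 ^ (T x * W x)" by (simp add: bits_val_zeros)
  then have "G.goal = bits_val ?bs" by (simp only: G.goal_def bits_val_digits)
  then have "enc_mat (unipotent G.goal) = enc_int 1 @ [False] @ double ?bs @ [False] @ enc_int 0 @ enc_int 1"
    by (simp only:) (rule enc_mat_unipotent, simp)
  then show ?thesis using d by (simp add: goal_em_def mat_em_def digit_one_def emitted_zeros)
qed

lemma emitted_covers: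
  assumes "c < W x" "t' < T x" "c' < W x"
  shows "emitted x [t, c, t', c'] (covers_em z f) = [True, G.covers (t, c, z) (t', c', f)]"
proof -
  have "c' = Suc c mod W x \<longleftrightarrow> c' = Suc c \<or> c' = 0 \<and> Suc c = W x"
    using assms by (cases "Suc c = W x") auto
  moreover have "Suc c mod W x \<noteq> c" using G.Suc_mod_neq assms(1) by blast
  ultimately show ?thesis
    by (cases f) (auto simp: digit_one_def digit_zero_def We eval_nat_numeral)
qed

lemma emitted_instance:
  "emitted x [] instance_em = enc_instance (map unipotent (G.goal # G.items)) (unipotent G.goal)"
proof -
  have filler: "emitted x [] (item_em (\<lambda>f. digit_zero)) = enc_mat (unipotent (G.item (\<lambda>k. False)))"
    by (rule emitted_item) (simp add: digit_zero_def)
  have tile: "emitted x [t, c] (item_em (covers_em z)) = enc_mat (unipotent (G.item (G.covers (t, c, z))))"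
    if "c < W x" for t c z
    by (rule emitted_item) (use that in \<open>simp add: emitted_covers\<close>)
  have "emitted x [] (For Te (For We (cats (map (\<lambda>z. Cat (Out [True]) (item_em (covers_em z))) tiles)))) =
      concat (map (\<lambda>t. concat (map (\<lambda>c. concat (map (\<lambda>z.
        True # emitted x [t, c] (item_em (covers_em z))) tiles)) [0..<W x])) [0..<T x])"
    by (simp add: emitted_cats comp_def Te We)
  also have "\<dots> = concat (map (\<lambda>t. concat (map (\<lambda>c. concat (map (\<lambda>z.
        True # enc_mat (unipotent (G.item (G.covers (t, c, z))))) tiles)) [0..<W x])) [0..<T x])"
    using tile by (intro arg_cong[of _ _ concat] map_cong refl) auto
  also have "\<dots> = concat (map (\<lambda>p. True # enc_mat (unipotent (G.item (G.covers p)))) G.placements)"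
    by (simp add: G.placements_def map_concat comp_def concat_concat)
  finally have "emitted x [] (For Te (For We (cats (map (\<lambda>z. Cat (Out [True]) (item_em (covers_em z))) tiles)))) =
      concat (map (\<lambda>p. True # enc_mat (unipotent (G.item (G.covers p)))) G.placements)" .
  with filler show ?thesis
    by (simp only: instance_em_def emitted_cats)
      (simp add: enc_instance_def enc_list_def G.items_def comp_def emitted_goal)
qed

lemma instance_correct:
  "((\<exists>f. G.tiling f) \<longrightarrow> emitted x [] instance_em \<in> fst multiple_factorization_problem) \<and>
   ((\<nexists>f. G.tiling f) \<longrightarrow> emitted x [] instance_em \<in> snd multiple_factorization_problem)"
proof -
  have "\<forall>y\<in>set G.items. y > 0" using G.item_pos by (auto simp: G.items_def)
  from knapsack_instance[OF G.goal_pos G.distinct_items this emitted_instance]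
  show ?thesis unfolding G.knapsack_iff_tiling .
qed

end

end

section \<open>From computations to tilings\<close>

text \<open>Accepting halting configurations are repeated, so that acceptance in bounded time becomes the
  existence of a computation of a fixed length.\<close>

definition moves_of :: "tm \<Rightarrow> nat \<Rightarrow> nat list \<Rightarrow> (nat \<times> (nat \<times> move) list) set" where
  "moves_of M q xs = trans M q xs \<union>
     (if trans M q xs = {} \<and> q \<in> accepting M then {(q, map (\<lambda>a. (a, Stay)) xs)} else {})"

definition scanned :: "config \<Rightarrow> nat list" where
  "scanned c = map (\<lambda>(t, h). t h) (snd c)"

definition apply_moves :: "config \<Rightarrow> nat \<times> (nat \<times> move) list \<Rightarrow> config" where
  "apply_moves c m = (fst m, map2 (\<lambda>(t, h) (a, d). (t(h := a), h + shift d)) (snd c) (snd m))"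

definition xstep :: "tm \<Rightarrow> config \<Rightarrow> config \<Rightarrow> bool" where
  "xstep M c c' \<longleftrightarrow> (\<exists>m\<in>moves_of M (fst c) (scanned c). c' = apply_moves c m)"

lemma step_iff: "step M c c' \<longleftrightarrow> (\<exists>m\<in>trans M (fst c) (scanned c). c' = apply_moves c m)"
  by (simp add: step_def scanned_def apply_moves_def case_prod_beta)

lemma halted_iff: "halted M c \<longleftrightarrow> trans M (fst c) (scanned c) = {}"
  unfolding halted_def step_iff by blast

lemma apply_idle: "apply_moves c (fst c, map (\<lambda>a. (a, Stay)) (scanned c)) = c"
proof -
  have "map2 (\<lambda>(t, h) (a, d). (t(h := a), h + shift d)) ts (map (\<lambda>a. (a, Stay)) (map (\<lambda>(t, h). t h) ts)) = ts"
    for ts :: "((int \<Rightarrow> nat) \<times> int) list"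
    by (induction ts) auto
  then show ?thesis by (simp add: apply_moves_def scanned_def)
qed

lemma xstep_iff: "xstep M c c' \<longleftrightarrow> step M c c' \<or> halted M c \<and> fst c \<in> accepting M \<and> c' = c"
  by (auto simp: xstep_def moves_of_def step_iff halted_iff apply_idle split: if_splits)

lemma xsteps_cases:
  "(xstep M ^^ n) c c' \<Longrightarrow> (step M ^^ n) c c' \<or> (\<exists>d. (step M)\<^sup>*\<^sup>* c d \<and> halted M d \<and> fst d \<in> accepting M)"
proof (induction n arbitrary: c')
  case (Suc n)
  then obtain d where d: "(xstep M ^^ n) c d" "xstep M d c'" by (auto elim!: relpowp_Suc_E)
  from Suc.IH[OF d(1)] show ?case
  proof
    assume st: "(step M ^^ n) c d"
    show ?thesis
    proof (cases "step M d c'")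
      case True
      with st show ?thesis by (blast intro: relpowp_Suc_I)
    next
      case False
      with d(2) show ?thesis using relpowp_imp_rtranclp[OF st] unfolding xstep_iff by blast
    qed
  qed blast
qed simp

text \<open>Genuine computations have fewer than \<open>T\<close> steps, so \<open>T\<close>
  extended steps must include a pause, and pauses occur only in accepting halting
  configurations.\<close>

lemma accepts_iff_xsteps:
  assumes "\<And>n c. (step M ^^ n) (init_config M x) c \<Longrightarrow> n < T"
  shows "accepts M x \<longleftrightarrow> (\<exists>c. (xstep M ^^ T) (init_config M x) c)"
proof
  assume "accepts M x"
  then obtain c n where c: "(step M ^^ n) (init_config M x) c" "halted M c" "fst c \<in> accepting M"
    by (auto simp: accepts_def rtranclp_power)
  have "(step M ^^ n) c d \<Longrightarrow> (xstep M ^^ n) c d" for n c d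
  proof (induction n arbitrary: d)
    case (Suc n)
    then obtain e where "(step M ^^ n) c e" "step M e d" by (auto elim!: relpowp_Suc_E)
    with Suc.IH xstep_iff show ?case by (blast intro: relpowp_Suc_I)
  qed simp
  moreover have "(xstep M ^^ j) c c" for j
    using c by (induction j) (auto intro: relpowp_Suc_I simp: xstep_iff)
  ultimately have "(xstep M ^^ (n + (T - n))) (init_config M x) c"
    using c(1) unfolding relpowp_add by blast
  moreover have "n + (T - n) = T" using assms[OF c(1)] by simp
  ultimately show "\<exists>c. (xstep M ^^ T) (init_config M x) c" by metis
next
  assume "\<exists>c. (xstep M ^^ T) (init_config M x) c"
  then show "accepts M x" using xsteps_cases[of T M "init_config M x"] assms unfolding accepts_def by blast
qed

fun poly_exp :: "nat list \<Rightarrow> exp" where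
  "poly_exp [] = Const 0"
| "poly_exp (a # as) = Add (Const a) (Mul Len (poly_exp as))"

lemma eval_poly_exp: "eval x env (poly_exp as) = poly (Poly as) (length x)"
  by (induction as) simp_all

lemma poly_exp_simple: "scoped k (poly_exp as)" "simple (poly_exp as)"
  by (induction as) simp_all

lemma finite_moves: "finite (UNIV :: move set)"
proof -
  have "(UNIV :: move set) = {MoveLeft, Stay, MoveRight}" using move.exhaust by blast
  then show ?thesis by (metis finite.emptyI finite.insertI)
qed

locale bounded_machine =
  fixes M :: tm and T :: nat
  assumes wf: "well_formed M" and T: "T \<ge> 1"
begin

abbreviation k :: nat where "k \<equiv> tapes M"

definition W :: nat where "W = 2 * T + 1"

text \<open>Tapes are folded onto a cycle: column \<open>c\<close> holds the only cell between \<open>-T\<close> and \<open>T\<close> congruent to \<open>c\<close>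
  modulo \<open>W\<close>.\<close>

definition cell :: "nat \<Rightarrow> int" where
  "cell c = (if c \<le> T then int c else int c - int W)"

lemma cell_column: "\<bar>h\<bar> \<le> int T \<Longrightarrow> c < W \<Longrightarrow> h mod int W = int c \<longleftrightarrow> h = cell c"
proof
  assume h: "\<bar>h\<bar> \<le> int T" and c: "c < W" and m: "h mod int W = int c"
  show "h = cell c"
  proof (cases "h \<ge> 0")
    case True
    then have "h mod int W = h" using h by (intro mod_pos_pos_trivial) (auto simp: W_def)
    then show ?thesis using m h by (simp add: cell_def)
  next
    case False
    have "h mod int W = (h + int W) mod int W" by simp
    also have "\<dots> = h + int W" using h False by (intro mod_pos_pos_trivial) (auto simp: W_def)
    finally show ?thesis using m h False by (auto simp: cell_def W_def)
  qed
next
  assume h: "\<bar>h\<bar> \<le> int T" and c: "c < W" and "h = cell c"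
  then have "h mod int W = int c mod int W" by (simp add: cell_def)
  then show "h mod int W = int c" using c by simp
qed

lemma succ_column: "(h + 1) mod int W = int (Suc c mod W) \<longleftrightarrow> h mod int W = int c" if "c < W"
proof -
  have "(h + 1) mod int W = int (Suc c mod W) \<longleftrightarrow> (h + 1) mod int W = (int c + 1) mod int W"
    by (simp add: zmod_int add.commute)
  also have "\<dots> \<longleftrightarrow> h mod int W = int c mod int W"
    unfolding mod_eq_dvd_iff by simp
  finally show ?thesis using that by simp
qed

definition tape_of :: "config \<Rightarrow> nat \<Rightarrow> int \<Rightarrow> nat" where
  "tape_of c i = fst (snd c ! i)"

definition head_of :: "config \<Rightarrow> nat \<Rightarrow> int" where
  "head_of c i = snd (snd c ! i)"

definition good :: "nat \<Rightarrow> config \<Rightarrow> bool" where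
  "good t c \<longleftrightarrow> fst c < states M \<and> length (snd c) = k \<and>
     (\<forall>i<k. \<bar>head_of c i\<bar> \<le> int t \<and> (\<forall>j. tape_of c i j < symbols M))"

lemma scanned_nth: "good t c \<Longrightarrow> i < k \<Longrightarrow> scanned c ! i = tape_of c i (head_of c i)"
  by (simp add: good_def scanned_def tape_of_def head_of_def case_prod_beta)

lemma scanned_good: "good t c \<Longrightarrow> length (scanned c) = k \<and> set (scanned c) \<subseteq> {..<symbols M}"
proof -
  assume g: "good t c"
  have "length (scanned c) = k" using g by (simp add: good_def scanned_def)
  then show ?thesis using scanned_nth[OF g] g by (auto simp: in_set_conv_nth good_def)
qed

text \<open>The scanned symbols are part of a transition, so that single columns can check them. The
  restriction to legal states and symbols gives finiteness by \<open>well_formed\<close>.\<close>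

definition transitions :: "(nat \<times> nat list \<times> nat \<times> (nat \<times> move) list) set" where
  "transitions = {(q, xs, m). q < states M \<and> length xs = k \<and> set xs \<subseteq> {..<symbols M} \<and> m \<in> moves_of M q xs}"

lemma moves_wf:
  assumes "(q, xs, m) \<in> transitions"
  shows "fst m < states M \<and> length (snd m) = k \<and> set (snd m) \<subseteq> {..<symbols M} \<times> UNIV"
proof (cases "m \<in> trans M q xs")
  case True
  have "q < states M" "length xs = k \<and> set xs \<subseteq> {..<symbols M}" using assms by (simp_all add: transitions_def)
  then have "\<forall>(q', acts) \<in> trans M q xs. q' < states M \<and> length acts = k \<and> fst ` set acts \<subseteq> {..<symbols M}"
    using wf unfolding well_formed_def by blast
  from bspec[OF this True] show ?thesis by (cases m) (auto simp: image_subset_iff)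
next
  case False
  then show ?thesis using assms unfolding transitions_def by (auto simp: moves_of_def split: if_splits)
qed

lemma finite_transitions: "finite transitions"
proof (rule finite_subset)
  show "transitions \<subseteq> {..<states M} \<times> {xs. set xs \<subseteq> {..<symbols M} \<and> length xs = k} \<times>
      {..<states M} \<times> {as. set as \<subseteq> {..<symbols M} \<times> UNIV \<and> length as = k}"
  proof
    fix \<tau> assume \<tau>: "\<tau> \<in> transitions"
    obtain q xs m where eq: "\<tau> = (q, xs, m)" by (cases \<tau>)
    show "\<tau> \<in> {..<states M} \<times> {xs. set xs \<subseteq> {..<symbols M} \<and> length xs = k} \<times>
        {..<states M} \<times> {as. set as \<subseteq> {..<symbols M} \<times> UNIV \<and> length as = k}"
      using \<tau> moves_wf[of q xs m] unfolding eq by (cases m) (auto simp: transitions_def)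
  qed
qed (intro finite_cartesian_product finite_lists_length_eq finite_moves finite_lessThan)

lemma head_apply:
  assumes "good t c" "length (snd m) = k" "i < k"
  shows "head_of (apply_moves c m) i = head_of c i + shift (snd (snd m ! i))"
    and "tape_of (apply_moves c m) i = (tape_of c i)(head_of c i := fst (snd m ! i))"
  using assms by (simp_all add: good_def head_of_def tape_of_def apply_moves_def case_prod_beta)

lemma good_apply:
  assumes g: "good t c" and m: "m \<in> moves_of M (fst c) (scanned c)"
  shows "(fst c, scanned c, m) \<in> transitions" and "good (Suc t) (apply_moves c m)"
proof -
  show tr: "(fst c, scanned c, m) \<in> transitions"
    using g m scanned_good[OF g] by (auto simp: transitions_def good_def)
  have mw: "fst m < states M" "length (snd m) = k" "set (snd m) \<subseteq> {..<symbols M} \<times> UNIV"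
    using moves_wf[OF tr] by auto
  have "fst (snd m ! i) < symbols M" if "i < k" for i
  proof -
    have "snd m ! i \<in> {..<symbols M} \<times> UNIV" using mw(2,3) nth_mem[of i "snd m"] that by (metis subsetD)
    then show ?thesis by (simp add: mem_Times_iff)
  qed
  moreover have "\<bar>head_of c i + shift d\<bar> \<le> int (Suc t)" if "i < k" for i d
  proof -
    have "\<bar>head_of c i\<bar> \<le> int t" using g that by (simp add: good_def)
    moreover have "\<bar>shift d\<bar> \<le> 1" by (cases d) auto
    ultimately show ?thesis by linarith
  qed
  ultimately show "good (Suc t) (apply_moves c m)"
    using g mw head_apply[OF g mw(2)] by (auto simp: good_def apply_moves_def)
qed

text \<open>Vertical colors record the state and, for each tape, the symbol of the column and whether the head
  is there. Horizontal colors carry the transition of the row along and, for each tape, whether the head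
  crosses this edge.\<close>

definition column :: "config \<Rightarrow> nat \<Rightarrow> nat \<times> (nat \<times> bool) list" where
  "column c j = (fst c, map (\<lambda>i. (tape_of c i (cell j), head_of c i mod int W = int j)) [0..<k])"

text \<open>Edge \<open>j\<close> is the left edge of column \<open>j\<close>: a head moving right
  crosses it on entering the column, a head moving left on leaving it.\<close>

definition crossing :: "config \<Rightarrow> nat \<times> (nat \<times> move) list \<Rightarrow> nat \<Rightarrow> bool list" where
  "crossing c m j = map (\<lambda>i. case snd (snd m ! i) of
      MoveRight \<Rightarrow> (head_of c i + 1) mod int W = int j
    | MoveLeft \<Rightarrow> head_of c i mod int W = int j
    | Stay \<Rightarrow> False) [0..<k]"

definition vset :: "(nat \<times> (nat \<times> bool) list) set" where
  "vset = {..<states M} \<times> {cs. set cs \<subseteq> {..<symbols M} \<times> UNIV \<and> length cs = k}"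

definition hset :: "((nat \<times> nat list \<times> nat \<times> (nat \<times> move) list) \<times> bool list) set" where
  "hset = transitions \<times> {bs. set bs \<subseteq> UNIV \<and> length bs = k}"

text \<open>What a single column can check. The transition passes unchanged from left to right, so
  the whole row agrees on it, and the symbol scanned on a tape is verified in the column of its
  head.\<close>

definition compatible where
  "compatible z \<longleftrightarrow> (case z of ((\<tau>, ls), (q, cs), (\<tau>', rs)) \<Rightarrow> \<tau>' = \<tau> \<and> fst \<tau> = q \<and>
     (\<forall>i<k. (snd (cs ! i) \<longrightarrow> fst (cs ! i) = fst (snd \<tau>) ! i) \<and>
       (snd (snd (snd (snd \<tau>)) ! i) = MoveRight \<longrightarrow> rs ! i = snd (cs ! i)) \<and>
       (snd (snd (snd (snd \<tau>)) ! i) = MoveLeft \<longrightarrow> ls ! i = snd (cs ! i))))"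

definition tile_set where
  "tile_set = {z \<in> hset \<times> vset \<times> hset. compatible z}"

text \<open>A head that moves right arrives through the left edge \<open>ls\<close>, one that moves
  left through the right edge \<open>rs\<close>.\<close>

definition top_color where
  "top_color z = (case z of ((\<tau>, ls), (q, cs), (\<tau>', rs)) \<Rightarrow>
     (fst (snd (snd \<tau>)),
      map (\<lambda>i. (if snd (cs ! i) then fst (snd (snd (snd \<tau>)) ! i) else fst (cs ! i),
        case snd (snd (snd (snd \<tau>)) ! i) of MoveRight \<Rightarrow> ls ! i | MoveLeft \<Rightarrow> rs ! i | Stay \<Rightarrow> snd (cs ! i))) [0..<k]))"

text \<open>It uses \<open>int c\<close> instead of \<open>cell c\<close> and so does not depend on
  \<open>T\<close>; for \<open>length x \<le> T\<close> both give a blank in the columns beyond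
  \<open>T\<close>.\<close>

definition initial_color :: "bool list \<Rightarrow> nat \<Rightarrow> nat \<times> (nat \<times> bool) list" where
  "initial_color x c = (initial M, map (\<lambda>i. (if i = 0 then input_tape x (int c) else 0, c = 0)) [0..<k])"

lemma column_apply:
  assumes g: "good t c" and t: "t \<le> T" and m: "length (snd m) = k" and j: "j < W"
  shows "column (apply_moves c m) j = (fst m, map (\<lambda>i.
    (if head_of c i mod int W = int j then fst (snd m ! i) else tape_of c i (cell j),
     case snd (snd m ! i) of MoveRight \<Rightarrow> (head_of c i + 1) mod int W = int j
       | MoveLeft \<Rightarrow> head_of c i mod int W = int (Suc j mod W)
       | Stay \<Rightarrow> head_of c i mod int W = int j)) [0..<k])"
proof -
  have "\<bar>head_of c i\<bar> \<le> int T" if "i < k" for i using g t that by (force simp: good_def)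
  then have "head_of c i mod int W = int j \<longleftrightarrow> head_of c i = cell j" if "i < k" for i
    using that cell_column[OF _ j] by blast
  moreover have "(h - 1) mod int W = int j \<longleftrightarrow> h mod int W = int (Suc j mod W)" for h
    using succ_column[OF j, of "h - 1"] by simp
  moreover have "fst (apply_moves c m) = fst m" by (simp add: apply_moves_def)
  ultimately show ?thesis
    by (auto simp: column_def head_apply[OF g m] split: move.split)
qed

lemma finite_vset: "finite vset"
  unfolding vset_def by (intro finite_cartesian_product finite_lists_length_eq) auto

lemma finite_hset: "finite hset" unfolding hset_def
  by (intro finite_cartesian_product finite_lists_length_eq finite_transitions) auto

lemma finite_tile_set: "finite tile_set"
  unfolding tile_set_def using finite_vset finite_hset by simp

lemma tile_set_colors:
  assumes "z \<in> tile_set"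
  shows "fst z \<in> hset \<and> fst (snd z) \<in> vset \<and> snd (snd z) \<in> hset \<and> top_color z \<in> vset"
proof -
  obtain q xs m ls q0 cs \<tau>' rs where z: "z = (((q, xs, m), ls), (q0, cs), (\<tau>', rs))"
    by (metis prod.collapse)
  have tr: "(q, xs, m) \<in> transitions" and cs: "set cs \<subseteq> {..<symbols M} \<times> UNIV" "length cs = k"
    using assms by (auto simp: z tile_set_def hset_def vset_def)
  note mw = moves_wf[OF tr]
  have "fst (cs ! i) < symbols M \<and> fst (snd m ! i) < symbols M" if "i < k" for i
    using nth_mem[of i cs] nth_mem[of i "snd m"] cs mw that by (metis lessThan_iff mem_Times_iff subsetD)
  then have "top_color z \<in> vset" using mw by (auto simp: z top_color_def vset_def)
  then show ?thesis using assms by (auto simp: tile_set_def)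
qed

lemma initial_color_vset: "initial_color x c \<in> vset"
  using wf input_tape_less[of x "int c"] by (auto simp: initial_color_def vset_def well_formed_def)

lemma init_nth: "i < k \<Longrightarrow> snd (init_config M x) ! i = (if i = 0 then input_tape x else (\<lambda>_. 0), 0)"
  by (cases i) (simp_all add: init_config_def)

lemma init_good: "good 0 (init_config M x)"
proof -
  have "length (snd (init_config M x)) = k" using wf by (simp add: init_config_def well_formed_def)
  moreover have "fst (init_config M x) < states M" "symbols M \<ge> 3"
    using wf by (simp_all add: init_config_def well_formed_def)
  moreover have "input_tape x j < symbols M" for j using input_tape_less[of x j] \<open>symbols M \<ge> 3\<close> by linarith
  ultimately show ?thesis by (simp add: good_def head_of_def tape_of_def init_nth)
qed

lemma init_column:
  assumes "length x \<le> T" "j < W"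
  shows "column (init_config M x) j = initial_color x j"
proof -
  have "input_tape x (cell j) = input_tape x (int j)"
    using assms by (auto simp: cell_def input_tape_def W_def)
  then show ?thesis
    by (auto simp: column_def initial_color_def head_of_def tape_of_def init_nth init_config_def)
qed

lemma xsteps_good: "(xstep M ^^ t) (init_config M x) c \<Longrightarrow> good t c"
proof (induction t arbitrary: c)
  case (Suc t)
  then obtain d where "(xstep M ^^ t) (init_config M x) d" "xstep M d c" by (auto elim!: relpowp_Suc_E)
  then obtain m where "m \<in> moves_of M (fst d) (scanned d)" "c = apply_moves d m" "good t d"
    using Suc.IH unfolding xstep_def by blast
  then show ?case using good_apply(2) by simp
qed (use init_good in simp)

section \<open>Tilings and computations of fixed length\<close>

definition tile_at where
  "tile_at c m j = (((fst c, scanned c, m), crossing c m j), column c j,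
     ((fst c, scanned c, m), crossing c m (Suc j mod W)))"

lemma tile_at:
  assumes g: "good t c" and t: "t \<le> T" and m: "m \<in> moves_of M (fst c) (scanned c)" and j: "j < W"
  shows "tile_at c m j \<in> tile_set" and "top_color (tile_at c m j) = column (apply_moves c m) j"
proof -
  have tr: "(fst c, scanned c, m) \<in> transitions" by (rule good_apply(1)[OF g m])
  have len: "length (snd m) = k" using moves_wf[OF tr] by simp
  have cell: "head_of c i mod int W = int j \<Longrightarrow> tape_of c i (cell j) = scanned c ! i" if "i < k" for i
    using cell_column[of "head_of c i" j] scanned_nth[OF g that] g t j that by (force simp: good_def)
  have "column c j \<in> vset" using g by (auto simp: column_def vset_def good_def)
  moreover have "(((fst c, scanned c, m), crossing c m j)) \<in> hset" for j
    using tr by (auto simp: hset_def crossing_def)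
  moreover have "compatible (tile_at c m j)"
    using cell succ_column[OF j] by (auto simp: compatible_def tile_at_def column_def crossing_def)
  ultimately show "tile_at c m j \<in> tile_set" by (simp add: tile_set_def tile_at_def)
  show "top_color (tile_at c m j) = column (apply_moves c m) j"
    unfolding column_apply[OF g t len j]
    by (auto simp: top_color_def tile_at_def column_def crossing_def split: move.split)
qed

definition accepting_tiling where
  "accepting_tiling x f \<longleftrightarrow> (\<forall>t<T. \<forall>j<W. f t j \<in> tile_set \<and> fst (f t (Suc j mod W)) = snd (snd (f t j)) \<and>
     fst (snd (f t j)) = (if t = 0 then initial_color x j else top_color (f (t - 1) j)))"

lemma tiling_of_computation:
  assumes x: "length x \<le> T" and run: "(xstep M ^^ T) (init_config M x) c"
  shows "\<exists>f. accepting_tiling x f"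
proof -
  from run obtain F where F: "F 0 = init_config M x" "\<And>i. i < T \<Longrightarrow> xstep M (F i) (F (Suc i))"
    unfolding relpowp_fun_conv by blast
  have "(xstep M ^^ t) (init_config M x) (F t)" if "t \<le> T" for t
    using that by (induction t) (use F in \<open>auto intro: relpowp_Suc_I\<close>)
  then have g: "good t (F t)" if "t \<le> T" for t using xsteps_good that by blast
  have "\<forall>t. \<exists>m. t < T \<longrightarrow> m \<in> moves_of M (fst (F t)) (scanned (F t)) \<and> F (Suc t) = apply_moves (F t) m"
    using F(2) unfolding xstep_def by blast
  then obtain m where m: "\<And>t. t < T \<Longrightarrow> m t \<in> moves_of M (fst (F t)) (scanned (F t))"
    "\<And>t. t < T \<Longrightarrow> F (Suc t) = apply_moves (F t) (m t)" by metis
  define f where "f t j = tile_at (F t) (m t) j" for t j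
  have "accepting_tiling x f" unfolding accepting_tiling_def
  proof (intro allI impI conjI)
    fix t j assume t: "t < T" and j: "j < W"
    show "f t j \<in> tile_set" unfolding f_def using g[of t] m(1) t j by (intro tile_at) auto
    show "fst (f t (Suc j mod W)) = snd (snd (f t j))" by (simp add: f_def tile_at_def)
    have b: "fst (snd (f t j)) = column (F t) j" by (simp add: f_def tile_at_def)
    show "fst (snd (f t j)) = (if t = 0 then initial_color x j else top_color (f (t - 1) j))"
    proof (cases t)
      case 0
      then show ?thesis using b F(1) init_column[OF x j] by simp
    next
      case (Suc s)
      have "top_color (f s j) = column (F (Suc s)) j"
        unfolding f_def using g[of s] m[of s] t j Suc by (subst tile_at(2)) auto
      then show ?thesis using b Suc by simp
    qed
  qed
  then show ?thesis by blast
qed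

text \<open>Every head is in some column, namely its position modulo \<open>W\<close>, and there its
  symbol is compared.\<close>

lemma column_scanned:
  assumes g: "good t c" and t: "t \<le> T" and xs: "length xs = k"
    and match: "\<And>i j. i < k \<Longrightarrow> j < W \<Longrightarrow> snd (snd (column c j) ! i) \<Longrightarrow> fst (snd (column c j) ! i) = xs ! i"
  shows "xs = scanned c"
proof (rule nth_equalityI)
  show "length xs = length (scanned c)" using xs scanned_good[OF g] by simp
  fix i assume "i < length xs"
  then have i: "i < k" using xs by simp
  define j where "j = nat (head_of c i mod int W)"
  have W: "int W > 0" by (simp add: W_def)
  then have j: "j < W" "head_of c i mod int W = int j"
    using pos_mod_bound[OF W, of "head_of c i"] pos_mod_sign[OF W, of "head_of c i"] by (simp_all add: j_def nat_less_iff)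
  have "\<bar>head_of c i\<bar> \<le> int T" using g t i by (force simp: good_def)
  then have "head_of c i = cell j" using cell_column j by blast
  then show "xs ! i = scanned c ! i"
    using match[OF i j(1)] j(2) scanned_nth[OF g i] i by (simp add: column_def)
qed

text \<open>Row by row, the bottom colors are the columns of a reachable configuration. The
  transition carried by the row is then applicable to it, and the top colors are the columns of its
  successor.\<close>

lemma computation_of_tiling:
  assumes x: "length x \<le> T" and f: "accepting_tiling x f"
  shows "\<exists>c. (xstep M ^^ T) (init_config M x) c"
proof -
  have tl: "f t j \<in> tile_set" "fst (f t (Suc j mod W)) = snd (snd (f t j))"
    "fst (snd (f t j)) = (if t = 0 then initial_color x j else top_color (f (t - 1) j))"
    if "t < T" "j < W" for t j using f that unfolding accepting_tiling_def by blast+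
  have W: "W > 0" by (simp add: W_def)
  have "\<exists>c. (xstep M ^^ t) (init_config M x) c \<and> (t < T \<longrightarrow> (\<forall>j<W. fst (snd (f t j)) = column c j))"
    if "t \<le> T" for t
    using that
  proof (induction t)
    case 0
    then show ?case using tl(3)[of 0] init_column[OF x] by (intro exI[of _ "init_config M x"]) simp
  next
    case (Suc t)
    then have t: "t < T" by simp
    obtain c where c: "(xstep M ^^ t) (init_config M x) c" "\<And>j. j < W \<Longrightarrow> fst (snd (f t j)) = column c j"
      using Suc.IH t by auto
    have g: "good t c" by (rule xsteps_good[OF c(1)])
    obtain q xs m where \<tau>: "fst (fst (f t 0)) = (q, xs, m)" by (cases "fst (fst (f t 0))")
    have comp: "fst (snd (snd (f t j))) = fst (fst (f t j)) \<and> fst (fst (fst (f t j))) = fst (column c j) \<and>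
        (\<forall>i<k. (snd (snd (column c j) ! i) \<longrightarrow> fst (snd (column c j) ! i) = fst (snd (fst (fst (f t j)))) ! i) \<and>
       (snd (snd (snd (snd (fst (fst (f t j))))) ! i) = MoveRight \<longrightarrow> snd (snd (snd (f t j))) ! i = snd (snd (column c j) ! i)) \<and>
       (snd (snd (snd (snd (fst (fst (f t j))))) ! i) = MoveLeft \<longrightarrow> snd (fst (f t j)) ! i = snd (snd (column c j) ! i)))"
      if "j < W" for j
      using tl(1)[OF t that] c(2)[OF that, symmetric]
      by (simp add: tile_set_def compatible_def case_prod_beta)
    \<comment> \<open>Each tile hands its transition on unchanged and adjacent edges agree, so the
      one of column 0 governs the row.\<close>
    have row: "fst (fst (f t j)) = (q, xs, m)" if "j < W" for j
      using that
    proof (induction j)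
      case (Suc j)
      then show ?case using tl(2)[OF t, of j] comp[of j] by simp
    qed (rule \<tau>)
    have tr: "(q, xs, m) \<in> transitions" using tl(1)[OF t W] \<tau> by (auto simp: tile_set_def hset_def)
    have q: "q = fst c" using comp[OF W] \<tau> by (simp add: column_def)
    have xs: "xs = scanned c"
    proof (rule column_scanned[OF g])
      show "length xs = k" using tr by (simp add: transitions_def)
      show "fst (snd (column c j) ! i) = xs ! i" if "i < k" "j < W" "snd (snd (column c j) ! i)" for i j
        using comp[OF that(2)] row[OF that(2)] that by simp
    qed (use t in simp)
    have m: "m \<in> moves_of M (fst c) (scanned c)" using tr q xs by (simp add: transitions_def)
    have len: "length (snd m) = k" using moves_wf[OF tr] by simp
    have "(xstep M ^^ Suc t) (init_config M x) (apply_moves c m)"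
    proof (rule relpowp_Suc_I[OF c(1)])
      show "xstep M c (apply_moves c m)" using m unfolding xstep_def by blast
    qed
    moreover have "fst (snd (f (Suc t) j)) = column (apply_moves c m) j" if st: "Suc t < T" and j: "j < W" for j
    proof -
      \<comment> \<open>The crossing bit at the left edge is dictated by the left neighbor, which
        sets it exactly if it holds the head.\<close>
      have right: "snd (fst (f t j)) ! i \<longleftrightarrow> (head_of c i + 1) mod int W = int j"
        if i: "i < k" "snd (snd m ! i) = MoveRight" for i
      proof -
        obtain j' where j': "j' < W" "Suc j' mod W = j"
        proof (cases j)
          case 0
          then show ?thesis using that[of "W - 1"] W by simp
        next
          case (Suc j')
          then show ?thesis using that[of j'] j by simp
        qed
        have "snd (fst (f t j)) ! i = snd (snd (column c j') ! i)"
          using comp[OF j'(1)] tl(2)[OF t j'(1)] row[OF j'(1)] j'(2) i by simp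
        then show ?thesis using succ_column[OF j'(1), of "head_of c i"] j'(2) i by (simp add: column_def)
      qed
      have left: "snd (snd (snd (f t j))) ! i \<longleftrightarrow> head_of c i mod int W = int (Suc j mod W)"
        if i: "i < k" "snd (snd m ! i) = MoveLeft" for i
      proof -
        have j': "Suc j mod W < W" using W by simp
        have "snd (fst (f t (Suc j mod W))) ! i = snd (snd (column c (Suc j mod W)) ! i)"
          using comp[OF j'] row[OF j'] i by simp
        then show ?thesis using tl(2)[OF t j] i by (simp add: column_def)
      qed
      have "fst (snd (f (Suc t) j)) = top_color (f t j)" using tl(3)[OF st j] by simp
      also have "\<dots> = column (apply_moves c m) j"
        unfolding column_apply[OF g less_imp_le[OF t] len j]
        using row[OF j] c(2)[OF j] right left
        by (auto simp: top_color_def case_prod_beta column_def split: move.split)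
      finally show ?thesis .
    qed
    ultimately show ?case by blast
  qed
  then show ?thesis by blast
qed

end

section \<open>NP-hardness\<close>

text \<open>The color \<open>v\<close> is known when the program is built, so its shape is checked
  then: the common head mark \<open>b\<close>, and blanks on all tapes but the first. At run time
  only \<open>c = 0\<close> and the input symbol of column \<open>c\<close> are tested.\<close>

definition initial_em :: "tm \<Rightarrow> nat \<times> (nat \<times> bool) list \<Rightarrow> em" where
  "initial_em M v = (let b = snd (snd v ! 0); s = fst (snd v ! 0);
       e = IfEq (In (Var 1)) (Const s) (Out [True, True]) (Out [True, False]) in
     if v = (initial M, map (\<lambda>i. (if i = 0 then s else 0, b)) [0..<tapes M])
     then IfEq (Var 1) (Const 0) (if b then e else Out [True, False]) (if b then Out [True, False] else e)
     else Out [True, False])"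

lemma emitted_initial_em:
  assumes "bounded_machine M T"
  shows "emitted x [t, c] (initial_em M v) = [True, v = bounded_machine.initial_color M x c]"
proof -
  interpret bounded_machine M T by fact
  have k: "tapes M \<ge> 1" using wf by (simp add: well_formed_def)
  define row where "row s b = (initial M, map (\<lambda>i. (if i = 0 then s else 0 :: nat, b :: bool)) [0..<tapes M])" for s b
  have row0: "snd (row s b) ! 0 = (s, b)" for s b using k by (simp add: row_def)
  have row_eq: "row s b = row s' b' \<longleftrightarrow> s = s' \<and> b = b'" for s b s' b'
  proof
    assume "row s b = row s' b'"
    then have "snd (row s b) ! 0 = snd (row s' b') ! 0" by (simp only:)
    then show "s = s' \<and> b = b'" unfolding row0 by simp
  qed simp
  have init: "initial_color x c = row (input_tape x (int c)) (c = 0)"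
    by (simp add: initial_color_def row_def)
  define b s where "b = snd (snd v ! 0)" and "s = fst (snd v ! 0)"
  have em: "initial_em M v = (if v = row s b
     then IfEq (Var 1) (Const 0) (if b then IfEq (In (Var 1)) (Const s) (Out [True, True]) (Out [True, False]) else Out [True, False])
       (if b then Out [True, False] else IfEq (In (Var 1)) (Const s) (Out [True, True]) (Out [True, False]))
     else Out [True, False])"
    unfolding initial_em_def Let_def b_def s_def row_def ..
  show ?thesis
  proof (cases "v = row s b")
    case True
    then have "v = initial_color x c \<longleftrightarrow> s = input_tape x (int c) \<and> b = (c = 0)"
      unfolding init using row_eq by metis
    with True show ?thesis unfolding em by (cases b; cases "c = 0") auto
  next
    case False
    then have "v \<noteq> initial_color x c" unfolding init b_def s_def using row0 by (metis prod.sel)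
    with False show ?thesis unfolding em by simp
  qed
qed

theorem NP_hard_multiple_factorization: "NP_hard multiple_factorization_problem"
proof -
  have "\<exists>f. polytime_computable f \<and> (\<forall>x. (x \<in> L \<longrightarrow> f x \<in> fst multiple_factorization_problem) \<and>
      (x \<notin> L \<longrightarrow> f x \<in> snd multiple_factorization_problem))" if "L \<in> NP" for L
  proof -
    from that obtain M and p :: "nat poly" where M: "well_formed M"
      "\<And>x n c. (step M ^^ n) (init_config M x) c \<Longrightarrow> n \<le> poly p (length x)"
      "\<And>x. x \<in> L \<longleftrightarrow> accepts M x" unfolding NP_def by blast
    \<comment> \<open>The summand \<open>length x\<close> makes the input fit between cells 0 and
      \<open>T\<close>; \<open>+ 1\<close> makes the time bound strict and \<open>T\<close>
      positive.\<close>
    define T where "T x = poly p (length x) + length x + 1" for x :: "bool list"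
    define Te where "Te = Add (Add (poly_exp (coeffs p)) Len) (Const 1)"
    define We where "We = Add (Mul (Const 2) Te) (Const 1)"
    have BM: "bounded_machine M (T x)" for x by standard (simp_all add: M(1) T_def)
    \<comment> \<open>Colors, tiles and initial row depend on the machine but not on the time bound,
      so interpreting them at the empty input provides them for all inputs.\<close>
    interpret B: bounded_machine M "T []" by (rule BM)
    obtain vs where vs: "set vs = B.vset" using B.finite_vset finite_list by blast
    obtain hs where hs: "set hs = B.hset" using B.finite_hset finite_list by blast
    obtain tiles where tiles: "set tiles = B.tile_set" "distinct tiles"
      using B.finite_tile_set finite_distinct_list by blast
    have Te: "eval x env Te = T x" for x env by (simp add: Te_def T_def eval_poly_exp)
    have W: "bounded_machine.W (T x) = 2 * T x + 1" for x by (rule bounded_machine.W_def[OF BM])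
    have We: "eval x env We = bounded_machine.W (T x)" for x env by (simp add: We_def Te W)
    have scoped: "scoped k Te" "simple Te" "scoped k We" "simple We" for k
      by (simp_all add: Te_def We_def poly_exp_simple)
    have adm: "admissible 2 (initial_em M v)" for v by (simp add: initial_em_def Let_def)
    have ge: "T x \<ge> 1" "bounded_machine.W (T x) \<ge> 2" for x unfolding W by (simp_all add: T_def)
    have grid: "tile_grid vs hs tiles B.top_color (T x) (bounded_machine.W (T x)) (B.initial_color x)" for x
      using B.tile_set_colors B.initial_color_vset tiles vs hs ge[of x]
      by unfold_locales auto
    have "tiling_reduction vs hs tiles B.top_color Te We T (\<lambda>x. bounded_machine.W (T x))
        B.initial_color (initial_em M)"
      by (intro tiling_reduction.intro grid Te We scoped emitted_initial_em[OF BM] adm)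
    then interpret R: tiling_reduction vs hs tiles B.top_color Te We T "\<lambda>x. bounded_machine.W (T x)"
        B.initial_color "initial_em M" .
    have "x \<in> L \<longleftrightarrow> (\<exists>f. tile_grid.tiling tiles B.top_color (T x) (bounded_machine.W (T x)) (B.initial_color x) f)" for x
    proof -
      have len: "length x \<le> T x" by (simp add: T_def)
      have "n < T x" if "(step M ^^ n) (init_config M x) c" for n c using M(2)[OF that] by (simp add: T_def)
      then have "x \<in> L \<longleftrightarrow> (\<exists>c. (xstep M ^^ T x) (init_config M x) c)"
        unfolding M(3) by (rule accepts_iff_xsteps)
      also have "\<dots> \<longleftrightarrow> (\<exists>f. bounded_machine.accepting_tiling M (T x) x f)"
        using bounded_machine.computation_of_tiling[OF BM len] bounded_machine.tiling_of_computation[OF BM len]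
        by blast
      also have "\<dots> \<longleftrightarrow> (\<exists>f. tile_grid.tiling tiles B.top_color (T x) (bounded_machine.W (T x)) (B.initial_color x) f)"
        unfolding bounded_machine.accepting_tiling_def[OF BM] tile_grid.tiling_def[OF R.grid] tiles(1) ..
      finally show ?thesis .
    qed
    then show ?thesis using R.instance_correct polytime_computable_emitted[OF R.admissible_instance]
      by (intro exI[of _ "\<lambda>x. emitted x [] R.instance_em"]) simp
  qed
  then show ?thesis unfolding NP_hard_def by (simp add: case_prod_beta)
qed

theorem theorem4:
  "decidable multiple_factorization_problem \<and> NP_hard multiple_factorization_problem"
  using decidable_multiple_factorization NP_hard_multiple_factorization ..

end
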